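(* Let $(R,\mathfrak m)$ be a regular local ring with quotient field $F$ and $\dim R\ge 2$, let $\{(R_i,\mathfrak m_i)\}_{i\ge 0}$ be an infinite sequence of local quadratic transforms with $R_0=R$, let $S=\bigcup_{i\ge0}R_i$ with maximal ideal $N=\bigcup_i\mathfrak m_i$, let $x\in S$ be such that $xS$ is $N$-primary, let $T$ be the Noetherian hull of $S$ and assume $T$ is a localization of $R$, and let $S^*$ be the complete integral closure of $S$. The following are equivalent: (1) $S$ is not archimedean; (2) $T$ is a fractional ideal of $S$; (3) $S^*=T$; (4) the boundary valuation ring of $S$ has a nonzero nonmaximal prime ideal that does not lie over $N$; (5) the ideal $\bigcap_{i>0}x^iS$ is a nonzero prime ideal of $S$; (6) there exists $0\ne y\in R$ such that for each $n>0$, $\mathrm{ord}_i(y)\ge n\cdot\mathrm{ord}_i(x)$ for all $i\gg 0$.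
   Context: A local quadratic transform of a regular local ring $(A,\mathfrak n)$ is a local ring $A[\mathfrak n/z]_{\mathfrak q}$ with $z\in\mathfrak n\setminus\mathfrak n^2$ and $\mathfrak q$ a prime ideal of $A[\mathfrak n/z]$ containing $\mathfrak n$. The sequence satisfies: for each $i\ge 0$, $R_{i+1}$ is a local quadratic transform of $R_i$, $R_i\subsetneq R_{i+1}$, and each $R_i$ is a regular local ring of dimension at least $2$ with maximal ideal $\mathfrak m_i$. $\mathrm{ord}_i$ is the order valuation of $R_i$ ($\mathrm{ord}_i(a)=\max\{n:a\in\mathfrak m_i^n\}$ for $0\ne a\in R_i$, extended to $F$ by $\mathrm{ord}_i(a/b)=\mathrm{ord}_i(a)-\mathrm{ord}_i(b)$), with valuation ring $V_i$. The boundary valuation ring of $S$ is the unique valuation ring $V$ with $R\subseteq V\subseteq F$ that is a limit point of $\{V_i\}$ in the patch topology (basic open sets $\{U: G\subseteq U, H\subseteq\mathfrak M_U\}$, $G,H\subseteq F$ finite); equivalently $V=\{q\in F:\mathrm{ord}_i(q)\ge 0\text{ for } i\gg0\}$. The Noetherian hull $T$ of $S$ is the intersection of all DVRs with quotient field $F$ properly containing $S$ (empty intersection $=F$). A domain $A$ is archimedean if $\bigcap_{n>0}a^nA=0$ for every nonunit $a\in A$. The complete integral closure of $S$ is the ring of $\theta\in F$ such that $S[\theta]$ is a fractional ideal of $S$. An ideal is $N$-primary if its radical is $N$. *)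

theory Defs
  imports Main "HOL-Library.Extended_Nat"
begin

text \<open>Throughout, the ambient field F is a type 'a of class field; rings are subsets.\<close>

definition subring :: "'a::field set \<Rightarrow> bool" where
  "subring A \<longleftrightarrow> 0 \<in> A \<and> 1 \<in> A \<and> (\<forall>a\<in>A. \<forall>b\<in>A. a + b \<in> A \<and> a * b \<in> A \<and> - a \<in> A)"

definition has_quotient_field_F :: "'a::field set \<Rightarrow> bool" where
  "has_quotient_field_F A \<longleftrightarrow> (\<forall>q. \<exists>a\<in>A. \<exists>b\<in>A. b \<noteq> 0 \<and> q = a / b)"

definition ideal :: "'a::field set \<Rightarrow> 'a set \<Rightarrow> bool" where
  "ideal A I \<longleftrightarrow> I \<subseteq> A \<and> 0 \<in> I \<and> (\<forall>a\<in>I. \<forall>b\<in>I. a + b \<in> I) \<and> (\<forall>a\<in>I. \<forall>r\<in>A. r * a \<in> I)"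

definition prime_ideal :: "'a::field set \<Rightarrow> 'a set \<Rightarrow> bool" where
  "prime_ideal A P \<longleftrightarrow> ideal A P \<and> P \<noteq> A \<and> (\<forall>a\<in>A. \<forall>b\<in>A. a * b \<in> P \<longrightarrow> a \<in> P \<or> b \<in> P)"

definition maximal_ideal :: "'a::field set \<Rightarrow> 'a set \<Rightarrow> bool" where
  "maximal_ideal A M \<longleftrightarrow> ideal A M \<and> M \<noteq> A \<and> (\<forall>J. ideal A J \<and> M \<subseteq> J \<longrightarrow> J = M \<or> J = A)"

definition local_ring :: "'a::field set \<Rightarrow> bool" where
  "local_ring A \<longleftrightarrow> subring A \<and> (\<exists>!M. maximal_ideal A M)"

definition max_ideal :: "'a::field set \<Rightarrow> 'a set" where
  "max_ideal A = (THE M. maximal_ideal A M)"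

definition gen_ideal :: "'a::field set \<Rightarrow> 'a set \<Rightarrow> 'a set" where
  "gen_ideal A G = \<Inter>{J. ideal A J \<and> G \<subseteq> J}"

definition noetherian :: "'a::field set \<Rightarrow> bool" where
  "noetherian A \<longleftrightarrow> subring A \<and> (\<forall>I. ideal A I \<longrightarrow> (\<exists>G. finite G \<and> G \<subseteq> I \<and> I = gen_ideal A G))"

definition krull_dim :: "'a::field set \<Rightarrow> enat" where
  "krull_dim A = Sup {enat n | n. \<exists>P :: nat \<Rightarrow> 'a set.
      (\<forall>i\<le>n. prime_ideal A (P i)) \<and> (\<forall>i<n. P i \<subset> P (Suc i))}"

definition regular_local :: "'a::field set \<Rightarrow> bool" where
  "regular_local A \<longleftrightarrow> local_ring A \<and> noetherian A \<and>
     (\<exists>d G. krull_dim A = enat d \<and> finite G \<and> card G = d \<and> G \<subseteq> max_ideal A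
            \<and> max_ideal A = gen_ideal A G)"

inductive_set ideal_prod :: "'a::field set \<Rightarrow> 'a set \<Rightarrow> 'a set" for I J where
  zero: "0 \<in> ideal_prod I J"
| mult: "i \<in> I \<Longrightarrow> j \<in> J \<Longrightarrow> i * j \<in> ideal_prod I J"
| add: "a \<in> ideal_prod I J \<Longrightarrow> b \<in> ideal_prod I J \<Longrightarrow> a + b \<in> ideal_prod I J"

primrec ideal_pow :: "'a::field set \<Rightarrow> 'a set \<Rightarrow> nat \<Rightarrow> 'a set" where
  "ideal_pow A I 0 = A"
| "ideal_pow A I (Suc n) = ideal_prod I (ideal_pow A I n)"

definition ordR :: "'a::field set \<Rightarrow> 'a \<Rightarrow> nat" where
  "ordR A a = (GREATEST n. a \<in> ideal_pow A (max_ideal A) n)"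

definition ordF :: "'a::field set \<Rightarrow> 'a \<Rightarrow> int" where
  "ordF A q = (if q = 0 then 0 else
     (THE k. \<exists>b\<in>A. \<exists>c\<in>A. b \<noteq> 0 \<and> c \<noteq> 0 \<and> q = b / c \<and> k = int (ordR A b) - int (ordR A c)))"

definition ring_adjoin :: "'a::field set \<Rightarrow> 'a set \<Rightarrow> 'a set" where
  "ring_adjoin A X = \<Inter>{B. subring B \<and> A \<union> X \<subseteq> B}"

definition localize_at :: "'a::field set \<Rightarrow> 'a set \<Rightarrow> 'a set" where
  "localize_at A P = {a / b | a b. a \<in> A \<and> b \<in> A - P}"

definition local_quadratic_transform :: "'a::field set \<Rightarrow> 'a set \<Rightarrow> bool" where
  "local_quadratic_transform A B \<longleftrightarrow>
     (\<exists>z. z \<in> max_ideal A - ideal_pow A (max_ideal A) 2 \<and>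
       (let C = ring_adjoin A {a / z | a. a \<in> max_ideal A} in
         \<exists>q. prime_ideal C q \<and> max_ideal A \<subseteq> q \<and> B = localize_at C q))"

definition valuation_ring :: "'a::field set \<Rightarrow> bool" where
  "valuation_ring V \<longleftrightarrow> subring V \<and> (\<forall>x. x \<noteq> 0 \<longrightarrow> x \<in> V \<or> inverse x \<in> V)"

definition DVR :: "'a::field set \<Rightarrow> bool" where
  "DVR V \<longleftrightarrow> valuation_ring V \<and> noetherian V \<and> V \<noteq> UNIV"

definition noetherian_hull :: "'a::field set \<Rightarrow> 'a set" where
  "noetherian_hull S = \<Inter>{V. DVR V \<and> S \<subset> V}"

definition is_localization_of :: "'a::field set \<Rightarrow> 'a set \<Rightarrow> bool" where
  "is_localization_of T R \<longleftrightarrow> (\<exists>U. U \<subseteq> R \<and> 1 \<in> U \<and> 0 \<notin> U \<and>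
      (\<forall>u\<in>U. \<forall>v\<in>U. u * v \<in> U) \<and> T = {r / u | r u. r \<in> R \<and> u \<in> U})"

definition unit_of :: "'a::field set \<Rightarrow> 'a \<Rightarrow> bool" where
  "unit_of A a \<longleftrightarrow> a \<in> A \<and> (\<exists>b\<in>A. a * b = 1)"

definition principal :: "'a::field set \<Rightarrow> 'a \<Rightarrow> 'a set" where
  "principal A a = {a * s | s. s \<in> A}"

definition archimedean :: "'a::field set \<Rightarrow> bool" where
  "archimedean A \<longleftrightarrow> (\<forall>a\<in>A. \<not> unit_of A a \<longrightarrow> (\<Inter>n\<in>{0<..}. principal A (a ^ n)) = {0})"

definition radical :: "'a::field set \<Rightarrow> 'a set \<Rightarrow> 'a set" where
  "radical A I = {a \<in> A. \<exists>n. a ^ n \<in> I}"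

definition fractional_ideal :: "'a::field set \<Rightarrow> 'a set \<Rightarrow> bool" where
  "fractional_ideal A M \<longleftrightarrow> 0 \<in> M \<and> M \<noteq> {0} \<and> (\<forall>a\<in>M. \<forall>b\<in>M. a + b \<in> M) \<and>
     (\<forall>a\<in>M. \<forall>r\<in>A. r * a \<in> M) \<and> (\<exists>d\<in>A. d \<noteq> 0 \<and> (\<forall>m\<in>M. d * m \<in> A))"

definition ring_adjoin1 :: "'a::field set \<Rightarrow> 'a \<Rightarrow> 'a set" where
  "ring_adjoin1 A \<theta> = {(\<Sum>k<n. c k * \<theta> ^ k) | n c. \<forall>k<n. c k \<in> A}"

definition complete_integral_closure :: "'a::field set \<Rightarrow> 'a set" where
  "complete_integral_closure A = {\<theta>. fractional_ideal A (ring_adjoin1 A \<theta>)}"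

text \<open>Boundary valuation ring of the sequence Rs (via the characterization
  V = {q. ord_i(q) \<ge> 0 for i \<gg> 0}).\<close>
definition boundary_valuation_ring :: "(nat \<Rightarrow> 'a::field set) \<Rightarrow> 'a set" where
  "boundary_valuation_ring Rs = {q. \<forall>\<^sub>F i in sequentially. ordF (Rs i) q \<ge> 0}"

end

theory Submission
  imports Defs "HOL-Library.Poly_Mapping" "HOL-Library.Multiset"
begin

text \<open>
  Write \<open>V\<close> for the boundary valuation ring and \<open>S[1/x]\<close> for the localization of \<open>S\<close> at the powers of \<open>x\<close>.
  Everything reduces to two facts: \<open>T = S[1/x]\<close> and \<open>S = V \<inter> S[1/x]\<close>. They show that each of the six
  conditions says that some nonzero \<open>y\<close> has \<open>y / x ^ n \<in> S\<close> for all \<open>n\<close>, the ideal of these \<open>y\<close> being the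
  contraction to \<open>S\<close> of the prime \<open>\<Inter>n. x ^ n V\<close> of \<open>V\<close>.

  A discrete valuation ring dominating \<open>S\<close> equals \<open>S\<close>, because dividing numerator and denominator of an
  element by successive exceptional parameters must stop; hence \<open>S[1/x] \<subseteq> T\<close>. For the other inclusions, an
  element outside \<open>S\<close> (or \<open>S[1/x]\<close>) lies outside some height one localization of every \<open>R_j\<close>; these
  are order valuation rings of earlier members of the sequence or localizations of a fixed \<open>R_i\<close>, of which
  only finitely many come into question, so one of them contains \<open>S\<close>.

  That \<open>V\<close> is a valuation ring rests on the fact that the order of an element does not increase when it is
  divided by the maximal possible power of the exceptional parameter. The facts on regular local rings
  (regular parameters generate primes, the order is a valuation, complete integral closedness) follow
  from Krull's principal ideal theorem by descending induction on sets of parameters.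
\<close>

section \<open>Ideals of subrings of a field\<close>

text \<open>All rings lie in one field, so residue rings and graded rings are not objects here;
  statements about them become membership in sums such as \<open>J + xA\<close> or
  \<open>J + M^n\<close> inside \<open>A\<close>. Regularity enters as a chain of primes up to
  \<open>M\<close> with as many steps as \<open>M\<close> has chosen generators. Complete integral
  closedness takes the place of unique factorization: an element outside such a noetherian ring is
  excluded by a localization that is a discrete valuation ring. The choice of \<open>x\<close>
  matters because a valuation ring over \<open>S\<close> either contains \<open>1 / x\<close> or
  dominates \<open>S\<close>. For the finiteness, one nonzero element of a fixed \<open>R_i\<close>
  has to lie in all primes considered, independently of \<open>j\<close>: for
  \<open>S = V \<inter> S[1/x]\<close> it is a power of \<open>x\<close>, for
  \<open>T = S[1/x]\<close> a denominator from \<open>R\<close>, which is where the hypothesis on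
  \<open>T\<close> enters. The residue field may grow under a transform, so the new point need not
  have coordinates \<open>g / z\<close> congruent to elements of \<open>A\<close>; hence the orders
  are compared through Taylor expansions with coefficients in the new ring instead of a change of
  parameters.\<close>

lemma subring_rules:
  assumes "subring A"
  shows subring_0: "0 \<in> A" and subring_1: "1 \<in> A"
    and subring_add: "a \<in> A \<Longrightarrow> b \<in> A \<Longrightarrow> a + b \<in> A"
    and subring_mult: "a \<in> A \<Longrightarrow> b \<in> A \<Longrightarrow> a * b \<in> A"
    and subring_uminus: "a \<in> A \<Longrightarrow> - a \<in> A"
  using assms by (auto simp: subring_def)

lemma subring_diff: "subring A \<Longrightarrow> a \<in> A \<Longrightarrow> b \<in> A \<Longrightarrow> a - b \<in> A"
  using subring_add[of A a "- b"] subring_uminus[of A b] by simp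

lemma subring_power: "subring A \<Longrightarrow> a \<in> A \<Longrightarrow> a ^ n \<in> A"
  by (induction n) (auto intro: subring_1 subring_mult)

lemma subring_sum: "subring A \<Longrightarrow> (\<And>i. i \<in> X \<Longrightarrow> f i \<in> A) \<Longrightarrow> sum f X \<in> A"
  by (induction X rule: infinite_finite_induct) (auto intro: subring_0 subring_add)

lemma ideal_subset: "ideal A I \<Longrightarrow> a \<in> I \<Longrightarrow> a \<in> A"
  and ideal_0: "ideal A I \<Longrightarrow> 0 \<in> I"
  and ideal_add: "ideal A I \<Longrightarrow> a \<in> I \<Longrightarrow> b \<in> I \<Longrightarrow> a + b \<in> I"
  and ideal_mult: "ideal A I \<Longrightarrow> a \<in> I \<Longrightarrow> r \<in> A \<Longrightarrow> r * a \<in> I"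
  and ideal_mult': "ideal A I \<Longrightarrow> a \<in> I \<Longrightarrow> r \<in> A \<Longrightarrow> a * r \<in> I"
  by (auto simp: ideal_def mult.commute)

lemma ideal_uminus: "subring A \<Longrightarrow> ideal A I \<Longrightarrow> a \<in> I \<Longrightarrow> - a \<in> I"
  using ideal_mult[of A I a "-1"] subring_1[of A] subring_uminus[of A 1] by simp

lemma ideal_diff: "subring A \<Longrightarrow> ideal A I \<Longrightarrow> a \<in> I \<Longrightarrow> b \<in> I \<Longrightarrow> a - b \<in> I"
  using ideal_add[of A I a "- b"] ideal_uminus[of A I b] by simp

lemma ideal_sum: "ideal A I \<Longrightarrow> (\<And>i. i \<in> X \<Longrightarrow> f i \<in> I) \<Longrightarrow> sum f X \<in> I"
  by (induction X rule: infinite_finite_induct) (auto intro: ideal_0 ideal_add)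

lemma ideal_whole: "subring A \<Longrightarrow> ideal A A"
  by (auto simp: ideal_def subring_def)

lemma ideal_zero: "subring A \<Longrightarrow> ideal A {0}"
  by (auto simp: ideal_def subring_def)

lemma ideal_eq_ring_iff: "ideal A I \<Longrightarrow> subring A \<Longrightarrow> I = A \<longleftrightarrow> 1 \<in> I"
  using ideal_mult[of A I 1] by (auto simp: subring_def intro: ideal_subset)

lemma prime_idealD:
  assumes "prime_ideal A P"
  shows prime_ideal_ideal: "ideal A P"
    and prime_ideal_mult: "a \<in> A \<Longrightarrow> b \<in> A \<Longrightarrow> a * b \<in> P \<Longrightarrow> a \<in> P \<or> b \<in> P"
  using assms by (auto simp: prime_ideal_def)

lemma prime_ideal_1: "subring A \<Longrightarrow> prime_ideal A P \<Longrightarrow> 1 \<notin> P"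
  by (metis ideal_eq_ring_iff prime_ideal_def)

lemma prime_ideal_power:
  assumes "subring A" "prime_ideal A P" "a \<in> A" "a ^ n \<in> P"
  shows "a \<in> P"
  using assms(4)
proof (induction n)
  case 0
  then show ?case using prime_ideal_1[OF assms(1,2)] by simp
next
  case (Suc n)
  then show ?case
    using prime_ideal_mult[OF assms(2,3) subring_power[OF assms(1,3), of n]] by auto
qed

text \<open>The ideal \<open>J + xA\<close>. Membership in it expresses divisibility by
  \<open>x\<close> in the residue ring of \<open>A\<close> modulo \<open>J\<close>, which is not a
  subset of the field.\<close>

definition adjoin_elem :: "'a::field set \<Rightarrow> 'a set \<Rightarrow> 'a \<Rightarrow> 'a set" where
  "adjoin_elem A J x = {j + x * r | j r. j \<in> J \<and> r \<in> A}"

lemma adjoin_elemI: "j \<in> J \<Longrightarrow> r \<in> A \<Longrightarrow> a = j + x * r \<Longrightarrow> a \<in> adjoin_elem A J x"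
  by (auto simp: adjoin_elem_def)

lemma adjoin_elemE:
  assumes "a \<in> adjoin_elem A J x"
  obtains j r where "j \<in> J" "r \<in> A" "a = j + x * r"
  using assms by (auto simp: adjoin_elem_def)

lemma ideal_adjoin_elem:
  assumes A: "subring A" and J: "ideal A J" and x: "x \<in> A"
  shows "ideal A (adjoin_elem A J x)"
proof -
  have "r * a \<in> adjoin_elem A J x" if "a \<in> adjoin_elem A J x" "r \<in> A" for a r
    using that(1)
  proof (rule adjoin_elemE)
    fix j s assume "j \<in> J" "s \<in> A" "a = j + x * s"
    then show ?thesis
      by (intro adjoin_elemI[of "r * j" _ "r * s"])
         (auto simp: distrib_left mult.left_commute intro: ideal_mult[OF J] subring_mult[OF A] that(2))
  qed
  moreover have "a + b \<in> adjoin_elem A J x"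
    if ab: "a \<in> adjoin_elem A J x" "b \<in> adjoin_elem A J x" for a b
  proof -
    obtain j r where 1: "j \<in> J" "r \<in> A" "a = j + x * r" using ab(1) by (rule adjoin_elemE)
    obtain k s where 2: "k \<in> J" "s \<in> A" "b = k + x * s" using ab(2) by (rule adjoin_elemE)
    show ?thesis
      by (intro adjoin_elemI[of "j + k" _ "r + s"])
         (auto simp: 1 2 algebra_simps intro: ideal_add[OF J] subring_add[OF A])
  qed
  moreover have "adjoin_elem A J x \<subseteq> A"
    using assms ideal_subset[OF J] by (auto simp: adjoin_elem_def intro!: subring_add subring_mult)
  moreover have "0 \<in> adjoin_elem A J x"
    by (rule adjoin_elemI[of 0 _ 0]) (auto intro: ideal_0 J subring_0 A)
  ultimately show ?thesis by (auto simp: ideal_def)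
qed

lemma subset_adjoin_elem: "subring A \<Longrightarrow> J \<subseteq> adjoin_elem A J x"
  by (auto intro!: adjoin_elemI[of _ _ 0] subring_0)

lemma elem_adjoin_elem: "subring A \<Longrightarrow> ideal A J \<Longrightarrow> x \<in> adjoin_elem A J x"
  by (rule adjoin_elemI[of 0 _ 1]) (auto intro: ideal_0 subring_1)

lemma adjoin_elem_least: "ideal A K \<Longrightarrow> J \<subseteq> K \<Longrightarrow> x \<in> K \<Longrightarrow> adjoin_elem A J x \<subseteq> K"
  by (auto elim!: adjoin_elemE intro!: ideal_add ideal_mult')

lemma adjoin_elem_mono: "J \<subseteq> K \<Longrightarrow> adjoin_elem A J x \<subseteq> adjoin_elem A K x"
  by (auto simp: adjoin_elem_def)

lemma adjoin_elem_mult: "subring A \<Longrightarrow> y \<in> A \<Longrightarrow> adjoin_elem A J (x * y) \<subseteq> adjoin_elem A J x"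
  by (auto elim!: adjoin_elemE intro!: adjoin_elemI[OF _ _ add_left_cancel[THEN iffD2, OF mult.assoc]] subring_mult)

lemma ideal_principal: "subring A \<Longrightarrow> x \<in> A \<Longrightarrow> ideal A (principal A x)"
  using ideal_adjoin_elem[of A "{0}" x] ideal_zero[of A]
  by (simp add: adjoin_elem_def principal_def)

lemma ideal_Int: "ideal A I \<Longrightarrow> ideal A J \<Longrightarrow> ideal A (I \<inter> J)"
  by (auto simp: ideal_def)

lemma ideal_INT: "(\<And>n::'i. ideal A (I n)) \<Longrightarrow> ideal A (\<Inter>n. I n)"
  by (force simp: ideal_def)

lemma ideal_gen_ideal: "subring A \<Longrightarrow> G \<subseteq> A \<Longrightarrow> ideal A (gen_ideal A G)"
  using ideal_whole[of A] by (auto simp: gen_ideal_def intro: ideal_add ideal_mult ideal_0 intro!: ideal_def[THEN iffD2])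

lemma gen_ideal_superset: "G \<subseteq> gen_ideal A G"
  by (auto simp: gen_ideal_def)

lemma gen_ideal_least: "ideal A J \<Longrightarrow> G \<subseteq> J \<Longrightarrow> gen_ideal A G \<subseteq> J"
  by (auto simp: gen_ideal_def)

lemma gen_ideal_mono: "D \<subseteq> E \<Longrightarrow> gen_ideal A D \<subseteq> gen_ideal A E"
  by (auto simp: gen_ideal_def)

lemma gen_ideal_empty: "subring A \<Longrightarrow> gen_ideal A {} = {0}"
  using gen_ideal_least[OF ideal_zero, of A "{}"] ideal_0[OF ideal_gen_ideal, of A "{}"] by auto

lemma gen_ideal_insert:
  assumes A: "subring A" and D: "D \<subseteq> A" "x \<in> A"
  shows "gen_ideal A (insert x D) = adjoin_elem A (gen_ideal A D) x"
proof
  have i: "ideal A (gen_ideal A D)" by (rule ideal_gen_ideal[OF A D(1)])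
  show "gen_ideal A (insert x D) \<subseteq> adjoin_elem A (gen_ideal A D) x"
    using elem_adjoin_elem[OF A i] subset_adjoin_elem[OF A] gen_ideal_superset
    by (intro gen_ideal_least ideal_adjoin_elem A i D) fastforce
  show "adjoin_elem A (gen_ideal A D) x \<subseteq> gen_ideal A (insert x D)"
    using D gen_ideal_superset[of "insert x D" A]
    by (intro adjoin_elem_least ideal_gen_ideal A gen_ideal_mono) auto
qed

lemma ideal_colon:
  assumes "subring A" "ideal A K" "a \<in> A"
  shows "ideal A {r \<in> A. r * a \<in> K}"
  using assms
  by (auto simp: ideal_def subring_def distrib_right mult.assoc)

section \<open>Noetherian rings and localization\<close>

lemma noetherian_subring: "noetherian A \<Longrightarrow> subring A"
  by (simp add: noetherian_def)

text \<open>The finitely many generators of the union of a chain already lie in one member, so the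
  union belongs to the chain and Zorn's lemma applies.\<close>

lemma noetherian_maximal:
  assumes A: "noetherian A" and ne: "F \<noteq> {}" and id: "\<And>I. I \<in> F \<Longrightarrow> ideal A I"
  shows "\<exists>K\<in>F. \<forall>L\<in>F. K \<subseteq> L \<longrightarrow> L = K"
proof (rule subset_Zorn_nonempty[OF ne])
  fix C assume C: "C \<noteq> {}" "subset.chain F C"
  have sub: "C \<subseteq> F" and cmp: "\<And>X Y. X \<in> C \<Longrightarrow> Y \<in> C \<Longrightarrow> X \<subseteq> Y \<or> Y \<subseteq> X"
    using C(2) by (auto simp: subset.chain_def)
  have "ideal A (\<Union>C)"
    unfolding ideal_def
  proof (intro conjI ballI)
    show "\<Union>C \<subseteq> A" using sub id ideal_subset by blast
    show "0 \<in> \<Union>C" using C(1) sub id ideal_0 by blast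
    show "a + b \<in> \<Union>C" if ab: "a \<in> \<Union>C" "b \<in> \<Union>C" for a b
    proof -
      obtain X Y where XY: "X \<in> C" "a \<in> X" "Y \<in> C" "b \<in> Y" using ab by blast
      have "ideal A X" "ideal A Y" using XY sub id by auto
      with cmp[of X Y] XY ideal_add[of A X a b] ideal_add[of A Y a b] show ?thesis by blast
    qed
    show "r * a \<in> \<Union>C" if "a \<in> \<Union>C" "r \<in> A" for a r
      using that sub id ideal_mult by blast
  qed
  then obtain G where G: "finite G" "G \<subseteq> \<Union>C" "\<Union>C = gen_ideal A G"
    using A by (auto simp: noetherian_def)
  obtain X where X: "X \<in> C" "G \<subseteq> X"
    using finite_subset_Union_chain[OF G(1,2) C] by blast
  have "\<Union>C \<subseteq> X" unfolding G(3) using X sub id by (intro gen_ideal_least) auto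
  with X have "\<Union>C = X" by blast
  with X sub show "\<Union>C \<in> F" by auto
qed

lemma noetherian_maximal_pred:
  assumes "noetherian A" "Q I" "\<And>I. Q I \<Longrightarrow> ideal A I"
  obtains K where "Q K" "\<And>L. Q L \<Longrightarrow> K \<subseteq> L \<Longrightarrow> L = K"
  using noetherian_maximal[of A "Collect Q"] assms by auto

text \<open>The maximal ideal is a parameter, characterised by the invertibility of everything
  outside it. Finiteness is kept apart in \<open>noetherian_local\<close>, because \<open>S\<close>
  and the boundary valuation ring are to be instances too.\<close>

locale quasi_local =
  fixes A M :: "'a::field set"
  assumes A: "subring A" and ideal_M: "ideal A M" and one_notin: "1 \<notin> M"
    and inverse_in: "a \<in> A \<Longrightarrow> a \<notin> M \<Longrightarrow> inverse a \<in> A"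
begin

lemma M_sub: "a \<in> M \<Longrightarrow> a \<in> A"
  using ideal_M by (rule ideal_subset)

lemma proper_subset_M:
  assumes "ideal A I" "1 \<notin> I" shows "I \<subseteq> M"
proof
  fix a assume a: "a \<in> I"
  show "a \<in> M"
  proof (rule ccontr)
    assume "a \<notin> M"
    then have "inverse a * a \<in> I" "a \<noteq> 0"
      using ideal_mult[OF assms(1) a] inverse_in ideal_subset[OF assms(1) a] ideal_0[OF ideal_M] by auto
    with assms(2) show False by simp
  qed
qed

lemma prime_M: "prime_ideal A M"
  unfolding prime_ideal_def
proof (intro conjI ballI impI)
  show "M \<noteq> A" using one_notin subring_1[OF A] by auto
  fix a b assume ab: "a \<in> A" "b \<in> A" "a * b \<in> M"
  show "a \<in> M \<or> b \<in> M"
  proof (rule ccontr)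
    assume *: "\<not> (a \<in> M \<or> b \<in> M)"
    then have "inverse a \<in> A" "a \<noteq> 0" using ab inverse_in ideal_0[OF ideal_M] by auto
    then have "b \<in> M" using ideal_mult[OF ideal_M ab(3), of "inverse a"] by (simp flip: mult.assoc)
    with * show False by simp
  qed
qed (rule ideal_M)

lemma prime_subset_M: "prime_ideal A P \<Longrightarrow> P \<subseteq> M"
  by (intro proper_subset_M prime_ideal_ideal prime_ideal_1[OF A])

lemma cancel_unit:
  assumes I: "ideal A I" and c: "c \<in> A" and r: "r \<in> M" and h: "c * (1 - r) \<in> I"
  shows "c \<in> I"
proof -
  have 1: "1 - r \<in> A" using r by (intro subring_diff A subring_1 M_sub)
  have 2: "1 - r \<notin> M"
    using ideal_add[OF ideal_M r, of "1 - r"] one_notin by auto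
  then have "1 - r \<noteq> 0" using ideal_0[OF ideal_M] by metis
  then have "c = c * (1 - r) * inverse (1 - r)" by simp
  also have "\<dots> \<in> I" by (rule ideal_mult'[OF I h inverse_in[OF 1 2]])
  finally show ?thesis .
qed

lemma max_ideal_eq: "max_ideal A = M"
  unfolding max_ideal_def
proof (rule the_equality)
  show "maximal_ideal A M"
    unfolding maximal_ideal_def
  proof (intro conjI allI impI)
    show "M \<noteq> A" using one_notin subring_1[OF A] by auto
    fix J assume J: "ideal A J \<and> M \<subseteq> J"
    then show "J = M \<or> J = A"
      using proper_subset_M[of J] ideal_eq_ring_iff[OF _ A, of J] by auto
  qed (rule ideal_M)
  fix M' assume "maximal_ideal A M'"
  then have M': "ideal A M'" "M' \<noteq> A" "\<forall>J. ideal A J \<and> M' \<subseteq> J \<longrightarrow> J = M' \<or> J = A"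
    by (auto simp: maximal_ideal_def)
  have "M' \<subseteq> M" using M' ideal_eq_ring_iff[OF _ A] by (intro proper_subset_M) auto
  then show "M' = M" using M'(3) ideal_M one_notin subring_1[OF A] by blast
qed

end

locale noetherian_local = quasi_local +
  assumes noeth: "noetherian A"
begin

text \<open>A maximal proper subideal containing D shows that C/D has a simple quotient, killed by x.\<close>
lemma nakayama:
  assumes C: "ideal A C" and D: "ideal A D" and x: "x \<in> M"
    and h: "\<And>c. c \<in> C \<Longrightarrow> \<exists>d\<in>D. \<exists>c'\<in>C. c = d + x * c'"
  shows "C \<subseteq> D"
proof (rule ccontr)
  assume n: "\<not> C \<subseteq> D"
  let ?F = "\<lambda>K. ideal A K \<and> C \<inter> D \<subseteq> K \<and> K \<subset> C"
  have "?F (C \<inter> D)" using n ideal_Int[OF C D] by auto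
  then obtain K where K: "?F K" and mx: "\<And>L. ?F L \<Longrightarrow> K \<subseteq> L \<Longrightarrow> L = K"
    by (rule noetherian_maximal_pred[OF noeth, of ?F]) (erule conjunct1, rule that)
  have K1: "ideal A K" using K by simp
  have gen: "adjoin_elem A K c = C" if "c \<in> C" "c \<notin> K" for c
  proof (rule ccontr)
    assume ne: "adjoin_elem A K c \<noteq> C"
    have cA: "c \<in> A" using C that by (auto intro: ideal_subset)
    have "adjoin_elem A K c \<subseteq> C" using K that C by (intro adjoin_elem_least) auto
    then have "adjoin_elem A K c = K"
      using ne K subset_adjoin_elem[OF A, of K c] ideal_adjoin_elem[OF A K1 cA]
      by (intro mx) auto
    then show False using elem_adjoin_elem[OF A K1, of c] that by auto
  qed
  have xK: "x * c \<in> K" if "c \<in> C" for c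
  proof (rule ccontr)
    assume nx: "x * c \<notin> K"
    have xA: "x \<in> A" using x by (rule M_sub)
    have "adjoin_elem A K (x * c) = C" by (rule gen) (use nx that ideal_mult[OF C _ xA] in auto)
    then have "c \<in> adjoin_elem A K (x * c)" using that by simp
    then obtain k r where kr: "k \<in> K" "r \<in> A" "c = k + x * c * r" by (rule adjoin_elemE)
    have "c * (1 - x * r) = k" using kr(3) by (simp add: algebra_simps)
    then have "c \<in> K"
      using kr(1) by (intro cancel_unit[OF K1 ideal_subset[OF C that] ideal_mult'[OF ideal_M x kr(2)]]) simp
    then show False using nx ideal_mult[OF K1 _ xA] by blast
  qed
  have "C \<subseteq> K"
  proof
    fix c assume c: "c \<in> C"
    then obtain d c' where dc: "d \<in> D" "c' \<in> C" "c = d + x * c'" using h by blast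
    have "d = c - x * c'" using dc by simp
    moreover have "c - x * c' \<in> C" using c dc(2) x by (intro ideal_diff[OF A C] ideal_mult[OF C] M_sub)
    ultimately have "d \<in> K" using dc(1) K by auto
    with dc show "c \<in> K" using ideal_add[OF K1 _ xK] by auto
  qed
  with K show False by auto
qed

text \<open>Artin-Rees for one element. The colon ideals of \<open>J\<close> by \<open>t ^ e\<close>
  become stationary; from that exponent on a factor \<open>t\<close> can be removed modulo
  \<open>J\<close>, so the intersection \<open>L\<close> of all \<open>J + t^n A\<close> satisfies
  \<open>L \<subseteq> J + tL\<close>, and Nakayama's lemma applies.\<close>

lemma krull_intersection_elem:
  assumes J: "ideal A J" and t: "t \<in> M" and a: "\<And>n. a \<in> adjoin_elem A J (t ^ n)"
  shows "a \<in> J"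
proof -
  have tA: "t \<in> A" using t by (rule M_sub)
  note pw = subring_power[OF A tA]
  define c where "c e = {r \<in> A. r * t ^ e \<in> J}" for e
  have ic: "ideal A (c e)" for e unfolding c_def by (intro ideal_colon A J pw)
  obtain e where e: "\<And>k. c e \<subseteq> c k \<Longrightarrow> c k = c e"
    using noetherian_maximal[OF noeth, of "range c"] ic by auto
  have "c e \<subseteq> c (Suc e)"
    unfolding c_def using ideal_mult[OF J _ tA] by (auto simp: mult.left_commute[of _ t])
  then have e': "c (Suc e) = c e" by (rule e)
  define L where "L = (\<Inter>n. adjoin_elem A J (t ^ n))"
  have L: "ideal A L"
    unfolding L_def by (rule ideal_INT) (rule ideal_adjoin_elem[OF A J pw])
  have "L \<subseteq> J"
  proof (rule nakayama[OF L J t])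
    fix b assume b: "b \<in> L"
    then have bn: "b \<in> adjoin_elem A J (t ^ n)" for n by (auto simp: L_def)
    obtain j r where jr: "j \<in> J" "r \<in> A" "b = j + t ^ Suc e * r" using bn by (rule adjoin_elemE)
    have "t ^ e * r \<in> adjoin_elem A J (t ^ n)" for n
    proof -
      obtain k s where ks: "k \<in> J" "s \<in> A" "b = k + t ^ (Suc e + n) * s" using bn by (rule adjoin_elemE)
      have "(r - t ^ n * s) * t ^ Suc e = k - j" using jr ks by (simp add: algebra_simps power_add)
      then have "r - t ^ n * s \<in> c (Suc e)"
        unfolding c_def using jr ks ideal_diff[OF A J ks(1) jr(1)] by (auto intro!: subring_diff A subring_mult pw)
      then have "(r - t ^ n * s) * t ^ e \<in> J" unfolding e' by (simp add: c_def)
      then show ?thesis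
        by (rule adjoin_elemI[of _ _ "t ^ e * s"]) (auto simp: algebra_simps intro: subring_mult A pw ks)
    qed
    then have "t ^ e * r \<in> L" by (simp add: L_def)
    then show "\<exists>d\<in>J. \<exists>c'\<in>L. b = d + t * c'" using jr by (auto simp: mult.assoc)
  qed
  with a show ?thesis by (auto simp: L_def)
qed

end

text \<open>A nonunit lies in an ideal that is maximal among those avoiding 1, and this must be the
  unique maximal ideal. So the definition through \<open>THE\<close> meets the locale.\<close>

lemma regular_local_noetherian_local:
  assumes "regular_local A"
  shows "noetherian_local A (max_ideal A)"
proof -
  have loc: "local_ring A" and n: "noetherian A" using assms by (auto simp: regular_local_def)
  have A: "subring A" using n by (rule noetherian_subring)
  obtain M where M: "maximal_ideal A M" and u: "\<And>M'. maximal_ideal A M' \<Longrightarrow> M' = M"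
    using loc by (auto simp: local_ring_def)
  have eq: "max_ideal A = M" unfolding max_ideal_def using M u by (rule the_equality)
  have iM: "ideal A M" "M \<noteq> A" using M by (auto simp: maximal_ideal_def)
  have "inverse a \<in> A" if a: "a \<in> A" "a \<notin> M" for a
  proof (rule ccontr)
    assume ni: "inverse a \<notin> A"
    have a0: "a \<noteq> 0" using a iM ideal_0 by metis
    have "1 \<notin> principal A a"
      using ni a0 by (auto simp: principal_def) (metis inverse_unique)
    let ?F = "\<lambda>I. ideal A I \<and> principal A a \<subseteq> I \<and> 1 \<notin> I"
    have "?F (principal A a)" using ideal_principal[OF A a(1)] \<open>1 \<notin> principal A a\<close> by auto
    then obtain K where K: "?F K" and mx: "\<And>L. ?F L \<Longrightarrow> K \<subseteq> L \<Longrightarrow> L = K"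
      by (rule noetherian_maximal_pred[OF n, of ?F]) (erule conjunct1, rule that)
    have "maximal_ideal A K"
      unfolding maximal_ideal_def
    proof (intro conjI allI impI)
      show "K \<noteq> A" using K subring_1[OF A] by auto
      fix J assume J: "ideal A J \<and> K \<subseteq> J"
      then show "J = K \<or> J = A"
        using mx[of J] K ideal_eq_ring_iff[OF _ A, of J] by auto
    qed (use K in simp)
    then have "K = M" by (rule u)
    moreover have "a \<in> principal A a" using subring_1[OF A] by (auto simp: principal_def)
    ultimately show False using K a by auto
  qed
  then show ?thesis
    unfolding noetherian_local_def quasi_local_def noetherian_local_axioms_def eq
    using n A iM ideal_eq_ring_iff[OF iM(1) A] by auto
qed

section \<open>Localization at a prime ideal\<close>

lemma localize_atI: "a \<in> A \<Longrightarrow> b \<in> A \<Longrightarrow> b \<notin> P \<Longrightarrow> q = a / b \<Longrightarrow> q \<in> localize_at A P"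
  by (auto simp: localize_at_def)

lemma localize_atE:
  assumes "q \<in> localize_at A P"
  obtains a b where "a \<in> A" "b \<in> A" "b \<notin> P" "q = a / b"
  using assms by (auto simp: localize_at_def)

lemma prime_contract:
  assumes A: "subring A" and B: "subring B" "A \<subseteq> B" and Q: "prime_ideal B Q"
  shows "prime_ideal A (Q \<inter> A)"
  using Q B(2) prime_ideal_1[OF B(1) Q] subring_1[OF A] A
  unfolding prime_ideal_def ideal_def subring_def by blast

context
  fixes A P :: "'a::field set"
  assumes A: "subring A" and P: "prime_ideal A P"
begin

lemma prime_compl:
  shows "1 \<notin> P" "0 \<in> P" "a \<in> A \<Longrightarrow> b \<in> A \<Longrightarrow> a \<notin> P \<Longrightarrow> b \<notin> P \<Longrightarrow> a * b \<notin> P"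
  using prime_ideal_1[OF A P] ideal_0[OF prime_ideal_ideal[OF P]] prime_ideal_mult[OF P] by auto

lemma localize_at_superset: "A \<subseteq> localize_at A P"
  using prime_compl(1) subring_1[OF A] localize_atI[of _ A 1 P] by auto

definition extend_ideal :: "'a set \<Rightarrow> 'a set" where
  "extend_ideal I = {a / b | a b. a \<in> I \<and> b \<in> A \<and> b \<notin> P}"

lemma subring_localize_at: "subring (localize_at A P)"
  unfolding subring_def
proof (intro conjI ballI)
  show "0 \<in> localize_at A P" "1 \<in> localize_at A P"
    using localize_at_superset subring_0[OF A] subring_1[OF A] by auto
  fix p q assume "p \<in> localize_at A P" "q \<in> localize_at A P"
  then obtain a b c d where *: "a \<in> A" "b \<in> A" "b \<notin> P" "p = a / b" "c \<in> A" "d \<in> A" "d \<notin> P" "q = c / d"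
    by (metis localize_atE)
  have nz: "b \<noteq> 0" "d \<noteq> 0" using * prime_compl(2) by auto
  show "p + q \<in> localize_at A P"
    by (rule localize_atI[of "a * d + c * b" _ "b * d"])
       (use * nz prime_compl(3) in \<open>auto intro: subring_add subring_mult A simp: field_simps\<close>)
  show "p * q \<in> localize_at A P"
    by (rule localize_atI[of "a * c" _ "b * d"])
       (use * nz prime_compl(3) in \<open>auto intro: subring_add subring_mult A simp: field_simps\<close>)
  show "- p \<in> localize_at A P"
    by (rule localize_atI[of "- a" _ "b"])
       (use * nz prime_compl(3) in \<open>auto intro: subring_uminus A simp: field_simps\<close>)
qed

lemma ideal_extend_ideal:
  assumes I: "ideal A I" shows "ideal (localize_at A P) (extend_ideal I)"
  unfolding ideal_def
proof (intro conjI ballI)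
  show "extend_ideal I \<subseteq> localize_at A P"
    using ideal_subset[OF I] by (auto simp: extend_ideal_def intro: localize_atI)
  show "0 \<in> extend_ideal I"
    using ideal_0[OF I] subring_1[OF A] prime_compl(1) by (force simp: extend_ideal_def)
  show "p + q \<in> extend_ideal I" if pq: "p \<in> extend_ideal I" "q \<in> extend_ideal I" for p q
  proof -
    obtain a b c d where *: "a \<in> I" "b \<in> A" "b \<notin> P" "p = a / b" "c \<in> I" "d \<in> A" "d \<notin> P" "q = c / d"
      using pq by (auto simp: extend_ideal_def)
    have nz: "b \<noteq> 0" "d \<noteq> 0" using * prime_compl(2) by auto
    have "p + q = (a * d + c * b) / (b * d)" using * nz by (auto simp: field_simps)
    moreover have "a * d + c * b \<in> I" "b * d \<in> A" "b * d \<notin> P"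
      using * prime_compl(3) by (auto intro: ideal_add I ideal_mult' subring_mult A)
    ultimately show ?thesis unfolding extend_ideal_def by blast
  qed
  show "r * p \<in> extend_ideal I" if pr: "p \<in> extend_ideal I" "r \<in> localize_at A P" for p r
  proof -
    obtain a b where *: "a \<in> I" "b \<in> A" "b \<notin> P" "p = a / b"
      using pr by (auto simp: extend_ideal_def)
    obtain c d where **: "c \<in> A" "d \<in> A" "d \<notin> P" "r = c / d" using pr(2) by (rule localize_atE)
    have "r * p = (c * a) / (d * b)" using * ** by auto
    moreover have "c * a \<in> I" "d * b \<in> A" "d * b \<notin> P"
      using * ** prime_compl(3) by (auto intro: ideal_mult I subring_mult A)
    ultimately show ?thesis unfolding extend_ideal_def by blast
  qed
qed

lemma extend_prime_Int:
  assumes Q: "prime_ideal A Q" "Q \<subseteq> P" and a: "a \<in> A"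
  shows "a \<in> extend_ideal Q \<longleftrightarrow> a \<in> Q"
proof
  assume "a \<in> extend_ideal Q"
  then obtain c d where *: "c \<in> Q" "d \<in> A" "d \<notin> P" "a = c / d" by (auto simp: extend_ideal_def)
  then have "a * d = c" using prime_compl(2) by auto
  then show "a \<in> Q" using prime_ideal_mult[OF Q(1) a *(2)] * Q(2) by auto
next
  assume "a \<in> Q"
  then show "a \<in> extend_ideal Q"
    unfolding extend_ideal_def using subring_1[OF A] prime_compl(1) by force
qed

lemma prime_extend_ideal:
  assumes Q: "prime_ideal A Q" "Q \<subseteq> P"
  shows "prime_ideal (localize_at A P) (extend_ideal Q)"
  unfolding prime_ideal_def
proof (intro conjI ballI impI)
  show "ideal (localize_at A P) (extend_ideal Q)"
    by (intro ideal_extend_ideal prime_ideal_ideal[OF Q(1)])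
  have "1 \<notin> extend_ideal Q"
    using extend_prime_Int[OF Q subring_1[OF A]] prime_ideal_1[OF A Q(1)] by simp
  then show "extend_ideal Q \<noteq> localize_at A P"
    using subring_1[OF subring_localize_at] by auto
  fix p q assume "p \<in> localize_at A P" "q \<in> localize_at A P" and pq: "p * q \<in> extend_ideal Q"
  then obtain a b c d where *: "a \<in> A" "b \<in> A" "b \<notin> P" "p = a / b" "c \<in> A" "d \<in> A" "d \<notin> P" "q = c / d"
    by (metis localize_atE)
  obtain e f where ef: "e \<in> Q" "f \<in> A" "f \<notin> P" "p * q = e / f" using pq by (auto simp: extend_ideal_def)
  have nz: "b \<noteq> 0" "d \<noteq> 0" "f \<noteq> 0" using * ef prime_compl(2) by auto
  have "(a * c) * f = e * (b * d)" using * ef nz by (auto simp: field_simps)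
  also have "\<dots> \<in> Q" using ef * by (intro ideal_mult'[OF prime_ideal_ideal[OF Q(1)]] subring_mult A)
  finally have "a * c \<in> Q \<or> f \<in> Q" using * ef prime_ideal_mult[OF Q(1) subring_mult[OF A]] by blast
  then have "a \<in> Q \<or> c \<in> Q" using ef Q(2) * prime_ideal_mult[OF Q(1)] by blast
  then show "p \<in> extend_ideal Q \<or> q \<in> extend_ideal Q" using * unfolding extend_ideal_def by blast
qed

lemma noetherian_localize_at:
  assumes n: "noetherian A" shows "noetherian (localize_at A P)"
  unfolding noetherian_def
proof (intro conjI allI impI)
  let ?L = "localize_at A P"
  show "subring ?L" by (rule subring_localize_at)
  fix I assume I: "ideal ?L I"
  have contr: "ideal A (J \<inter> A)" if "ideal ?L J" for J
    using that localize_at_superset A unfolding ideal_def subring_def by blast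
  obtain G where G: "finite G" "G \<subseteq> I \<inter> A" "I \<inter> A = gen_ideal A G"
    using n contr[OF I] unfolding noetherian_def by blast
  have GL: "ideal ?L (gen_ideal ?L G)"
    using G(2) localize_at_superset by (intro ideal_gen_ideal subring_localize_at) auto
  have "I \<subseteq> gen_ideal ?L G"
  proof
    fix q assume q: "q \<in> I"
    then obtain a b where ab: "a \<in> A" "b \<in> A" "b \<notin> P" "q = a / b"
      using ideal_subset[OF I] by (metis localize_atE)
    then have b0: "b \<noteq> 0" using prime_compl(2) by auto
    have "b * q \<in> I" using ab localize_at_superset by (intro ideal_mult[OF I q]) auto
    then have "a \<in> I \<inter> A" using ab b0 by simp
    also have "I \<inter> A \<subseteq> gen_ideal ?L G \<inter> A"
      unfolding G(3) using G(2) gen_ideal_superset[of G ?L] by (intro gen_ideal_least contr GL) auto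
    finally have a: "a \<in> gen_ideal ?L G" by simp
    have "(1 / b) * a \<in> gen_ideal ?L G"
      using ab subring_1[OF A] by (intro ideal_mult[OF GL a] localize_atI[of 1]) auto
    then show "q \<in> gen_ideal ?L G" using ab by simp
  qed
  moreover have "gen_ideal ?L G \<subseteq> I" using G(2) by (intro gen_ideal_least I) auto
  ultimately show "\<exists>G. finite G \<and> G \<subseteq> I \<and> I = gen_ideal ?L G" using G by blast
qed

lemma quasi_local_localize_at: "quasi_local (localize_at A P) (extend_ideal P)"
proof
  show "subring (localize_at A P)" by (rule subring_localize_at)
  show "ideal (localize_at A P) (extend_ideal P)" by (rule ideal_extend_ideal[OF prime_ideal_ideal[OF P]])
  show "1 \<notin> extend_ideal P" using extend_prime_Int[OF P order_refl subring_1[OF A]] prime_compl(1) by simp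
  fix q assume q: "q \<in> localize_at A P" "q \<notin> extend_ideal P"
  obtain a b where ab: "a \<in> A" "b \<in> A" "b \<notin> P" "q = a / b" using q(1) by (rule localize_atE)
  then have "a \<notin> P" using q(2) unfolding extend_ideal_def by blast
  with ab show "inverse q \<in> localize_at A P" by (intro localize_atI[of b _ a]) auto
qed

lemma noetherian_local_localize_at:
  assumes n: "noetherian A" shows "noetherian_local (localize_at A P) (extend_ideal P)"
  unfolding noetherian_local_def noetherian_local_axioms_def
  using quasi_local_localize_at noetherian_localize_at[OF n] by simp

end

section \<open>Krull's principal ideal theorem and regular parameters\<close>

text \<open>Existence of associated primes: replacing \<open>a\<close> by \<open>s * a\<close> can
  only enlarge the annihilator modulo \<open>K\<close>, so a maximal annihilator is prime.\<close>

lemma prime_colon_maximal: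
  assumes A: "subring A" and K: "ideal A K" and a: "a \<in> A" "a \<notin> K"
    and mx: "\<And>b. b \<in> A \<Longrightarrow> b \<notin> K \<Longrightarrow> {r \<in> A. r * a \<in> K} \<subseteq> {r \<in> A. r * b \<in> K} \<Longrightarrow>
      {r \<in> A. r * b \<in> K} = {r \<in> A. r * a \<in> K}"
  shows "prime_ideal A {r \<in> A. r * a \<in> K}" (is "prime_ideal A ?p")
  unfolding prime_ideal_def
proof (intro conjI ballI impI)
  show "ideal A ?p" by (rule ideal_colon[OF A K a(1)])
  have "1 \<notin> ?p" using a by auto
  then show "?p \<noteq> A" using subring_1[OF A] by blast
  fix r s assume rs: "r \<in> A" "s \<in> A" "r * s \<in> ?p"
  show "r \<in> ?p \<or> s \<in> ?p"
  proof (rule ccontr)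
    assume n: "\<not> (r \<in> ?p \<or> s \<in> ?p)"
    have sa: "s * a \<in> A" "s * a \<notin> K" using rs n a subring_mult[OF A] by auto
    have "?p \<subseteq> {r \<in> A. r * (s * a) \<in> K}"
      using ideal_mult[OF K _ rs(2)] by (auto simp: mult.left_commute[of _ s])
    from mx[OF sa this] have "{r \<in> A. r * (s * a) \<in> K} = ?p" .
    moreover have "r \<in> {r \<in> A. r * (s * a) \<in> K}" using rs by (auto simp: mult.assoc)
    ultimately show False using n by blast
  qed
qed

text \<open>The residue ring modulo \<open>I\<close> is artinian. In a maximal counterexample
  \<open>K\<close> an associated prime over \<open>K\<close> must be \<open>M\<close>, so
  \<open>K + aA\<close> is a simple extension of \<open>K\<close>; a chain over \<open>K\<close> is
  stationary after adding \<open>a\<close> by maximality, and the simple step costs only finitely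
  many terms.\<close>

lemma (in noetherian_local) descending_chain_condition:
  assumes I: "ideal A I" and only: "\<And>P. prime_ideal A P \<Longrightarrow> I \<subseteq> P \<Longrightarrow> P = M"
    and C: "\<And>n::nat. ideal A (C n)" "\<And>n. I \<subseteq> C n" "\<And>n. C (Suc n) \<subseteq> C n"
  shows "\<exists>n0. \<forall>n\<ge>n0. C n = C n0"
proof -
  define dcc where "dcc K \<longleftrightarrow> (\<forall>C. (\<forall>n::nat. ideal A (C n) \<and> K \<subseteq> C n \<and> C (Suc n) \<subseteq> C n) \<longrightarrow>
    (\<exists>n0. \<forall>n\<ge>n0. C n = C n0))" for K
  have "dcc I"
  proof (rule ccontr)
    assume "\<not> dcc I"
    let ?F = "\<lambda>K. ideal A K \<and> I \<subseteq> K \<and> \<not> dcc K"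
    have "?F I" using I \<open>\<not> dcc I\<close> by simp
    then obtain K where K: "?F K" and mx: "\<And>L. ?F L \<Longrightarrow> K \<subseteq> L \<Longrightarrow> L = K"
      by (rule noetherian_maximal_pred[OF noeth, of ?F]) (erule conjunct1, rule that)
    have iK: "ideal A K" using K by simp
    have "K \<noteq> A"
    proof
      assume KA: "K = A"
      have "dcc A"
        unfolding dcc_def
      proof (intro allI impI)
        fix C :: "nat \<Rightarrow> 'a set"
        assume "\<forall>n. ideal A (C n) \<and> A \<subseteq> C n \<and> C (Suc n) \<subseteq> C n"
        then have "C n = A" for n using ideal_subset by blast
        then show "\<exists>n0. \<forall>n\<ge>n0. C n = C n0" by auto
      qed
      with K KA show False by simp
    qed
    then have "1 \<notin> K" using ideal_eq_ring_iff[OF iK A] by simp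
    define c where "c a = {r \<in> A. r * a \<in> K}" for a
    let ?Q = "\<lambda>X. \<exists>a\<in>A. a \<notin> K \<and> X = c a"
    have "?Q (c 1)" using \<open>1 \<notin> K\<close> subring_1[OF A] by blast
    then obtain X where X: "?Q X" "\<And>L. ?Q L \<Longrightarrow> X \<subseteq> L \<Longrightarrow> L = X"
      by (rule noetherian_maximal_pred[OF noeth, of ?Q])
        (use ideal_colon[OF A iK] in \<open>auto simp: c_def\<close>)
    then obtain a where a: "a \<in> A" "a \<notin> K" "X = c a" by blast
    have "prime_ideal A (c a)"
      unfolding c_def
      by (rule prime_colon_maximal[OF A iK a(1,2)]) (use X(2) a(3) in \<open>auto simp: c_def\<close>)
    moreover have "I \<subseteq> c a"
      using K I ideal_mult'[OF iK _ a(1)] by (auto simp: c_def intro: ideal_subset)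
    ultimately have cM: "c a = M" by (rule only)
    define K' where "K' = adjoin_elem A K a"
    have "ideal A K'" "K \<subseteq> K'" "a \<in> K'"
      unfolding K'_def using a(1) iK
      by (auto intro: ideal_adjoin_elem A elem_adjoin_elem dest: subset_adjoin_elem[OF A, THEN subsetD])
    then have "dcc K'" using mx[of K'] K a(2) by blast
    have "dcc K"
      unfolding dcc_def
    proof (intro allI impI)
      fix C :: "nat \<Rightarrow> 'a set"
      assume asm: "\<forall>n. ideal A (C n) \<and> K \<subseteq> C n \<and> C (Suc n) \<subseteq> C n"
      then have iC: "ideal A (C n)" and KC: "K \<subseteq> C n" for n by auto
      have anti: "C n \<subseteq> C m" if "m \<le> n" for m n
        using that by (induction n) (use asm in \<open>auto simp: le_Suc_eq\<close>)
      have "\<forall>n. ideal A (adjoin_elem A (C n) a) \<and> K' \<subseteq> adjoin_elem A (C n) a \<and>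
          adjoin_elem A (C (Suc n)) a \<subseteq> adjoin_elem A (C n) a"
        using asm a(1) unfolding K'_def by (intro allI conjI ideal_adjoin_elem A adjoin_elem_mono) auto
      then obtain n1 where n1: "\<And>n. n \<ge> n1 \<Longrightarrow> adjoin_elem A (C n) a = adjoin_elem A (C n1) a"
        using \<open>dcc K'\<close>[unfolded dcc_def, rule_format, of "\<lambda>n. adjoin_elem A (C n) a"] by auto
      show "\<exists>n0. \<forall>n\<ge>n0. C n = C n0"
      proof (cases "\<forall>n. a \<in> C n")
        case True
        then have "adjoin_elem A (C n) a = C n" for n
          using adjoin_elem_least[OF iC order_refl, of a n] subset_adjoin_elem[OF A, of "C n" a] by blast
        then show ?thesis using n1 by auto
      next
        case False
        then obtain n2 where n2: "a \<notin> C n2" by blast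
        define n0 where "n0 = max n1 n2"
        \<comment> \<open>An element of \<open>C n0\<close> is \<open>j + a * r\<close> with
          \<open>j\<close> in \<open>C n\<close>. If \<open>r\<close> were a unit, \<open>a\<close>
          would lie in \<open>C n0\<close> and so in \<open>C n2\<close>; hence \<open>r\<close> is
          in \<open>M\<close>, which kills \<open>a\<close> modulo \<open>K\<close>.\<close>
        have "C n0 \<subseteq> C n" if n: "n \<ge> n0" for n
        proof
          fix b assume b: "b \<in> C n0"
          have "b \<in> adjoin_elem A (C n0) a" using subset_adjoin_elem[OF A] b by blast
          also have "adjoin_elem A (C n0) a = adjoin_elem A (C n) a"
            using n1[of n] n1[of n0] n by (simp add: n0_def)
          finally obtain j r where jr: "j \<in> C n" "r \<in> A" "b = j + a * r" by (rule adjoin_elemE)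
          have "a * r = b - j" using jr by simp
          moreover have "b - j \<in> C n0"
            using jr(1) b anti[OF n] by (intro ideal_diff[OF A iC]) auto
          ultimately have ar: "a * r \<in> C n0" by simp
          have "r \<in> M"
          proof (rule ccontr)
            assume rM: "r \<notin> M"
            then have "r \<noteq> 0" using ideal_0[OF ideal_M] by auto
            then have "a = inverse r * (a * r)" by simp
            also have "\<dots> \<in> C n0" by (rule ideal_mult[OF iC ar inverse_in[OF jr(2) rM]])
            also have "C n0 \<subseteq> C n2" by (rule anti) (simp add: n0_def)
            finally show False using n2 by simp
          qed
          then have "r * a \<in> K" using cM by (auto simp: c_def)
          then have "a * r \<in> C n" using KC by (auto simp: mult.commute)
          then show "b \<in> C n" using jr ideal_add[OF iC jr(1)] by simp
        qed
        then have "\<forall>n\<ge>n0. C n = C n0" using anti by blast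
        then show ?thesis by blast
      qed
    qed
    with K show False by simp
  qed
  then show ?thesis unfolding dcc_def using C by blast
qed

text \<open>If \<open>M\<close> were the only prime over \<open>Q + xA\<close>, the chain
  \<open>C n + xA\<close> would be stationary, and Nakayama's lemma would give
  \<open>C n = C (Suc n)\<close>. Then \<open>s * y ^ n\<close> is in \<open>Q + y^(n+1) A\<close>
  for some \<open>s\<close> outside \<open>P\<close>, and cancelling \<open>y ^ n\<close> modulo
  \<open>Q\<close> forces \<open>s\<close> into \<open>P\<close>.\<close>

lemma (in noetherian_local) principal_ideal_theorem_local:
  assumes Q: "prime_ideal A Q" and P: "prime_ideal A P" and QP: "Q \<subset> P" "P \<subset> M" and x: "x \<in> M"
  shows "\<exists>P'. prime_ideal A P' \<and> Q \<subseteq> P' \<and> x \<in> P' \<and> P' \<noteq> M"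
proof (rule ccontr)
  assume neg: "\<not> ?thesis"
  have iQ: "ideal A Q" and iP: "ideal A P" using Q P by (auto intro: prime_ideal_ideal)
  have xA: "x \<in> A" using x by (rule M_sub)
  obtain y where y: "y \<in> P" "y \<notin> Q" using QP by blast
  have yA: "y \<in> A" using y iP by (auto intro: ideal_subset)
  have xP: "x \<notin> P" using neg P QP by blast
  note pw = subring_power[OF A yA]
  define J where "J n = adjoin_elem A Q (y ^ n)" for n
  have iJ: "ideal A (J n)" for n unfolding J_def by (intro ideal_adjoin_elem A iQ pw)
  \<comment> \<open>The contraction of \<open>J n\<close> from the localization at \<open>P\<close>.
    It plays the part of a symbolic power, with the single element \<open>y\<close> of
    \<open>P - Q\<close> in place of \<open>P\<close>.\<close>
  define C where "C n = {a \<in> A. \<exists>s\<in>A. s \<notin> P \<and> s * a \<in> J n}" for n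
  have iC: "ideal A (C n)" for n
    unfolding ideal_def
  proof (intro conjI ballI)
    show "C n \<subseteq> A" by (auto simp: C_def)
    show "0 \<in> C n"
      using subring_1[OF A] prime_ideal_1[OF A P] ideal_0[OF iJ] subring_0[OF A] by (auto simp: C_def)
    show "a + b \<in> C n" if ab: "a \<in> C n" "b \<in> C n" for a b
    proof -
      obtain s t where st: "s \<in> A" "s \<notin> P" "s * a \<in> J n" "t \<in> A" "t \<notin> P" "t * b \<in> J n" "a \<in> A" "b \<in> A"
        using ab by (auto simp: C_def)
      have "(s * t) * (a + b) = t * (s * a) + s * (t * b)" by (simp add: algebra_simps)
      also have "\<dots> \<in> J n" by (rule ideal_add[OF iJ ideal_mult[OF iJ st(3,4)] ideal_mult[OF iJ st(6,1)]])
      finally have "(s * t) * (a + b) \<in> J n" .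
      moreover have "s * t \<notin> P" using st prime_ideal_mult[OF P] by blast
      ultimately show ?thesis
        using st subring_add[OF A] subring_mult[OF A] unfolding C_def by blast
    qed
    show "r * a \<in> C n" if ra: "a \<in> C n" "r \<in> A" for r a
    proof -
      obtain s where s: "s \<in> A" "s \<notin> P" "s * a \<in> J n" "a \<in> A" using ra by (auto simp: C_def)
      have "s * (r * a) \<in> J n" using ideal_mult[OF iJ s(3) ra(2)] by (simp add: mult.left_commute)
      then show ?thesis using s ra subring_mult[OF A] unfolding C_def by blast
    qed
  qed
  have QJ: "Q \<subseteq> J n" for n unfolding J_def by (rule subset_adjoin_elem[OF A])
  have JC: "J n \<subseteq> C n" for n
    using subring_1[OF A] prime_ideal_1[OF A P] ideal_subset[OF iJ] unfolding C_def by force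
  have "J (Suc n) \<subseteq> J n" for n
    unfolding J_def using adjoin_elem_mult[OF A yA, of Q "y ^ n"] by (simp add: mult.commute)
  then have CC: "C (Suc n) \<subseteq> C n" for n unfolding C_def by blast
  define I where "I = adjoin_elem A Q x"
  have "\<exists>n0. \<forall>n\<ge>n0. adjoin_elem A (C n) x = adjoin_elem A (C n0) x"
  proof (rule descending_chain_condition)
    show "ideal A I" unfolding I_def by (intro ideal_adjoin_elem A iQ xA)
    show "P' = M" if "prime_ideal A P'" "I \<subseteq> P'" for P'
    proof -
      have "Q \<subseteq> P'" "x \<in> P'"
        using that(2) subset_adjoin_elem[OF A, of Q x] elem_adjoin_elem[OF A iQ, of x] by (auto simp: I_def)
      with neg that show ?thesis by blast
    qed
    show "ideal A (adjoin_elem A (C n) x)" for n by (intro ideal_adjoin_elem A iC xA)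
    show "I \<subseteq> adjoin_elem A (C n) x" for n
      unfolding I_def using QJ JC by (intro adjoin_elem_mono) blast
    show "adjoin_elem A (C (Suc n)) x \<subseteq> adjoin_elem A (C n) x" for n by (intro adjoin_elem_mono CC)
  qed
  then obtain n where n: "adjoin_elem A (C (Suc n)) x = adjoin_elem A (C n) x" by (metis le_refl le_Suc_eq)
  have "C n \<subseteq> C (Suc n)"
  proof (rule nakayama[OF iC iC x])
    fix a assume a: "a \<in> C n"
    then have "a \<in> adjoin_elem A (C (Suc n)) x" unfolding n using subset_adjoin_elem[OF A] by blast
    then obtain b r where br: "b \<in> C (Suc n)" "r \<in> A" "a = b + x * r" by (rule adjoin_elemE)
    have "x * r = a - b" using br by simp
    moreover have "a - b \<in> C n" using a br CC by (intro ideal_diff[OF A iC]) auto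
    ultimately have "x * r \<in> C n" by simp
    then obtain s where s: "s \<in> A" "s \<notin> P" "s * (x * r) \<in> J n" by (auto simp: C_def)
    have "s * x \<notin> P" using s xA xP prime_ideal_mult[OF P] by blast
    moreover have "(s * x) * r \<in> J n" using s by (simp add: mult.assoc)
    ultimately have "r \<in> C n" using br(2) s(1) xA subring_mult[OF A] unfolding C_def by blast
    with br show "\<exists>d\<in>C (Suc n). \<exists>c'\<in>C n. a = d + x * c'" by blast
  qed
  moreover have "y ^ n \<in> C n" using JC elem_adjoin_elem[OF A iQ, of "y ^ n"] unfolding J_def by blast
  ultimately have "y ^ n \<in> C (Suc n)" by blast
  then obtain s where s: "s \<in> A" "s \<notin> P" "s * y ^ n \<in> J (Suc n)" by (auto simp: C_def)
  obtain q r where qr: "q \<in> Q" "r \<in> A" "s * y ^ n = q + y ^ Suc n * r"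
    using s(3) unfolding J_def by (rule adjoin_elemE)
  have "y ^ n * (s - y * r) = q" using qr(3) by (simp add: algebra_simps)
  then have "y ^ n * (s - y * r) \<in> Q" using qr by simp
  moreover have "y ^ n \<notin> Q" using prime_ideal_power[OF A Q yA] y by blast
  moreover have sy: "s - y * r \<in> A" by (intro subring_diff[OF A] s subring_mult[OF A] yA qr)
  ultimately have "s - y * r \<in> Q" using prime_ideal_mult[OF Q pw[of n] sy] by blast
  then have "s - y * r \<in> P" using QP by blast
  then have "(s - y * r) + y * r \<in> P" by (rule ideal_add[OF iP]) (rule ideal_mult'[OF iP y(1) qr(2)])
  with s show False by simp
qed

text \<open>Localization at \<open>P\<close> reduces to the case where \<open>P\<close> is the
  maximal ideal. For chains of primes it exchanges the middle term \<open>P'\<close> for a prime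
  containing \<open>x\<close>.\<close>

lemma principal_ideal_theorem:
  assumes n: "noetherian A" and Q: "prime_ideal A Q" and P: "prime_ideal A P" "prime_ideal A P'"
    and sub: "Q \<subset> P'" "P' \<subset> P" and x: "x \<in> P"
  shows "\<exists>P''. prime_ideal A P'' \<and> Q \<subseteq> P'' \<and> x \<in> P'' \<and> P'' \<subset> P"
proof -
  have A: "subring A" using n by (rule noetherian_subring)
  let ?L = "localize_at A P" and ?e = "extend_ideal A P"
  interpret L: noetherian_local ?L "?e P" by (rule noetherian_local_localize_at[OF A P(1) n])
  note ext = extend_prime_Int[OF A P(1)]
  have mono: "?e I \<subseteq> ?e J" if "I \<subseteq> J" for I J using that unfolding extend_ideal_def[OF A P(1)] by blast
  have QP: "Q \<subseteq> P" and P'P: "P' \<subseteq> P" using sub by blast+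
  have AL: "A \<subseteq> ?L" by (rule localize_at_superset[OF A P(1)])
  have sP: "P \<subseteq> A" using prime_ideal_ideal[OF P(1)] ideal_subset by blast
  have xA: "x \<in> A" using sP x by blast
  have "\<exists>R. prime_ideal ?L R \<and> ?e Q \<subseteq> R \<and> x \<in> R \<and> R \<noteq> ?e P"
  proof (rule L.principal_ideal_theorem_local)
    show "prime_ideal ?L (?e Q)" "prime_ideal ?L (?e P')"
      by (rule prime_extend_ideal[OF A P(1) Q QP], rule prime_extend_ideal[OF A P(1) P(2) P'P])
    obtain a b where ab: "a \<in> P'" "a \<notin> Q" "b \<in> P" "b \<notin> P'" using sub by blast
    have abA: "a \<in> A" "b \<in> A" using ab sP P'P by auto
    have "a \<in> ?e P'" "b \<notin> ?e P'" using ab ext[OF P(2) P'P] abA by auto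
    moreover have "a \<notin> ?e Q" using ab ext[OF Q QP] abA by auto
    moreover have "b \<in> ?e P" using ab ext[OF P(1) order_refl] abA by auto
    moreover have "?e Q \<subseteq> ?e P'" "?e P' \<subseteq> ?e P" using sub by (auto intro!: mono)
    ultimately show "?e Q \<subset> ?e P'" "?e P' \<subset> ?e P" by blast+
    show "x \<in> ?e P" using ext[OF P(1) order_refl xA] x by simp
  qed
  then obtain R where R: "prime_ideal ?L R" "?e Q \<subseteq> R" "x \<in> R" "R \<noteq> ?e P" by blast
  have RP: "R \<subseteq> ?e P" by (rule L.prime_subset_M[OF R(1)])
  have "prime_ideal A (R \<inter> A)" by (rule prime_contract[OF A subring_localize_at[OF A P(1)] AL R(1)])
  moreover have "Q \<subseteq> R \<inter> A"
    using ext[OF Q QP] R(2) QP sP by blast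
  moreover have "R \<inter> A \<subseteq> P" using RP ext[OF P(1) order_refl] by auto
  moreover have "R \<inter> A \<noteq> P"
  proof
    assume eq: "R \<inter> A = P"
    have "?e P \<subseteq> R"
    proof
      fix q assume "q \<in> ?e P"
      then obtain a b where ab: "a \<in> P" "b \<in> A" "b \<notin> P" "q = a / b"
        by (auto simp: extend_ideal_def[OF A P(1)])
      have "(1 / b) * a \<in> R"
        using ab eq by (intro ideal_mult[OF prime_ideal_ideal[OF R(1)]] localize_atI[of 1 _ b] subring_1 A) auto
      then show "q \<in> R" using ab by simp
    qed
    with RP R(4) show False by blast
  qed
  ultimately show ?thesis using R(3) xA by blast
qed

section \<open>Chains of primes and regular systems of parameters\<close>

inductive prime_chain :: "'a::field set \<Rightarrow> nat \<Rightarrow> 'a set \<Rightarrow> 'a set \<Rightarrow> bool" for A where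
  chain_refl: "prime_ideal A P \<Longrightarrow> prime_chain A 0 P P"
| chain_step: "prime_chain A n P Q \<Longrightarrow> prime_ideal A Q' \<Longrightarrow> Q \<subset> Q' \<Longrightarrow> prime_chain A (Suc n) P Q'"

inductive_cases prime_chain_0E: "prime_chain A 0 P Q"
inductive_cases prime_chain_SucE: "prime_chain A (Suc n) P Q"

lemma prime_chain_0D: "prime_chain A 0 P Q \<Longrightarrow> P = Q"
  by (auto elim: prime_chain_0E)

lemma prime_chain_prime: "prime_chain A n P Q \<Longrightarrow> prime_ideal A P \<and> prime_ideal A Q \<and> P \<subseteq> Q"
  by (induction rule: prime_chain.induct) auto

text \<open>Working down from the top, a term without \<open>x\<close> is exchanged for a prime with
  \<open>x\<close>; this prime is still strictly above the next term, because that term does not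
  contain \<open>x\<close>. Only one step of the chain is lost.\<close>

lemma prime_chain_through:
  assumes n: "noetherian A"
  shows "prime_chain A (Suc e) P Q \<Longrightarrow> x \<in> Q \<Longrightarrow> \<exists>P'. x \<in> P' \<and> P \<subseteq> P' \<and> prime_chain A e P' Q"
proof (induction e arbitrary: Q)
  case 0
  then have "prime_ideal A Q" "P \<subseteq> Q" using prime_chain_prime by blast+
  with 0 show ?case by (intro exI[of _ Q]) (auto intro: prime_chain.chain_refl)
next
  case (Suc e)
  obtain Q1 where Q1: "prime_chain A (Suc e) P Q1" "prime_ideal A Q" "Q1 \<subset> Q"
    using Suc.prems(1) by (rule prime_chain_SucE)
  show ?case
  proof (cases "x \<in> Q1")
    case True
    with Suc.IH[OF Q1(1)] Q1 show ?thesis by (blast intro: prime_chain.chain_step)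
  next
    case False
    obtain Q0 where Q0: "prime_chain A e P Q0" "prime_ideal A Q1" "Q0 \<subset> Q1"
      using Q1(1) by (rule prime_chain_SucE)
    have "prime_ideal A Q0" using prime_chain_prime[OF Q0(1)] by simp
    then obtain Q' where Q': "prime_ideal A Q'" "Q0 \<subseteq> Q'" "x \<in> Q'" "Q' \<subset> Q"
      using principal_ideal_theorem[OF n _ Q1(2) Q0(2) Q0(3) Q1(3) Suc.prems(2)] by blast
    have "Q0 \<subset> Q'" using Q' Q0 False by blast
    then have "prime_chain A (Suc e) P Q'" using Q0 Q' by (blast intro: prime_chain.chain_step)
    with Suc.IH[OF this Q'(3)] Q' Q1(2) show ?thesis by (blast intro: prime_chain.chain_step)
  qed
qed

text \<open>Some generator \<open>g\<close> lies outside \<open>P\<close>. Passing to a prime over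
  \<open>P\<close> and \<open>g\<close> shortens the chain by one and uses up \<open>g\<close>, so
  inductively \<open>J + gA\<close> is that prime. As \<open>P\<close> is prime and \<open>g\<close>
  is not in it, \<open>P \<subseteq> J + gP\<close>, and Nakayama's lemma gives
  \<open>P \<subseteq> J\<close>.\<close>

lemma (in noetherian_local) prime_chain_generators:
  assumes "prime_chain A e P M" "ideal A J" "J \<subseteq> P" "finite E" "E \<subseteq> M" "card E \<le> e"
    "M \<subseteq> gen_ideal A (J \<union> E)"
  shows "J = P"
  using assms
proof (induction e arbitrary: P J E)
  case 0
  have "P = M" using 0(1) by (rule prime_chain_0D)
  moreover have "E = {}" using 0 by auto
  moreover have "gen_ideal A J \<subseteq> J" using 0(2) by (intro gen_ideal_least) auto
  ultimately show ?case using 0 by auto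
next
  case (Suc e)
  obtain Q where Q: "prime_chain A e P Q" "Q \<subset> M" using Suc.prems(1) by (rule prime_chain_SucE) (rule that)
  then have PM: "P \<subset> M" and pP: "prime_ideal A P" using prime_chain_prime[OF Q(1)] by auto
  have iP: "ideal A P" using pP by (rule prime_ideal_ideal)
  have JA: "J \<subseteq> A" using Suc.prems(2) ideal_subset by blast
  obtain g where g: "g \<in> E" "g \<notin> P"
  proof (rule ccontr)
    assume "\<not> thesis"
    then have "J \<union> E \<subseteq> P" using Suc.prems(3) that by blast
    then have "gen_ideal A (J \<union> E) \<subseteq> P" by (rule gen_ideal_least[OF iP])
    with Suc.prems(7) PM show False by blast
  qed
  have gM: "g \<in> M" and gA: "g \<in> A" using g Suc.prems(5) M_sub by auto
  obtain P' where P': "g \<in> P'" "P \<subseteq> P'" "prime_chain A e P' M"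
    using prime_chain_through[OF noeth Suc.prems(1) gM] by blast
  have iP': "ideal A P'" using prime_chain_prime[OF P'(3)] prime_ideal_ideal by blast
  let ?J = "adjoin_elem A J g"
  have iJ: "ideal A ?J" by (intro ideal_adjoin_elem A Suc.prems gA)
  have "?J = P'"
  proof (rule Suc.IH[OF P'(3) iJ])
    show "?J \<subseteq> P'" using Suc.prems(3) P' by (intro adjoin_elem_least[OF iP']) auto
    show "finite (E - {g})" "E - {g} \<subseteq> M" using Suc.prems by auto
    show "card (E - {g}) \<le> e" using Suc.prems g by (simp add: card_Diff_singleton)
    have "J \<union> E \<subseteq> gen_ideal A (?J \<union> (E - {g}))"
      using gen_ideal_superset[of "?J \<union> (E - {g})" A] subset_adjoin_elem[OF A, of J g]
        elem_adjoin_elem[OF A Suc.prems(2), of g] by blast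
    moreover have "?J \<union> (E - {g}) \<subseteq> A" using ideal_subset[OF iJ] Suc.prems(5) M_sub by blast
    ultimately have "gen_ideal A (J \<union> E) \<subseteq> gen_ideal A (?J \<union> (E - {g}))"
      by (intro gen_ideal_least ideal_gen_ideal A)
    with Suc.prems(7) show "M \<subseteq> gen_ideal A (?J \<union> (E - {g}))" by blast
  qed
  have "P \<subseteq> J"
  proof (rule nakayama[OF iP Suc.prems(2) gM])
    fix p assume p: "p \<in> P"
    then have "p \<in> ?J" using \<open>?J = P'\<close> P' by blast
    then obtain j r where jr: "j \<in> J" "r \<in> A" "p = j + g * r" by (rule adjoin_elemE)
    have "g * r = p - j" using jr by simp
    moreover have "p - j \<in> P" using p jr Suc.prems(3) by (intro ideal_diff[OF A iP]) auto
    ultimately have "r \<in> P" using prime_ideal_mult[OF pP gA jr(2)] g by auto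
    with jr show "\<exists>d\<in>J. \<exists>c'\<in>P. p = d + g * c'" by blast
  qed
  with Suc.prems show ?case by blast
qed

text \<open>The dimension is recorded as a chain of \<open>card G\<close> steps ending in
  \<open>M\<close>. This lower bound, confronted with \<open>card G\<close> generators, is what
  forces every subset of \<open>G\<close> to generate a prime.\<close>

locale regular_system = noetherian_local A M for A M :: "'a::field set" +
  fixes G :: "'a set"
  assumes fin: "finite G" and gen: "M = gen_ideal A G" and chain: "\<exists>P. prime_chain A (card G) P M"
begin

lemma G_sub: "G \<subseteq> M"
  using gen gen_ideal_superset by blast

lemma G_A: "D \<subseteq> G \<Longrightarrow> D \<subseteq> A"
  using G_sub M_sub by blast

lemma prime_chain_over_params:
  assumes "D \<subseteq> G"
  shows "\<exists>P. gen_ideal A D \<subseteq> P \<and> prime_chain A (card G - card D) P M"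
proof -
  have "finite D" by (rule finite_subset[OF assms fin])
  then show ?thesis using assms
  proof (induction D)
    case empty
    obtain P where P: "prime_chain A (card G) P M" using chain by blast
    have "ideal A P" using prime_chain_prime[OF P] by (intro prime_ideal_ideal) simp
    then have "gen_ideal A {} \<subseteq> P" by (rule gen_ideal_least) simp
    with P show ?case by (intro exI[of _ P]) simp
  next
    case (insert g D)
    then have "\<exists>P. gen_ideal A D \<subseteq> P \<and> prime_chain A (card G - card D) P M" by simp
    then obtain P where P: "gen_ideal A D \<subseteq> P" "prime_chain A (card G - card D) P M" by (elim exE conjE)
    have "card (insert g D) \<le> card G" using insert.prems by (intro card_mono fin)
    then have "card G - card D = Suc (card G - card (insert g D))" using insert.hyps by simp
    then have ch: "prime_chain A (Suc (card G - card (insert g D))) P M" using P(2) by metis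
    have "g \<in> M" using insert.prems G_sub by auto
    from prime_chain_through[OF noeth ch this] obtain P'
      where P': "g \<in> P'" "P \<subseteq> P'" "prime_chain A (card G - card (insert g D)) P' M" by (elim exE conjE)
    have "ideal A P'" using prime_chain_prime[OF P'(3)] by (intro prime_ideal_ideal) simp
    moreover have "insert g D \<subseteq> P'" using P(1) P'(1,2) gen_ideal_superset[of D A] by auto
    ultimately have "gen_ideal A (insert g D) \<subseteq> P'" by (rule gen_ideal_least)
    with P'(3) show ?case by (intro exI[of _ P'] conjI)
  qed
qed

text \<open>Over \<open>gid D\<close> there is a chain with at least as many steps as there are
  remaining generators, so by \<open>prime_chain_generators\<close> its lowest prime is
  \<open>gid D\<close> itself.\<close>

lemma prime_gen:
  assumes D: "D \<subseteq> G" shows "prime_ideal A (gen_ideal A D)"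
proof -
  obtain P where P: "gen_ideal A D \<subseteq> P" "prime_chain A (card G - card D) P M"
    using prime_chain_over_params[OF D] by blast
  have "gen_ideal A D = P"
  proof (rule prime_chain_generators[OF P(2) ideal_gen_ideal[OF A G_A[OF D]] P(1)])
    show "finite (G - D)" "G - D \<subseteq> M" using fin G_sub by auto
    show "card (G - D) \<le> card G - card D" using D fin by (simp add: card_Diff_subset finite_subset)
    have "G \<subseteq> gen_ideal A D \<union> (G - D)" using gen_ideal_superset by blast
    then show "M \<subseteq> gen_ideal A (gen_ideal A D \<union> (G - D))" unfolding gen by (rule gen_ideal_mono)
  qed
  then show ?thesis using prime_chain_prime[OF P(2)] by simp
qed

lemma ideal_gen: "D \<subseteq> G \<Longrightarrow> ideal A (gen_ideal A D)"
  by (rule ideal_gen_ideal[OF A G_A])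

text \<open>Otherwise \<open>G - {g}\<close> would generate \<open>M\<close>, although some prime
  over it has one step of a chain left below \<open>M\<close>.\<close>

lemma params_independent:
  assumes D: "D \<subseteq> G" and g: "g \<in> G" "g \<notin> D" shows "g \<notin> gen_ideal A D"
proof
  assume *: "g \<in> gen_ideal A D"
  have "gen_ideal A D \<subseteq> gen_ideal A (G - {g})" using D g by (intro gen_ideal_mono) auto
  then have "G \<subseteq> gen_ideal A (G - {g})" using * gen_ideal_superset[of "G - {g}" A] by blast
  then have MG: "M \<subseteq> gen_ideal A (G - {g})" unfolding gen by (intro gen_ideal_least ideal_gen) auto
  obtain P where P: "gen_ideal A (G - {g}) \<subseteq> P" "prime_chain A (card G - card (G - {g})) P M"
    using prime_chain_over_params[of "G - {g}"] by blast
  have "card G > 0" using g fin card_gt_0_iff by blast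
  then have "card G - card (G - {g}) = Suc 0" using g fin by (simp add: card_Diff_singleton)
  with P(2) have "prime_chain A (Suc 0) P M" by simp
  then obtain Q where "prime_chain A 0 P Q" "Q \<subset> M" by (rule prime_chain_SucE) (rule that)
  then have "P \<subset> M" using prime_chain_0D by blast
  with MG P(1) show False by blast
qed

end

text \<open>The supremum \<open>d\<close> is not bounded by \<open>d - 1\<close>, so some chain has
  at least \<open>d\<close> steps, and it is cut off after \<open>d\<close>.\<close>

lemma krull_dim_prime_chain:
  assumes "krull_dim A = enat d" "d > 0"
  shows "\<exists>P Q. prime_chain A d P Q"
proof -
  let ?S = "{enat n | n. \<exists>P :: nat \<Rightarrow> 'a set. (\<forall>i\<le>n. prime_ideal A (P i)) \<and> (\<forall>i<n. P i \<subset> P (Suc i))}"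
  have "\<exists>n\<ge>d. enat n \<in> ?S"
  proof (rule ccontr)
    assume *: "\<not> ?thesis"
    have "Sup ?S \<le> enat (d - 1)"
    proof (rule Sup_least)
      fix e assume e: "e \<in> ?S"
      then obtain n where n: "e = enat n" by blast
      have "\<not> d \<le> n" using e * unfolding n by blast
      then have "n < d" by simp
      then show "e \<le> enat (d - 1)" using n by simp
    qed
    then show False using assms unfolding krull_dim_def by simp
  qed
  then obtain n P where n: "n \<ge> d" and P: "\<forall>i\<le>n. prime_ideal A (P i)" "\<forall>i<n. P i \<subset> P (Suc i)"
    by auto
  have "k \<le> n \<Longrightarrow> prime_chain A k (P 0) (P k)" for k
  proof (induction k)
    case 0
    show ?case using P(1) by (auto intro: prime_chain.chain_refl)
  next
    case (Suc k)
    then show ?case using P by (intro prime_chain.chain_step[of A k "P 0" "P k"]) auto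
  qed
  with n show ?thesis by blast
qed

text \<open>The top of a longest chain is replaced by \<open>M\<close>; the last inclusion stays
  strict because every prime lies in \<open>M\<close>. The bound on the dimension ensures that there
  is a last step.\<close>

lemma regular_local_regular_system:
  assumes "regular_local A" "krull_dim A \<ge> 2"
  shows "\<exists>G. regular_system A (max_ideal A) G"
proof -
  interpret noetherian_local A "max_ideal A" by (rule regular_local_noetherian_local[OF assms(1)])
  obtain d G where dG: "krull_dim A = enat d" "finite G" "card G = d" "max_ideal A = gen_ideal A G"
    using assms(1) by (auto simp: regular_local_def)
  have "2 \<le> d" using assms(2) unfolding dG(1) by (metis enat_ord_simps(1) numeral_eq_enat)
  then obtain P Q where PQ: "prime_chain A d P Q" using krull_dim_prime_chain[OF dG(1)] by auto
  obtain e where e: "d = Suc e" using \<open>2 \<le> d\<close> by (cases d) auto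
  obtain Q0 where Q0: "prime_chain A e P Q0" "prime_ideal A Q" "Q0 \<subset> Q"
    using PQ unfolding e by (rule prime_chain_SucE)
  have "Q0 \<subset> max_ideal A" using Q0 prime_subset_M by blast
  then have "prime_chain A d P (max_ideal A)" unfolding e using Q0 prime_M by (intro prime_chain.chain_step)
  then show ?thesis
    using dG noetherian_local_axioms
    by (intro exI[of _ G]) (auto simp: regular_system_def regular_system_axioms_def)
qed

section \<open>The associated graded ring of a regular local ring\<close>

lemma ideal_prod_least:
  assumes "0 \<in> K" "\<And>a b. a \<in> K \<Longrightarrow> b \<in> K \<Longrightarrow> a + b \<in> K" "\<And>i j. i \<in> I \<Longrightarrow> j \<in> J \<Longrightarrow> i * j \<in> K"
  shows "ideal_prod I J \<subseteq> K"
proof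
  fix x assume "x \<in> ideal_prod I J"
  then show "x \<in> K" by induction (use assms in auto)
qed

lemma ideal_ideal_prod:
  assumes A: "subring A" and I: "ideal A I" and J: "ideal A J"
  shows "ideal A (ideal_prod I J)"
proof -
  have "ideal_prod I J \<subseteq> A"
    by (rule ideal_prod_least)
       (auto intro: subring_0[OF A] subring_add[OF A] subring_mult[OF A] ideal_subset[OF I] ideal_subset[OF J])
  moreover have "r * x \<in> ideal_prod I J" if "x \<in> ideal_prod I J" "r \<in> A" for r x
    using that(1)
  proof induction
    case zero
    show ?case by (simp add: ideal_prod.zero)
  next
    case (mult i j)
    then show ?case
      using ideal_prod.mult[OF ideal_mult[OF I mult(1) that(2)] mult(2)] by (simp add: mult.assoc)
  next
    case (add a b)
    then show ?case using ideal_prod.add[OF add(3,4)] by (simp add: distrib_left)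
  qed
  ultimately show ?thesis
    by (auto simp: ideal_def intro: ideal_prod.zero ideal_prod.add)
qed

lemma ideal_prod_mono: "I \<subseteq> I' \<Longrightarrow> J \<subseteq> J' \<Longrightarrow> ideal_prod I J \<subseteq> ideal_prod I' J'"
  by (rule ideal_prod_least) (auto intro: ideal_prod.intros)

lemma ideal_pow_mono:
  assumes "I \<subseteq> J" shows "ideal_pow A I n \<subseteq> ideal_pow A J n"
  by (induction n) (simp_all add: ideal_prod_mono[OF assms])

context
  fixes A I :: "'a::field set"
  assumes A: "subring A" and I: "ideal A I"
begin

lemma ideal_ideal_pow: "ideal A (ideal_pow A I n)"
  by (induction n) (auto intro: ideal_whole A ideal_ideal_prod I)

lemma ideal_pow_Suc_subset: "ideal_pow A I (Suc n) \<subseteq> ideal_pow A I n"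
  unfolding ideal_pow.simps
  by (rule ideal_prod_least)
     (auto intro: ideal_0[OF ideal_ideal_pow] ideal_add[OF ideal_ideal_pow]
        ideal_mult[OF ideal_ideal_pow] ideal_subset[OF I])

lemma ideal_pow_antimono: "m \<le> n \<Longrightarrow> ideal_pow A I n \<subseteq> ideal_pow A I m"
  by (induction n) (use ideal_pow_Suc_subset in \<open>fastforce simp: le_Suc_eq\<close>)+

lemma ideal_pow_mult: "a \<in> ideal_pow A I n \<Longrightarrow> b \<in> ideal_pow A I k \<Longrightarrow> a * b \<in> ideal_pow A I (n + k)"
proof (induction n arbitrary: a)
  case 0
  then show ?case by (auto intro: ideal_mult[OF ideal_ideal_pow])
next
  case (Suc n)
  from Suc.prems(1) have "a \<in> ideal_prod I (ideal_pow A I n)" by simp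
  then show ?case
  proof induction
    case zero
    show ?case by (simp add: ideal_prod.zero)
  next
    case (mult i j)
    have "j * b \<in> ideal_pow A I (n + k)" by (rule Suc.IH[OF mult(2) Suc.prems(2)])
    then show ?case using ideal_prod.mult[OF mult(1)] by (simp add: mult.assoc)
  next
    case (add a1 a2)
    then show ?case by (simp add: distrib_right ideal_prod.add)
  qed
qed

lemma ideal_pow_one: "ideal_pow A I (Suc 0) = I"
proof
  show "ideal_pow A I (Suc 0) \<subseteq> I"
    by (simp, rule ideal_prod_least) (auto intro: ideal_0[OF I] ideal_add[OF I] ideal_mult'[OF I])
  show "I \<subseteq> ideal_pow A I (Suc 0)"
    using ideal_prod.mult[of _ I 1 A] subring_1[OF A] by auto
qed

lemma ideal_pow_mult_elem: "a \<in> I \<Longrightarrow> b \<in> ideal_pow A I n \<Longrightarrow> a * b \<in> ideal_pow A I (Suc n)"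
  by (simp add: ideal_prod.mult)

lemma power_in_ideal_pow: "a \<in> I \<Longrightarrow> a ^ n \<in> ideal_pow A I n"
  by (induction n) (auto intro: subring_1 A ideal_prod.mult)

lemma prod_mset_in_ideal_pow: "set_mset m \<subseteq> I \<Longrightarrow> prod_mset m \<in> ideal_pow A I (size m)"
  by (induction m) (auto intro: subring_1 A ideal_prod.mult)

end

section \<open>Filtrations modulo subsets of the parameters\<close>

context regular_system
begin

abbreviation gid where "gid D \<equiv> gen_ideal A D"
abbreviation pw where "pw E n \<equiv> ideal_pow A (gid E) n"

text \<open>The \<open>n\<close>-th power of the ideal generated by \<open>E\<close> in the residue
  ring modulo \<open>D\<close>, pulled back to \<open>A\<close>.\<close>

definition gpow :: "'a set \<Rightarrow> 'a set \<Rightarrow> nat \<Rightarrow> 'a set" where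
  "gpow D E n = {d + p | d p. d \<in> gid D \<and> p \<in> pw E n}"

lemma gpowI: "d \<in> gid D \<Longrightarrow> p \<in> pw E n \<Longrightarrow> a = d + p \<Longrightarrow> a \<in> gpow D E n"
  by (auto simp: gpow_def)

lemma gpowE:
  assumes "a \<in> gpow D E n"
  obtains d p where "d \<in> gid D" "p \<in> pw E n" "a = d + p"
  using assms by (auto simp: gpow_def)

lemma ideal_pw: "E \<subseteq> G \<Longrightarrow> ideal A (pw E n)"
  by (intro ideal_ideal_pow A ideal_gen)

lemma ideal_gpow:
  assumes D: "D \<subseteq> G" and E: "E \<subseteq> G" shows "ideal A (gpow D E n)"
  unfolding ideal_def
proof (intro conjI ballI)
  note iD = ideal_gen[OF D] and iE = ideal_pw[OF E, of n]
  show "gpow D E n \<subseteq> A"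
    unfolding gpow_def using subring_add[OF A ideal_subset[OF iD] ideal_subset[OF iE]] by blast
  show "0 \<in> gpow D E n" by (rule gpowI[OF ideal_0[OF iD] ideal_0[OF iE]]) simp
  show "a + b \<in> gpow D E n" if ab: "a \<in> gpow D E n" "b \<in> gpow D E n" for a b
  proof -
    obtain d p where 1: "d \<in> gid D" "p \<in> pw E n" "a = d + p" using ab(1) by (rule gpowE)
    obtain d' p' where 2: "d' \<in> gid D" "p' \<in> pw E n" "b = d' + p'" using ab(2) by (rule gpowE)
    show ?thesis
      by (rule gpowI[OF ideal_add[OF iD 1(1) 2(1)] ideal_add[OF iE 1(2) 2(2)]]) (simp add: 1 2)
  qed
  show "r * a \<in> gpow D E n" if ab: "a \<in> gpow D E n" "r \<in> A" for a r
  proof -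
    obtain d p where 1: "d \<in> gid D" "p \<in> pw E n" "a = d + p" using ab(1) by (rule gpowE)
    show ?thesis
      by (rule gpowI[OF ideal_mult[OF iD 1(1) ab(2)] ideal_mult[OF iE 1(2) ab(2)]])
        (simp add: 1 distrib_left)
  qed
qed

lemma gid_subset_gpow: "E \<subseteq> G \<Longrightarrow> d \<in> gid D \<Longrightarrow> d \<in> gpow D E n"
  by (rule gpowI[OF _ ideal_0[OF ideal_pw]]) auto

lemma pw_subset_gpow: "D \<subseteq> G \<Longrightarrow> p \<in> pw E n \<Longrightarrow> p \<in> gpow D E n"
  by (rule gpowI[OF ideal_0[OF ideal_gen]]) auto

lemma gpow_mono: "D \<subseteq> D' \<Longrightarrow> E \<subseteq> E' \<Longrightarrow> gpow D E n \<subseteq> gpow D' E' n"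
  unfolding gpow_def
  using gen_ideal_mono[of D D' A] ideal_pow_mono[OF gen_ideal_mono[of E E' A], of A n] by blast

lemma gpow_antimono:
  assumes E: "E \<subseteq> G" and mn: "m \<le> n" shows "gpow D E n \<subseteq> gpow D E m"
  unfolding gpow_def using ideal_pow_antimono[OF A ideal_gen[OF E] mn] by blast

lemma gpow_zero: "D \<subseteq> G \<Longrightarrow> a \<in> A \<Longrightarrow> a \<in> gpow D E 0"
  by (rule pw_subset_gpow) auto

lemma gpow_mult:
  assumes D: "D \<subseteq> G" and E: "E \<subseteq> G" and a: "a \<in> gpow D E n" and b: "b \<in> gpow D E k"
  shows "a * b \<in> gpow D E (n + k)"
proof -
  note iD = ideal_gen[OF D] and iE = ideal_pw[OF E]
  obtain d p where 1: "d \<in> gid D" "p \<in> pw E n" "a = d + p" using a by (rule gpowE)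
  obtain d' p' where 2: "d' \<in> gid D" "p' \<in> pw E k" "b = d' + p'" using b by (rule gpowE)
  have "a * b = (d * b + p * d') + p * p'" by (simp add: 1 2 algebra_simps)
  moreover have "p * p' \<in> pw E (n + k)" by (rule ideal_pow_mult[OF A ideal_gen[OF E] 1(2) 2(2)])
  moreover have "d * b + p * d' \<in> gid D"
    using ideal_subset[OF iE 1(2)] ideal_subset[OF ideal_gpow[OF D E] b] 1 2
    by (intro ideal_add[OF iD] ideal_mult'[OF iD 1(1)] ideal_mult[OF iD 2(1)])
  ultimately show ?thesis by (intro gpowI)
qed

lemma gid_insertE:
  assumes "D \<subseteq> G" "e \<in> G" "d \<in> gid (insert e D)"
  obtains d0 r where "d0 \<in> gid D" "r \<in> A" "d = d0 + e * r"
proof -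
  have "e \<in> A" using assms(2) G_A[OF order_refl] by auto
  then have "d \<in> adjoin_elem A (gid D) e"
    using assms(3) gen_ideal_insert[OF A G_A[OF assms(1)]] by simp
  then show thesis by (rule adjoin_elemE) (rule that)
qed

lemma gid_insertI:
  assumes "D \<subseteq> G" "e \<in> G" "d0 \<in> gid D" "r \<in> A" "d = d0 + e * r"
  shows "d \<in> gid (insert e D)"
proof -
  have "e \<in> A" using assms(2) G_A[OF order_refl] by auto
  then show ?thesis
    using gen_ideal_insert[OF A G_A[OF assms(1)]] adjoin_elemI[OF assms(3-5)] by simp
qed

lemma G_gid: "e \<in> E \<Longrightarrow> e \<in> gid E"
  using gen_ideal_superset by blast

text \<open>Monomials in \<open>insert e E\<close> are sorted into those without \<open>e\<close>
  and those with at least one factor \<open>e\<close>.\<close>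

lemma pw_insert:
  assumes E: "E \<subseteq> G" and e: "e \<in> G"
  shows "p \<in> pw (insert e E) (Suc n) \<Longrightarrow> \<exists>p0\<in>pw E (Suc n). \<exists>q\<in>pw (insert e E) n. p = p0 + e * q"
proof (induction n arbitrary: p)
  case 0
  have eE: "insert e E \<subseteq> G" using E e by simp
  have "p \<in> gid (insert e E)" using 0 ideal_pow_one[OF A ideal_gen[OF eE]] by simp
  then obtain d r where "d \<in> gid E" "r \<in> A" "p = d + e * r" by (rule gid_insertE[OF E e])
  moreover have "d \<in> pw E (Suc 0)" using \<open>d \<in> gid E\<close> ideal_pow_one[OF A ideal_gen[OF E]] by simp
  ultimately show ?case by auto
next
  case (Suc n)
  have eE: "insert e E \<subseteq> G" using E e by simp
  note iE = ideal_gen[OF E] and iI = ideal_gen[OF eE] and iP = ideal_pw[OF E] and iQ = ideal_pw[OF eE]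
  have sub: "gid E \<subseteq> gid (insert e E)" by (rule gen_ideal_mono) auto
  from Suc.prems have "p \<in> ideal_prod (gid (insert e E)) (pw (insert e E) (Suc n))" by simp
  then show ?case
  proof induction
    case zero
    show ?case using ideal_0[OF iP] ideal_0[OF iQ] by (intro bexI[of _ 0]) (simp_all del: ideal_pow.simps)
  next
    case (mult i j)
    obtain i0 r where i: "i0 \<in> gid E" "r \<in> A" "i = i0 + e * r" using mult(1) by (rule gid_insertE[OF E e])
    obtain j0 q where j: "j0 \<in> pw E (Suc n)" "q \<in> pw (insert e E) n" "j = j0 + e * q"
      using Suc.IH[OF mult(2)] by (elim bexE)
    have "i * j = i0 * j0 + e * (r * j + i0 * q)" by (simp add: i(3) j(3) algebra_simps)
    moreover have "i0 * j0 \<in> pw E (Suc (Suc n))" by (rule ideal_pow_mult_elem[OF A iE i(1) j(1)])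
    moreover have "r * j + i0 * q \<in> pw (insert e E) (Suc n)"
      using i(1) sub
      by (intro ideal_add[OF iQ] ideal_mult[OF iQ mult(2) i(2)] ideal_pow_mult_elem[OF A iI _ j(2)]) auto
    ultimately show ?case by blast
  next
    case (add a b)
    then obtain p1 q1 p2 q2 where
      "p1 \<in> pw E (Suc (Suc n))" "q1 \<in> pw (insert e E) (Suc n)" "a = p1 + e * q1"
      "p2 \<in> pw E (Suc (Suc n))" "q2 \<in> pw (insert e E) (Suc n)" "b = p2 + e * q2" by (elim bexE)
    then have "a + b = (p1 + p2) + e * (q1 + q2)" "p1 + p2 \<in> pw E (Suc (Suc n))"
      "q1 + q2 \<in> pw (insert e E) (Suc n)"
      using ideal_add[OF iP] ideal_add[OF iQ] by (simp_all add: algebra_simps del: ideal_pow.simps)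
    then show ?case by blast
  qed
qed

text \<open>After splitting off a summand \<open>e * q\<close> with \<open>q\<close> in the wanted
  power, what is left of \<open>e * u\<close> lies in \<open>D\<close> plus a power of
  \<open>E\<close> alone, where \<open>e\<close> is a nonzerodivisor by \<open>nzd\<close>.\<close>

lemma param_cancel_aux:
  assumes sub: "D \<subseteq> G" "E \<subseteq> G" "e \<in> G" and u: "u \<in> A"
    and nzd: "\<And>r n. r \<in> A \<Longrightarrow> e * r \<in> gpow D E n \<Longrightarrow> r \<in> gpow D E n"
    and h: "e * u \<in> gpow D (insert e E) (Suc n)"
  shows "u \<in> gpow D (insert e E) n"
proof -
  have eE: "insert e E \<subseteq> G" using sub by simp
  obtain d p where dp: "d \<in> gid D" "p \<in> pw (insert e E) (Suc n)" "e * u = d + p" using h by (rule gpowE)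
  obtain p0 q where pq: "p0 \<in> pw E (Suc n)" "q \<in> pw (insert e E) n" "p = p0 + e * q"
    using pw_insert[OF sub(2,3) dp(2)] by (elim bexE)
  have qA: "q \<in> A" by (rule ideal_subset[OF ideal_pw[OF eE] pq(2)])
  have "e * (u - q) \<in> gpow D E (Suc n)"
    by (rule gpowI[OF dp(1) pq(1)]) (use dp(3) pq(3) in \<open>simp add: algebra_simps\<close>)
  then have "u - q \<in> gpow D E (Suc n)" by (rule nzd[OF subring_diff[OF A u qA]])
  also have "gpow D E (Suc n) \<subseteq> gpow D E n" by (rule gpow_antimono[OF sub(2)]) simp
  also have "\<dots> \<subseteq> gpow D (insert e E) n" by (rule gpow_mono) auto
  finally have "(u - q) + q \<in> gpow D (insert e E) n"
    by (rule ideal_add[OF ideal_gpow[OF sub(1) eE] _ pw_subset_gpow[OF sub(1) pq(2)]])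
  then show ?thesis by simp
qed

text \<open>Quasi-regularity of a system of parameters all of whose subsets generate prime ideals.\<close>
lemma nonzerodivisor_mod_gpow:
  assumes "finite E"
  shows "D \<subseteq> G \<Longrightarrow> E \<subseteq> G \<Longrightarrow> t \<in> G \<Longrightarrow> t \<notin> D \<Longrightarrow> t \<notin> E \<Longrightarrow> D \<inter> E = {} \<Longrightarrow> r \<in> A \<Longrightarrow> t * r \<in> gpow D E n
    \<Longrightarrow> r \<in> gpow D E n"
  using assms
proof (induction E arbitrary: D t r n rule: finite_induct)
  case empty
  have tA: "t \<in> A" using empty G_A[OF order_refl] by auto
  show ?case
  proof (cases n)
    case 0
    then show ?thesis using gpow_zero empty by simp
  next
    case (Suc m)
    have "pw {} (Suc m) \<subseteq> {0}"
      unfolding gen_ideal_empty[OF A] ideal_pow.simps by (rule ideal_prod_least) auto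
    then have "t * r \<in> gid D" using empty.prems(8) unfolding Suc by (auto elim!: gpowE)
    then have "r \<in> gid D"
      using prime_ideal_mult[OF prime_gen[OF empty.prems(1)] tA empty.prems(7)]
        params_independent[OF empty.prems(1,3,4)] by simp
    then show ?thesis by (rule gid_subset_gpow[OF empty.prems(2)])
  qed
next
  case (insert e E)
  have sub: "D \<subseteq> G" "E \<subseteq> G" "e \<in> G" "insert e E \<subseteq> G" "insert e D \<subseteq> G" "e \<notin> D" using insert by auto
  have tG: "t \<in> G" and tA: "t \<in> A" and eA: "e \<in> A" using insert G_A[OF order_refl] by auto
  have cancel: "u \<in> gpow D (insert e E) n" if "u \<in> A" "e * u \<in> gpow D (insert e E) (Suc n)" for u n
  proof (rule param_cancel_aux[OF sub(1-3) that(1) _ that(2)])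
    fix r n assume "r \<in> A" "e * r \<in> gpow D E n"
    then show "r \<in> gpow D E n" using insert.IH[of D e] insert.hyps insert.prems sub by auto
  qed
  \<comment> \<open>Induction on \<open>n\<close> inside the induction on \<open>E\<close>. With
    \<open>e\<close> moved from \<open>E\<close> to \<open>D\<close> the outer hypothesis gives
    \<open>r = d1 + e * s + p'\<close>; cancelling \<open>e\<close> costs one degree, so
    \<open>s\<close> falls under the inner hypothesis.\<close>
  have "r \<in> A \<Longrightarrow> t * r \<in> gpow D (insert e E) n \<Longrightarrow> r \<in> gpow D (insert e E) n" for r
  proof (induction n arbitrary: r)
    case 0
    then show ?case using gpow_zero[OF sub(1)] by simp
  next
    case (Suc n)
    note iI = ideal_gpow[OF sub(1,4)]
    obtain d p where dp: "d \<in> gid D" "p \<in> pw (insert e E) (Suc n)" "t * r = d + p" using Suc.prems(2) by (rule gpowE)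
    obtain p0 q where pq: "p0 \<in> pw E (Suc n)" "q \<in> pw (insert e E) n" "p = p0 + e * q"
      using pw_insert[OF sub(2,3) dp(2)] by (elim bexE)
    have qA: "q \<in> A" by (rule ideal_subset[OF ideal_pw[OF sub(4)] pq(2)])
    have "d + e * q \<in> gid (insert e D)" by (rule gid_insertI[OF sub(1,3) dp(1) qA refl])
    then have "t * r \<in> gpow (insert e D) E (Suc n)" by (rule gpowI[OF _ pq(1)]) (simp add: dp pq)
    then have "r \<in> gpow (insert e D) E (Suc n)"
      using insert.IH[OF sub(5,2) tG _ _ _ Suc.prems(1)] insert.prems insert.hyps by auto
    then obtain d' p' where d'p': "d' \<in> gid (insert e D)" "p' \<in> pw E (Suc n)" "r = d' + p'" by (rule gpowE)
    obtain d1 s where d1s: "d1 \<in> gid D" "s \<in> A" "d' = d1 + e * s"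
      using d'p'(1) by (rule gid_insertE[OF sub(1,3)])
    have p'I: "p' \<in> gpow D (insert e E) (Suc n)"
      using gpow_mono[OF order_refl subset_insertI, of D E "Suc n" e] pw_subset_gpow[OF sub(1) d'p'(2)] by blast
    have d1I: "d1 \<in> gpow D (insert e E) (Suc n)" by (rule gid_subset_gpow[OF sub(4) d1s(1)])
    have "e * (t * s) = t * r - t * (d1 + p')" by (simp add: d'p' d1s algebra_simps)
    moreover have "t * r - t * (d1 + p') \<in> gpow D (insert e E) (Suc n)"
      by (intro ideal_diff[OF A iI Suc.prems(2)] ideal_mult[OF iI _ tA] ideal_add[OF iI] p'I d1I)
    ultimately have "e * (t * s) \<in> gpow D (insert e E) (Suc n)" by simp
    then have "t * s \<in> gpow D (insert e E) n" by (rule cancel[OF subring_mult[OF A tA d1s(2)]])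
    then have "s \<in> gpow D (insert e E) n" by (rule Suc.IH[OF d1s(2)])
    then obtain d2 p2 where d2: "d2 \<in> gid D" "p2 \<in> pw (insert e E) n" "s = d2 + p2" by (rule gpowE)
    have "e * s \<in> gpow D (insert e E) (Suc n)"
    proof (rule gpowI)
      show "e * d2 \<in> gid D" by (rule ideal_mult[OF ideal_gen[OF sub(1)] d2(1) eA])
      show "e * p2 \<in> pw (insert e E) (Suc n)"
        by (rule ideal_pow_mult_elem[OF A ideal_gen[OF sub(4)] G_gid d2(2)]) simp
      show "e * s = e * d2 + e * p2" by (simp add: d2 distrib_left)
    qed
    then have "d1 + p' + e * s \<in> gpow D (insert e E) (Suc n)" by (intro ideal_add[OF iI] p'I d1I)
    then show ?case by (simp add: d'p' d1s algebra_simps)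
  qed
  then show ?case using insert.prems by blast
qed

text \<open>The \<open>M\<close>-adic filtration of the residue ring modulo \<open>D\<close>, pulled
  back to \<open>A\<close>.\<close>

definition mpow :: "'a set \<Rightarrow> nat \<Rightarrow> 'a set" where
  "mpow D n = gpow D G n"

lemma gid_G: "gid G = M"
  using gen by simp

lemma M_pow_subset:
  assumes D: "D \<subseteq> G"
  shows "p \<in> ideal_pow A M n \<Longrightarrow> p \<in> gpow D (G - D) n"
proof (induction n arbitrary: p)
  case 0
  then show ?case by (intro gpow_zero D) simp
next
  case (Suc n)
  have DG: "G - D \<subseteq> G" by auto
  note iI = ideal_gpow[OF D DG]
  have "G \<subseteq> gpow D (G - D) (Suc 0)"
  proof
    fix g assume g: "g \<in> G"
    show "g \<in> gpow D (G - D) (Suc 0)"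
    proof (cases "g \<in> D")
      case True
      then show ?thesis by (intro gid_subset_gpow DG G_gid)
    next
      case False
      then have "g \<in> pw (G - D) (Suc 0)"
        unfolding ideal_pow_one[OF A ideal_gen[OF DG]] using g by (intro G_gid) simp
      then show ?thesis by (rule pw_subset_gpow[OF D])
    qed
  qed
  then have M1: "M \<subseteq> gpow D (G - D) (Suc 0)" unfolding gen by (rule gen_ideal_least[OF iI])
  have "ideal_prod M (ideal_pow A M n) \<subseteq> gpow D (G - D) (Suc n)"
  proof (rule ideal_prod_least)
    fix i j assume "i \<in> M" "j \<in> ideal_pow A M n"
    then show "i * j \<in> gpow D (G - D) (Suc n)"
      using gpow_mult[OF D DG _ Suc.IH, of i "Suc 0" j] M1 by auto
  qed (auto intro: ideal_0[OF iI] ideal_add[OF iI])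
  with Suc.prems show ?case by auto
qed

lemma mpow_eq:
  assumes D: "D \<subseteq> G" shows "mpow D n = gpow D (G - D) n"
proof
  show "gpow D (G - D) n \<subseteq> mpow D n" unfolding mpow_def by (rule gpow_mono) auto
  show "mpow D n \<subseteq> gpow D (G - D) n"
  proof
    fix a assume "a \<in> mpow D n"
    then obtain d p where dp: "d \<in> gid D" "p \<in> pw G n" "a = d + p" unfolding mpow_def by (rule gpowE)
    have "p \<in> gpow D (G - D) n" using M_pow_subset[OF D] dp(2) unfolding gid_G by blast
    moreover have "d \<in> gpow D (G - D) n" using dp(1) by (intro gid_subset_gpow) auto
    ultimately show "a \<in> gpow D (G - D) n"
      using ideal_add[OF ideal_gpow[OF D]] dp(3) by auto
  qed
qed

text \<open>The initial form of \<open>t\<close> is a nonzerodivisor in the graded ring of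
  \<open>A\<close> modulo \<open>D\<close>: by \<open>mpow_eq\<close> only the parameters outside
  \<open>D\<close> matter, and \<open>t\<close> is a nonzerodivisor modulo the powers of the
  others.\<close>

lemma param_cancel:
  assumes D: "D \<subseteq> G" and t: "t \<in> G" "t \<notin> D" and r: "r \<in> A" and h: "t * r \<in> mpow D (Suc n)"
  shows "r \<in> mpow D n"
proof -
  let ?E = "G - D - {t}"
  have eq: "G - D = insert t ?E" using t by auto
  have "r \<in> gpow D (insert t ?E) n"
  proof (rule param_cancel_aux[OF D _ t(1) r])
    show "t * r \<in> gpow D (insert t ?E) (Suc n)" using h unfolding mpow_eq[OF D] eq[symmetric] .
    show "s \<in> gpow D ?E k" if "s \<in> A" "t * s \<in> gpow D ?E k" for s k
      by (rule nonzerodivisor_mod_gpow[OF _ D _ t(1) t(2) _ _ that]) (use fin in auto)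
  qed auto
  then show ?thesis unfolding mpow_eq[OF D] eq[symmetric] .
qed

lemma ideal_mpow: "D \<subseteq> G \<Longrightarrow> ideal A (mpow D n)"
  unfolding mpow_def by (rule ideal_gpow) auto

lemma mpow_mono: "D \<subseteq> D' \<Longrightarrow> mpow D n \<subseteq> mpow D' n"
  unfolding mpow_def by (rule gpow_mono) auto

lemma mpow_antimono: "m \<le> n \<Longrightarrow> mpow D n \<subseteq> mpow D m"
  unfolding mpow_def by (rule gpow_antimono) auto

lemma mpow_mult: "D \<subseteq> G \<Longrightarrow> a \<in> mpow D n \<Longrightarrow> b \<in> mpow D k \<Longrightarrow> a * b \<in> mpow D (n + k)"
  unfolding mpow_def by (rule gpow_mult) auto

lemma gid_mpow: "D \<subseteq> G \<Longrightarrow> d \<in> gid D \<Longrightarrow> d \<in> mpow D n"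
  unfolding mpow_def by (rule gid_subset_gpow) auto

lemma M_pow_mpow: "D \<subseteq> G \<Longrightarrow> p \<in> ideal_pow A M n \<Longrightarrow> p \<in> mpow D n"
  unfolding mpow_def by (rule pw_subset_gpow) (simp_all add: gid_G)

lemma M_mpow: "D \<subseteq> G \<Longrightarrow> g \<in> M \<Longrightarrow> g \<in> mpow D (Suc 0)"
  by (rule M_pow_mpow) (simp_all only: ideal_pow_one[OF A ideal_M])

lemma mpow_empty: "mpow {} n = ideal_pow A M n"
  unfolding mpow_def gpow_def gid_G gen_ideal_empty[OF A] by auto

lemma mpow_G: "mpow G (Suc n) = M"
proof
  show "M \<subseteq> mpow G (Suc n)" using gid_mpow[of G] unfolding gid_G by blast
  have "ideal_pow A M (Suc n) \<subseteq> ideal_pow A M (Suc 0)"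
    by (rule ideal_pow_antimono[OF A ideal_M]) simp
  then have "ideal_pow A M (Suc n) \<subseteq> M" unfolding ideal_pow_one[OF A ideal_M] .
  then show "mpow G (Suc n) \<subseteq> M"
    unfolding mpow_def gpow_def gid_G using ideal_add[OF ideal_M] by blast
qed

lemma mpow_split:
  assumes D: "D \<subseteq> G" and t: "t \<in> G" and a: "a \<in> mpow (insert t D) n"
  obtains c r where "c \<in> mpow D n" "r \<in> A" "a = c + t * r"
proof -
  obtain d p where dp: "d \<in> gid (insert t D)" "p \<in> pw G n" "a = d + p"
    using a unfolding mpow_def by (rule gpowE)
  obtain d0 r where d: "d0 \<in> gid D" "r \<in> A" "d = d0 + t * r" using dp(1) by (rule gid_insertE[OF D t])
  have "d0 + p \<in> mpow D n" unfolding mpow_def by (rule gpowI[OF d(1) dp(2) refl])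
  then show thesis by (rule that[OF _ d(2)]) (simp add: dp d)
qed

text \<open>Leads from the residue field, \<open>D = G\<close>, back to \<open>A\<close> itself,
  \<open>D = {}\<close>, one parameter at a time.\<close>

lemma params_induct [consumes 1, case_names full step]:
  assumes D: "D \<subseteq> G" and full: "Q G"
    and step: "\<And>D t. D \<subseteq> G \<Longrightarrow> t \<in> G \<Longrightarrow> t \<notin> D \<Longrightarrow> Q (insert t D) \<Longrightarrow> Q D"
  shows "Q D"
proof -
  have "D \<subseteq> G \<Longrightarrow> card (G - D) = k \<Longrightarrow> Q D" for k
  proof (induction k arbitrary: D)
    case 0
    then have "G - D = {}" using fin by simp
    then have "D = G" using 0 by auto
    then show ?case using full by simp
  next
    case (Suc k)
    then have "G - D \<noteq> {}" by (metis card.empty nat.distinct(1))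
    then obtain t where t: "t \<in> G" "t \<notin> D" by auto
    have "G - insert t D = G - D - {t}" by auto
    then have "card (G - insert t D) = k" using Suc.prems t fin by simp
    then show ?case using step[OF Suc.prems(1) t] Suc.IH[of "insert t D"] Suc.prems(1) t by simp
  qed
  then show ?thesis using D by blast
qed

text \<open>The graded ring of \<open>A\<close> modulo \<open>D\<close> is a domain. If a product of
  initial forms vanishes, one factor vanishes modulo \<open>t\<close> by the descending induction,
  so it is a multiple of \<open>t\<close>, and an induction on the total degree removes this
  \<open>t\<close>.\<close>

lemma mpow_order_multiplicative:
  assumes "D \<subseteq> G"
  shows "a \<in> mpow D n \<Longrightarrow> b \<in> mpow D k \<Longrightarrow> a * b \<in> mpow D (Suc (n + k))
    \<Longrightarrow> a \<in> mpow D (Suc n) \<or> b \<in> mpow D (Suc k)"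
  using assms
proof (induction D arbitrary: n k a b rule: params_induct)
  case full
  show ?case
  proof (cases n)
    case (Suc n')
    then show ?thesis using full(1) by (simp add: mpow_G)
  next
    case n: 0
    show ?thesis
    proof (cases k)
      case (Suc k')
      then show ?thesis using full(2) by (simp add: mpow_G)
    next
      case 0
      have "a \<in> A" "b \<in> A"
        using full(1,2) ideal_subset[OF ideal_mpow[OF order_refl]] by auto
      then show ?thesis using full(3) prime_ideal_mult[OF prime_M] by (simp add: mpow_G)
    qed
  qed
next
  case (step D t)
  have D': "insert t D \<subseteq> G" using step by simp
  have tM: "t \<in> M" and tA: "t \<in> A" using step(2) G_sub M_sub by auto
  note iI = ideal_mpow[OF step(1)]
  have up: "x \<in> mpow D m \<Longrightarrow> x \<in> mpow (insert t D) m" for x m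
    using mpow_mono[of D "insert t D" m] by auto
  have "n + k = s \<Longrightarrow> a \<in> mpow D n \<Longrightarrow> b \<in> mpow D k \<Longrightarrow> a * b \<in> mpow D (Suc (n + k))
    \<Longrightarrow> a \<in> mpow D (Suc n) \<or> b \<in> mpow D (Suc k)" for n k a b s
  proof (induction s arbitrary: n k a b)
    case (0 n k a b)
    have half: "x \<in> mpow D (Suc 0)" if "x \<in> mpow (insert t D) (Suc 0)" for x
      using that
    proof (rule mpow_split[OF step(1,2)])
      fix c r assume "c \<in> mpow D (Suc 0)" "r \<in> A" "x = c + t * r"
      then show ?thesis
        using ideal_add[OF iI] ideal_mult'[OF iI M_mpow[OF step(1) tM]] by blast
    qed
    show ?case using step(4)[OF up[OF 0(2)] up[OF 0(3)] up[OF 0(4)]] half 0(1) by auto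
  next
    case (Suc s n k a b)
    \<comment> \<open>Here the initial form of \<open>x\<close> is a multiple of \<open>t\<close>:
      \<open>x = c + t * r\<close> with \<open>c\<close> of higher order. Cancelling
      \<open>t\<close> leaves \<open>r * y\<close>, of total degree smaller by one.\<close>
    have half: "x \<in> mpow D (Suc m) \<or> y \<in> mpow D (Suc l)"
      if ml: "m + l = Suc s" and x: "x \<in> mpow D m" and y: "y \<in> mpow D l"
        and xy: "x * y \<in> mpow D (Suc (m + l))" and x': "x \<in> mpow (insert t D) (Suc m)" for x y m l
      using x'
    proof (rule mpow_split[OF step(1,2)])
      fix c r assume c: "c \<in> mpow D (Suc m)" and r: "r \<in> A" and xc: "x = c + t * r"
      have yA: "y \<in> A" by (rule ideal_subset[OF iI y])
      show ?thesis
      proof (cases m)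
        case 0
        have "t * r \<in> mpow D (Suc 0)" by (rule ideal_mult'[OF iI M_mpow[OF step(1) tM] r])
        then show ?thesis using c xc 0 ideal_add[OF iI] by auto
      next
        case (Suc m')
        have "c \<in> mpow D m" using c mpow_antimono[of m "Suc m" D] by auto
        then have "x - c \<in> mpow D m" by (rule ideal_diff[OF A iI x])
        then have r1: "r \<in> mpow D m'"
          using param_cancel[OF step(1,2,3) r, of m'] xc Suc by simp
        have "c * y \<in> mpow D (Suc (m + l))" using mpow_mult[OF step(1) c y] by simp
        then have "x * y - c * y \<in> mpow D (Suc (m + l))" by (rule ideal_diff[OF A iI xy])
        then have "t * (r * y) \<in> mpow D (Suc (m + l))" by (simp add: xc algebra_simps)
        then have "r * y \<in> mpow D (m + l)" by (rule param_cancel[OF step(1,2,3) subring_mult[OF A r yA]])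
        then have "r \<in> mpow D (Suc m') \<or> y \<in> mpow D (Suc l)"
          using ml Suc by (intro Suc.IH[OF _ r1 y]) auto
        moreover have "x \<in> mpow D (Suc m)" if "r \<in> mpow D (Suc m')"
        proof -
          have "t * r \<in> mpow D (Suc m)"
            using mpow_mult[OF step(1) M_mpow[OF step(1) tM] that] Suc by simp
          then show ?thesis unfolding xc by (rule ideal_add[OF iI c])
        qed
        ultimately show ?thesis by blast
      qed
    qed
    have "a \<in> mpow (insert t D) (Suc n) \<or> b \<in> mpow (insert t D) (Suc k)"
      by (rule step(4)[OF up[OF Suc.prems(2)] up[OF Suc.prems(3)] up[OF Suc.prems(4)]])
    then show ?case
    proof
      assume "a \<in> mpow (insert t D) (Suc n)"
      then show ?thesis by (rule half[OF Suc.prems])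
    next
      assume *: "b \<in> mpow (insert t D) (Suc k)"
      have "b * a \<in> mpow D (Suc (k + n))" "k + n = Suc s"
        using Suc.prems by (simp_all add: mult.commute add.commute)
      then show ?thesis using half[OF _ Suc.prems(3,2) _ *] by blast
    qed
  qed
  then show ?case using step.prems by blast
qed

lemma M_pow_order_multiplicative:
  "a \<in> ideal_pow A M n \<Longrightarrow> b \<in> ideal_pow A M k \<Longrightarrow> a * b \<in> ideal_pow A M (Suc (n + k))
    \<Longrightarrow> a \<in> ideal_pow A M (Suc n) \<or> b \<in> ideal_pow A M (Suc k)"
  using mpow_order_multiplicative[of "{}"] unfolding mpow_empty by simp

text \<open>By descent an element of all these powers is \<open>d + t * r\<close>, and
  \<open>r\<close> is again in all of them, since \<open>t\<close> can be cancelled. Thus it lies in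
  \<open>gid D + t^k A\<close> for every \<open>k\<close>, and the intersection theorem for the
  single element \<open>t\<close> suffices.\<close>

lemma mpow_Inter:
  assumes "D \<subseteq> G"
  shows "(\<And>n. a \<in> mpow D n) \<Longrightarrow> a \<in> gid D"
  using assms
proof (induction D arbitrary: a rule: params_induct)
  case full
  then show ?case using mpow_G[of 0] gid_G by blast
next
  case (step D t)
  have D': "insert t D \<subseteq> G" using step by simp
  note iD = ideal_gen[OF step(1)] and iI = ideal_mpow[OF step(1)]
  have tM: "t \<in> M" and tA: "t \<in> A" using step(2) G_sub M_sub by auto
  have "(\<And>n. b \<in> mpow D n) \<Longrightarrow> b \<in> adjoin_elem A (gid D) (t ^ k)" for b k
  proof (induction k arbitrary: b)
    case 0
    have "b \<in> A" by (rule ideal_subset[OF iI 0])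
    then show ?case by (intro adjoin_elemI[OF ideal_0[OF iD]]) auto
  next
    case (Suc k)
    have "b \<in> gid (insert t D)"
      by (rule step(4)) (use Suc.prems mpow_mono[of D "insert t D"] in blast)
    then obtain d r where dr: "d \<in> gid D" "r \<in> A" "b = d + t * r" by (rule gid_insertE[OF step(1,2)])
    have "r \<in> mpow D n" for n
    proof (rule param_cancel[OF step(1-3) dr(2)])
      have "b - d \<in> mpow D (Suc n)" by (rule ideal_diff[OF A iI Suc.prems gid_mpow[OF step(1) dr(1)]])
      then show "t * r \<in> mpow D (Suc n)" by (simp add: dr)
    qed
    then have "r \<in> adjoin_elem A (gid D) (t ^ k)" by (rule Suc.IH)
    then obtain j s where js: "j \<in> gid D" "s \<in> A" "r = j + t ^ k * s" by (rule adjoin_elemE)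
    have "d + t * j \<in> gid D" by (rule ideal_add[OF iD dr(1) ideal_mult[OF iD js(1) tA]])
    then show ?case by (rule adjoin_elemI[OF _ js(2)]) (simp add: dr js algebra_simps)
  qed
  then show ?case using krull_intersection_elem[OF iD tM] step.prems by blast
qed

lemma M_pow_Inter: "(\<And>n. a \<in> ideal_pow A M n) \<Longrightarrow> a = 0"
  using mpow_Inter[of "{}" a] unfolding mpow_empty gen_ideal_empty[OF A] by simp

end

section \<open>Complete integral closedness and analytic independence\<close>

lemma power_diff_in_ideal:
  assumes A: "subring A" and J: "ideal A J" and xy: "x \<in> A" "y \<in> A" "x - y \<in> J"
  shows "x ^ n - y ^ n \<in> J"
proof (induction n)
  case 0
  show ?case using ideal_0[OF J] by simp
next
  case (Suc n)
  have "x ^ Suc n - y ^ Suc n = x * (x ^ n - y ^ n) + (x - y) * y ^ n" by (simp add: algebra_simps)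
  also have "\<dots> \<in> J"
    by (rule ideal_add[OF J ideal_mult[OF J Suc xy(1)] ideal_mult'[OF J xy(3) subring_power[OF A xy(2)]]])
  finally show ?case .
qed

context regular_system
begin

text \<open>Hypothesis \<open>h\<close> says that \<open>a / b\<close> is almost integral over the
  residue ring modulo \<open>J\<close>, with multiplier \<open>d\<close>. When \<open>b\<close> is
  prime to \<open>t\<close>, factors \<open>t\<close> can be cancelled modulo \<open>J\<close> and
  the powers of \<open>b\<close>, so both the multiplier and the remainder of \<open>a\<close> may
  be divided by \<open>t\<close> until the intersection theorem decides.\<close>

lemma cic_aux_unit:
  assumes J: "prime_ideal A J" and t: "t \<in> M" "t \<notin> J"
    and J': "J' = adjoin_elem A J t" "prime_ideal A J'"
    and IH: "\<And>a b d. a \<in> A \<Longrightarrow> b \<in> A \<Longrightarrow> d \<in> A \<Longrightarrow> b \<notin> J' \<Longrightarrow> d \<notin> J' \<Longrightarrow>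
      (\<And>n. d * a ^ n \<in> adjoin_elem A J' (b ^ n)) \<Longrightarrow> a \<in> adjoin_elem A J' b"
    and ab: "a \<in> A" "b \<in> A" "d \<in> A" "b \<notin> J'" "d \<notin> J"
    and h: "\<And>n. d * a ^ n \<in> adjoin_elem A J (b ^ n)"
  shows "a \<in> adjoin_elem A J b"
proof -
  have iJ: "ideal A J" and iJ': "ideal A J'" using J J' by (auto intro: prime_ideal_ideal)
  have tA: "t \<in> A" using t(1) by (rule M_sub)
  note pwA = subring_power[OF A]
  note iB = ideal_adjoin_elem[OF A iJ pwA[OF ab(2)]]
  have sub: "J \<subseteq> adjoin_elem A J c" for c by (rule subset_adjoin_elem[OF A])
  have cancel: "e \<in> adjoin_elem A J (b ^ n)" if e: "e \<in> A" "t * e \<in> adjoin_elem A J (b ^ n)" for e n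
    using e(2)
  proof (rule adjoin_elemE)
    fix j r assume jr: "j \<in> J" "r \<in> A" "t * e = j + b ^ n * r"
    have "b ^ n * r = - j + t * e" using jr by simp
    then have "b ^ n * r \<in> J'"
      unfolding J'(1) by (rule adjoin_elemI[OF ideal_uminus[OF A iJ jr(1)] e(1)])
    then have "b ^ n \<in> J' \<or> r \<in> J'" by (rule prime_ideal_mult[OF J'(2) pwA[OF ab(2)] jr(2)])
    then have "r \<in> J'" using prime_ideal_power[OF A J'(2) ab(2)] ab(4) by blast
    then obtain j' r' where r': "j' \<in> J" "r' \<in> A" "r = j' + t * r'" unfolding J'(1) by (rule adjoin_elemE)
    have br: "b ^ n * r' \<in> A" by (rule subring_mult[OF A pwA[OF ab(2)] r'(2)])
    have "t * (e - b ^ n * r') = j + b ^ n * j'" using jr r' by (simp add: algebra_simps)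
    also have "\<dots> \<in> J" by (rule ideal_add[OF iJ jr(1) ideal_mult[OF iJ r'(1) pwA[OF ab(2)]]])
    finally have "e - b ^ n * r' \<in> J"
      using prime_ideal_mult[OF J tA subring_diff[OF A e(1) br]] t(2) by blast
    then show ?thesis by (rule adjoin_elemI[OF _ r'(2)]) simp
  qed
  have cancel_pow: "e \<in> adjoin_elem A J (b ^ n)"
    if "e \<in> A" "t ^ k * e \<in> adjoin_elem A J (b ^ n)" for e n k
    using that(2)
  proof (induction k)
    case (Suc k)
    have "t * (t ^ k * e) \<in> adjoin_elem A J (b ^ n)" using Suc.prems by (simp add: mult.assoc)
    then show ?case by (intro Suc.IH cancel[OF subring_mult[OF A pwA[OF tA] that(1)]])
  qed simp
  \<comment> \<open>A multiplier outside \<open>J'\<close>: if all multipliers lay in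
    \<open>J'\<close>, each would be \<open>t\<close> times another one modulo \<open>J\<close>, and
    the given \<open>d\<close> would lie in every \<open>J + t^k A\<close>, hence in
    \<open>J\<close>.\<close>
  obtain d where d: "d \<in> A" "d \<notin> J'" and hd: "\<And>n. d * a ^ n \<in> adjoin_elem A J (b ^ n)"
  proof (rule ccontr)
    assume neg: "\<not> thesis"
    have H: "e \<in> J'" if "e \<in> A" "\<And>n. e * a ^ n \<in> adjoin_elem A J (b ^ n)" for e
      using neg that(1) that(2) \<open>\<And>d. d \<in> A \<Longrightarrow> d \<notin> J' \<Longrightarrow> (\<And>n. d * a ^ n \<in> adjoin_elem A J (b ^ n)) \<Longrightarrow> thesis\<close>
      by blast
    have "e \<in> A \<Longrightarrow> (\<And>n. e * a ^ n \<in> adjoin_elem A J (b ^ n)) \<Longrightarrow> e \<in> adjoin_elem A J (t ^ k)" for e k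
    proof (induction k arbitrary: e)
      case 0
      then show ?case by (intro adjoin_elemI[OF ideal_0[OF iJ] 0(1)]) simp
    next
      case (Suc k)
      have "e \<in> J'" by (rule H[OF Suc.prems])
      then obtain j r where jr: "j \<in> J" "r \<in> A" "e = j + t * r" unfolding J'(1) by (rule adjoin_elemE)
      have "r * a ^ n \<in> adjoin_elem A J (b ^ n)" for n
      proof (rule cancel)
        show "r * a ^ n \<in> A" by (rule subring_mult[OF A jr(2) pwA[OF ab(1)]])
        have "j * a ^ n \<in> adjoin_elem A J (b ^ n)"
          using ideal_mult'[OF iJ jr(1) pwA[OF ab(1)]] sub by blast
        then have "e * a ^ n - j * a ^ n \<in> adjoin_elem A J (b ^ n)" by (rule ideal_diff[OF A iB Suc.prems(2)])
        then show "t * (r * a ^ n) \<in> adjoin_elem A J (b ^ n)" by (simp add: jr algebra_simps)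
      qed
      then have "r \<in> adjoin_elem A J (t ^ k)" by (rule Suc.IH[OF jr(2)])
      then obtain j' s where js: "j' \<in> J" "s \<in> A" "r = j' + t ^ k * s" by (rule adjoin_elemE)
      have "j + t * j' \<in> J" by (rule ideal_add[OF iJ jr(1) ideal_mult[OF iJ js(1) tA]])
      then show ?case by (rule adjoin_elemI[OF _ js(2)]) (simp add: jr js algebra_simps)
    qed
    then have "d \<in> adjoin_elem A J (t ^ k)" for k using ab(3) h by blast
    then have "d \<in> J" by (rule krull_intersection_elem[OF iJ t(1)])
    with ab(5) show False by simp
  qed
  let ?K = "adjoin_elem A J b"
  have iK: "ideal A ?K" by (rule ideal_adjoin_elem[OF A iJ ab(2)])
  \<comment> \<open>Modulo \<open>J'\<close> the element \<open>c\<close> is a multiple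
    \<open>b * e\<close>, so \<open>c - b * e\<close> is \<open>t * r\<close> modulo
    \<open>J\<close>. The hypothesis passes to \<open>c - b * e\<close> and, after cancelling
    \<open>t ^ n\<close>, to \<open>r\<close>.\<close>
  have "c \<in> A \<Longrightarrow> (\<And>n. d * c ^ n \<in> adjoin_elem A J (b ^ n)) \<Longrightarrow> c \<in> adjoin_elem A ?K (t ^ k)" for c k
  proof (induction k arbitrary: c)
    case 0
    then show ?case by (intro adjoin_elemI[OF ideal_0[OF iK] 0(1)]) simp
  next
    case (Suc k)
    have JJ': "J \<subseteq> J'" unfolding J'(1) by (rule sub)
    have "c \<in> adjoin_elem A J' b"
      by (rule IH[OF Suc.prems(1) ab(2) d(1) ab(4) d(2)])
        (use adjoin_elem_mono[OF JJ'] Suc.prems(2) in blast)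
    then obtain j' e where e: "j' \<in> J'" "e \<in> A" "c = j' + b * e" by (rule adjoin_elemE)
    obtain j r where jr: "j \<in> J" "r \<in> A" "j' = j + t * r" using e(1) unfolding J'(1) by (rule adjoin_elemE)
    have cb: "c - b * e \<in> A" by (intro subring_diff[OF A] Suc.prems(1) subring_mult[OF A] ab(2) e(2))
    have *: "d * c ^ i * (c - b * e) ^ m \<in> adjoin_elem A J (b ^ (i + m))" for i m
    proof (induction m arbitrary: i)
      case 0
      then show ?case using Suc.prems(2) by simp
    next
      case (Suc m)
      have eq: "d * c ^ i * (c - b * e) ^ Suc m =
        d * c ^ Suc i * (c - b * e) ^ m - b * (d * c ^ i * (c - b * e) ^ m) * e"
        by (simp add: algebra_simps)
      have m1: "d * c ^ Suc i * (c - b * e) ^ m \<in> adjoin_elem A J (b ^ (i + Suc m))"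
        using Suc.IH[of "Suc i"] by simp
      have m2: "b * (d * c ^ i * (c - b * e) ^ m) \<in> adjoin_elem A J (b ^ (i + Suc m))"
        using Suc.IH[of i]
      proof (rule adjoin_elemE)
        fix j0 r0 assume 0: "j0 \<in> J" "r0 \<in> A" "d * c ^ i * (c - b * e) ^ m = j0 + b ^ (i + m) * r0"
        show ?thesis
          by (rule adjoin_elemI[OF ideal_mult[OF iJ 0(1) ab(2)] 0(2)]) (unfold 0(3), simp add: algebra_simps)
      qed
      show ?case unfolding eq by (rule ideal_diff[OF A iB m1 ideal_mult'[OF iB m2 e(2)]])
    qed
    have "d * r ^ n \<in> adjoin_elem A J (b ^ n)" for n
    proof (rule cancel_pow)
      show "d * r ^ n \<in> A" by (intro subring_mult[OF A] d(1) pwA jr(2))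
      have "(t * r) - (c - b * e) = - j" using e(3) jr(3) by simp
      then have "(t * r) - (c - b * e) \<in> J" using ideal_uminus[OF A iJ jr(1)] by simp
      then have "(t * r) ^ n - (c - b * e) ^ n \<in> J"
        by (rule power_diff_in_ideal[OF A iJ subring_mult[OF A tA jr(2)] cb])
      then have "d * ((t * r) ^ n - (c - b * e) ^ n) \<in> adjoin_elem A J (b ^ n)"
        using ideal_mult[OF iJ _ d(1)] sub by blast
      then have "d * ((t * r) ^ n - (c - b * e) ^ n) + d * c ^ 0 * (c - b * e) ^ n \<in> adjoin_elem A J (b ^ n)"
        using *[of 0 n] ideal_add[OF iB] by simp
      then show "t ^ n * (d * r ^ n) \<in> adjoin_elem A J (b ^ n)"
        by (simp add: algebra_simps power_mult_distrib)
    qed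
    then have "r \<in> adjoin_elem A ?K (t ^ k)" by (rule Suc.IH[OF jr(2)])
    then obtain u s where us: "u \<in> ?K" "s \<in> A" "r = u + t ^ k * s" by (rule adjoin_elemE)
    have "j + b * e + t * u \<in> ?K"
      by (intro ideal_add[OF iK] ideal_mult[OF iK us(1) tA] adjoin_elemI[OF jr(1) e(2)] refl)
    then show ?case by (rule adjoin_elemI[OF _ us(2)]) (simp add: e(3) jr(3) us(3) algebra_simps)
  qed
  then have "a \<in> adjoin_elem A ?K (t ^ k)" for k using ab(1) hd by blast
  then show ?thesis by (rule krull_intersection_elem[OF iK t(1)])
qed

text \<open>Descending induction on the set of parameters: for b prime to t reduce modulo t,
  otherwise divide both a and b by t.\<close>
lemma completely_integrally_closed_mod:
  assumes "D \<subseteq> G"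
  shows "a \<in> A \<Longrightarrow> b \<in> A \<Longrightarrow> d \<in> A \<Longrightarrow> b \<notin> gid D \<Longrightarrow> d \<notin> gid D \<Longrightarrow>
    (\<And>n. d * a ^ n \<in> adjoin_elem A (gid D) (b ^ n)) \<Longrightarrow> a \<in> adjoin_elem A (gid D) b"
  using assms
proof (induction D arbitrary: a b d rule: params_induct)
  case full
  have bM: "b \<notin> M" using full(4) gid_G by simp
  then have "b \<noteq> 0" using ideal_0[OF ideal_M] by auto
  then have "a = 0 + b * (inverse b * a)" by simp
  then show ?case
    by (rule adjoin_elemI[OF ideal_0[OF ideal_gen[OF order_refl]]
          subring_mult[OF A inverse_in[OF full(2) bM] full(1)]])
next
  case (step D t)
  let ?J = "gid D" and ?J' = "gid (insert t D)"
  have tM: "t \<in> M" and tA: "t \<in> A" using step(2) G_sub M_sub by auto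
  have J: "prime_ideal A ?J" by (rule prime_gen[OF step(1)])
  have J': "prime_ideal A ?J'" by (rule prime_gen) (use step in auto)
  have J'eq: "?J' = adjoin_elem A ?J t" by (rule gen_ideal_insert[OF A G_A[OF step(1)] tA])
  have tJ: "t \<notin> ?J" by (rule params_independent[OF step(1-3)])
  have iJ: "ideal A ?J" and iJ': "ideal A ?J'" using J J' by (auto intro: prime_ideal_ideal)
  note pwA = subring_power[OF A]
  have unit: "a \<in> adjoin_elem A ?J b"
    if "a \<in> A" "b \<in> A" "d \<in> A" "b \<notin> ?J'" "d \<notin> ?J" "\<And>n. d * a ^ n \<in> adjoin_elem A ?J (b ^ n)" for a b d
    by (rule cic_aux_unit[OF J tM tJ J'eq J' step(4) that])
  have cancel: "e \<in> adjoin_elem A ?J (t ^ k)"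
    if "a \<in> A" "a \<notin> ?J'" "e \<in> A" "e * a \<in> adjoin_elem A ?J (t ^ k)" for a e k
    using that(3,4)
  proof (induction k arbitrary: e)
    case 0
    then show ?case by (intro adjoin_elemI[OF ideal_0[OF iJ] 0(1)]) simp
  next
    case (Suc k)
    obtain j r where jr: "j \<in> ?J" "r \<in> A" "e * a = j + t ^ Suc k * r" using Suc.prems(2) by (rule adjoin_elemE)
    have "e * a \<in> ?J'"
      unfolding J'eq by (rule adjoin_elemI[OF jr(1) subring_mult[OF A pwA[OF tA, of k] jr(2)]]) (simp add: jr mult.assoc)
    then have "e \<in> ?J'" using prime_ideal_mult[OF J' Suc.prems(1) that(1)] that(2) by blast
    then obtain j2 e1 where e1: "j2 \<in> ?J" "e1 \<in> A" "e = j2 + t * e1" unfolding J'eq by (rule adjoin_elemE)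
    have "t * (e1 * a - t ^ k * r) = j - j2 * a" using jr(3) e1(3) by (simp add: algebra_simps)
    also have "\<dots> \<in> ?J" by (rule ideal_diff[OF A iJ jr(1) ideal_mult'[OF iJ e1(1) that(1)]])
    finally have "e1 * a - t ^ k * r \<in> ?J"
      using prime_ideal_mult[OF J tA subring_diff[OF A subring_mult[OF A e1(2) that(1)] subring_mult[OF A pwA[OF tA] jr(2)]]] tJ
      by blast
    then have "e1 * a \<in> adjoin_elem A ?J (t ^ k)" by (rule adjoin_elemI[OF _ jr(2)]) simp
    then have "e1 \<in> adjoin_elem A ?J (t ^ k)" by (rule Suc.IH[OF e1(2)])
    then obtain j3 s where s: "j3 \<in> ?J" "s \<in> A" "e1 = j3 + t ^ k * s" by (rule adjoin_elemE)
    show ?case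
      by (rule adjoin_elemI[OF ideal_add[OF iJ e1(1) ideal_mult[OF iJ s(1) tA]] s(2)])
        (simp add: e1 s algebra_simps)
  qed
  \<comment> \<open>The induction on \<open>s\<close> counts how often \<open>t\<close> can be
    divided out of \<open>b\<close>; a bound exists because \<open>b\<close> is nonzero modulo
    \<open>?J\<close>.\<close>
  have main: "b \<notin> adjoin_elem A ?J (t ^ s) \<Longrightarrow> a \<in> A \<Longrightarrow> b \<in> A \<Longrightarrow> b \<notin> ?J \<Longrightarrow>
    (\<And>n. d * a ^ n \<in> adjoin_elem A ?J (b ^ n)) \<Longrightarrow> a \<in> adjoin_elem A ?J b" for a b s
  proof (induction s arbitrary: a b)
    case 0
    have "b \<in> adjoin_elem A ?J (t ^ 0)" by (rule adjoin_elemI[OF ideal_0[OF iJ] 0(3)]) simp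
    with 0 show ?case by blast
  next
    case (Suc s)
    show ?case
    proof (cases "b \<in> ?J'")
      case False
      show ?thesis by (rule unit[OF Suc.prems(2,3) step.prems(3) False step.prems(5) Suc.prems(5)])
    next
      case True
      then obtain j b1 where b1: "j \<in> ?J" "b1 \<in> A" "b = j + t * b1" unfolding J'eq by (rule adjoin_elemE)
      have tb: "t * b1 \<in> A" by (rule subring_mult[OF A tA b1(2)])
      have bt: "b ^ n - (t * b1) ^ n \<in> ?J" for n
        by (rule power_diff_in_ideal[OF A iJ Suc.prems(3) tb]) (simp add: b1)
      have ht: "d * a ^ n \<in> adjoin_elem A ?J ((t * b1) ^ n)" for n
        using Suc.prems(5)[of n]
      proof (rule adjoin_elemE)
        fix j0 r assume 0: "j0 \<in> ?J" "r \<in> A" "d * a ^ n = j0 + b ^ n * r"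
        show ?thesis
          by (rule adjoin_elemI[OF ideal_add[OF iJ 0(1) ideal_mult'[OF iJ bt 0(2)]] 0(2)])
            (simp add: 0(3) algebra_simps)
      qed
      \<comment> \<open>As \<open>t\<close> divides \<open>b\<close>, an \<open>a\<close> prime to
        \<open>t\<close> would make the multiplier \<open>d\<close> divisible by all powers of
        \<open>t\<close>, although it is nonzero modulo \<open>?J\<close>.\<close>
      have "a \<in> ?J'"
      proof (rule ccontr)
        assume a: "a \<notin> ?J'"
        have "d \<in> adjoin_elem A ?J (t ^ n)" for n
        proof (rule cancel)
          show "a ^ n \<in> A" by (rule pwA[OF Suc.prems(2)])
          show "a ^ n \<notin> ?J'" using prime_ideal_power[OF A J' Suc.prems(2)] a by blast
          show "d \<in> A" by (rule step.prems(3))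
          show "d * a ^ n \<in> adjoin_elem A ?J (t ^ n)"
            using ht[of n] adjoin_elem_mult[OF A pwA[OF b1(2)], of ?J "t ^ n" n]
            by (auto simp: power_mult_distrib)
        qed
        then have "d \<in> ?J" by (rule krull_intersection_elem[OF iJ tM])
        with step.prems(5) show False by simp
      qed
      then obtain j2 a1 where a1: "j2 \<in> ?J" "a1 \<in> A" "a = j2 + t * a1" unfolding J'eq by (rule adjoin_elemE)
      have "a1 \<in> adjoin_elem A ?J b1"
      proof (rule Suc.IH)
        show "a1 \<in> A" "b1 \<in> A" by (rule a1 b1)+
        show "b1 \<notin> ?J"
          using Suc.prems(4) ideal_add[OF iJ b1(1) ideal_mult[OF iJ _ tA]] b1(3) by auto
        show "b1 \<notin> adjoin_elem A ?J (t ^ s)"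
        proof
          assume "b1 \<in> adjoin_elem A ?J (t ^ s)"
          then obtain k r where k: "k \<in> ?J" "r \<in> A" "b1 = k + t ^ s * r" by (rule adjoin_elemE)
          have "b \<in> adjoin_elem A ?J (t ^ Suc s)"
            by (rule adjoin_elemI[OF ideal_add[OF iJ b1(1) ideal_mult[OF iJ k(1) tA]] k(2)])
              (simp add: b1 k algebra_simps)
          with Suc.prems(1) show False by simp
        qed
        show "d * a1 ^ n \<in> adjoin_elem A ?J (b1 ^ n)" for n
          using ht[of n]
        proof (rule adjoin_elemE)
          fix j0 r assume 0: "j0 \<in> ?J" "r \<in> A" "d * a ^ n = j0 + (t * b1) ^ n * r"
          have at: "a ^ n - (t * a1) ^ n \<in> ?J"
            by (rule power_diff_in_ideal[OF A iJ Suc.prems(2) subring_mult[OF A tA a1(2)]]) (simp add: a1)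
          have "t ^ n * (d * a1 ^ n - b1 ^ n * r) = j0 - d * (a ^ n - (t * a1) ^ n)"
            using 0(3) by (simp add: algebra_simps power_mult_distrib)
          also have "\<dots> \<in> ?J" by (rule ideal_diff[OF A iJ 0(1) ideal_mult[OF iJ at step.prems(3)]])
          finally have "t ^ n \<in> ?J \<or> d * a1 ^ n - b1 ^ n * r \<in> ?J"
            by (rule prime_ideal_mult[OF J pwA[OF tA]
                  subring_diff[OF A subring_mult[OF A step.prems(3) pwA[OF a1(2)]] subring_mult[OF A pwA[OF b1(2)] 0(2)]]])
          then have "d * a1 ^ n - b1 ^ n * r \<in> ?J" using prime_ideal_power[OF A J tA] tJ by blast
          then show ?thesis by (rule adjoin_elemI[OF _ 0(2)]) simp
        qed
      qed
      then obtain j3 c where c: "j3 \<in> ?J" "c \<in> A" "a1 = j3 + b1 * c" by (rule adjoin_elemE)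
      have "j2 + t * j3 - j * c \<in> ?J"
        by (intro ideal_diff[OF A iJ] ideal_add[OF iJ] a1(1) ideal_mult[OF iJ c(1) tA] ideal_mult'[OF iJ b1(1) c(2)])
      then show ?thesis by (rule adjoin_elemI[OF _ c(2)]) (simp add: a1(3) b1(3) c(3) algebra_simps)
    qed
  qed
  obtain s where "b \<notin> adjoin_elem A ?J (t ^ s)"
    using krull_intersection_elem[OF iJ tM, of b] step.prems(4) by blast
  then show ?case by (rule main[OF _ step.prems(1,2,4,6)])
qed

lemma completely_integrally_closed:
  assumes qf: "has_quotient_field_F A" and d: "d \<in> A" "d \<noteq> 0" and h: "\<And>n. d * q ^ n \<in> A"
  shows "q \<in> A"
proof -
  obtain a b where ab: "a \<in> A" "b \<in> A" "b \<noteq> 0" "q = a / b"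
    using qf unfolding has_quotient_field_F_def by blast
  have "a \<in> adjoin_elem A (gid {}) b"
  proof (rule completely_integrally_closed_mod[OF _ ab(1,2) d(1)])
    show "b \<notin> gid {}" "d \<notin> gid {}" using ab d by (simp_all add: gen_ideal_empty[OF A])
    show "d * a ^ n \<in> adjoin_elem A (gid {}) (b ^ n)" for n
      by (rule adjoin_elemI[OF _ h[of n], of 0]) (use ab in \<open>simp_all add: gen_ideal_empty[OF A] power_divide\<close>)
  qed simp
  then obtain r where "r \<in> A" "a = b * r"
    unfolding gen_ideal_empty[OF A] by (auto elim: adjoin_elemE)
  then show ?thesis using ab by simp
qed

section \<open>Analytic independence of the parameters\<close>

lemma prod_mset_M_pow: "set_mset m \<subseteq> M \<Longrightarrow> prod_mset m \<in> ideal_pow A M (size m)"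
  by (rule prod_mset_in_ideal_pow[OF A ideal_M])

text \<open>Coefficients of monomials without \<open>e\<close> are found in \<open>M\<close> by
  working modulo \<open>e\<close>. Their part of the sum then has higher order and drops out; the
  rest is divisible by \<open>e\<close>, and \<open>param_cancel\<close> lowers the degree.\<close>

lemma analytic_independence_mod:
  assumes "finite E" "E \<subseteq> G"
  shows "finite X \<Longrightarrow> (\<And>m. m \<in> X \<Longrightarrow> set_mset m \<subseteq> E \<and> size m = n \<and> r m \<in> A) \<Longrightarrow>
    (\<Sum>m\<in>X. r m * prod_mset m) \<in> mpow (G - E) (Suc n) \<Longrightarrow> m \<in> X \<Longrightarrow> r m \<in> M"
  using assms
proof (induction E arbitrary: n X r m rule: finite_induct)
  case empty
  have "X = {{#}}" using empty.prems(2,4) by auto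
  moreover have "n = 0" using empty.prems(2,4) by auto
  ultimately show ?case using empty.prems(3,4) by (simp add: mpow_G)
next
  case (insert e E)
  have eG: "e \<in> G" and EG: "E \<subseteq> G" and eM: "e \<in> M" and eA: "e \<in> A"
    using insert.prems G_sub M_sub by auto
  let ?D = "G - insert e E"
  have D: "?D \<subseteq> G" and D': "insert e ?D = G - E" and DE: "G - E \<subseteq> G"
    using eG insert.hyps by auto
  note iD = ideal_mpow[OF D]
  show ?case using insert.prems(1-4)
  proof (induction n arbitrary: X r m)
    case (0 X r m)
    have "X = {{#}}" using 0(2,4) by auto
    then have "r m \<in> mpow ?D (Suc 0)" using 0(3,4) by simp
    also have "\<dots> \<subseteq> mpow G (Suc 0)" by (rule mpow_mono[OF D])
    finally show ?case by (simp add: mpow_G)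
  next
    case (Suc n X r m)
    define X0 where "X0 = {m \<in> X. e \<notin># m}"
    define X1 where "X1 = {m \<in> X. e \<in># m}"
    have X: "X = X0 \<union> X1" "X0 \<inter> X1 = {}" "finite X0" "finite X1"
      using Suc.prems(1) by (auto simp: X0_def X1_def)
    have mM: "set_mset m \<subseteq> M" if "m \<in> X" for m
      using Suc.prems(2)[OF that] insert.prems(5) G_sub by auto
    define f0 where "f0 = (\<Sum>m\<in>X0. r m * prod_mset m)"
    define f1 where "f1 = (\<Sum>m\<in>X1. r m * prod_mset (m - {#e#}))"
    have X1e: "prod_mset m = e * prod_mset (m - {#e#})" if "m \<in> X1" for m
      using that by (metis (no_types, lifting) X1_def mem_Collect_eq insert_DiffM prod_mset.add_mset)
    have sum: "(\<Sum>m\<in>X. r m * prod_mset m) = f0 + e * f1"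
      unfolding X(1) f0_def f1_def sum_distrib_left
      using X by (simp add: sum.union_disjoint X1e mult.left_commute cong: sum.cong)
    have f1A: "f1 \<in> A"
      unfolding f1_def
    proof (intro subring_sum[OF A] subring_mult[OF A])
      fix m assume m: "m \<in> X1"
      then have "m \<in> X" by (simp add: X1_def)
      then show "r m \<in> A" using Suc.prems(2) by simp
      have "set_mset (m - {#e#}) \<subseteq> M" using mM[OF \<open>m \<in> X\<close>] by (meson in_diffD subset_eq)
      then show "prod_mset (m - {#e#}) \<in> A"
        using prod_mset_M_pow ideal_subset[OF ideal_ideal_pow[OF A ideal_M]] by blast
    qed
    have r0: "r m \<in> M" if "m \<in> X0" for m
    proof (rule insert.IH[of X0 "Suc n" r])
      show "set_mset m \<subseteq> E \<and> size m = Suc n \<and> r m \<in> A" if "m \<in> X0" for m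
        using Suc.prems(2)[of m] that by (auto simp: X0_def)
      have "f0 + e * f1 \<in> mpow (G - E) (Suc (Suc n))"
        using Suc.prems(3) mpow_mono[of ?D "G - E" "Suc (Suc n)"] unfolding sum by auto
      moreover have "e \<in> gid (G - E)" using insert.hyps eG by (intro G_gid) simp
      then have "e * f1 \<in> mpow (G - E) (Suc (Suc n))"
        by (intro ideal_mult'[OF ideal_mpow[OF DE] _ f1A] gid_mpow[OF DE])
      ultimately have "f0 + e * f1 - e * f1 \<in> mpow (G - E) (Suc (Suc n))"
        by (rule ideal_diff[OF A ideal_mpow[OF DE]])
      then show "(\<Sum>m\<in>X0. r m * prod_mset m) \<in> mpow (G - E) (Suc (Suc n))" by (simp add: f0_def)
    qed (use X that EG in auto)
    have "f0 \<in> mpow ?D (Suc (Suc n))"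
      unfolding f0_def
    proof (intro ideal_sum[OF iD] M_pow_mpow[OF D] ideal_pow_mult_elem[OF A ideal_M])
      fix m assume m: "m \<in> X0"
      then show "r m \<in> M" by (rule r0)
      have "m \<in> X" using m by (simp add: X0_def)
      then show "prod_mset m \<in> ideal_pow A M (Suc n)" using prod_mset_M_pow[OF mM] Suc.prems(2) by auto
    qed
    then have "f0 + e * f1 - f0 \<in> mpow ?D (Suc (Suc n))"
      using Suc.prems(3) unfolding sum by (intro ideal_diff[OF A iD])
    then have "f1 \<in> mpow ?D (Suc n)" by (intro param_cancel[OF D eG _ f1A]) simp_all
    moreover have "f1 = (\<Sum>m\<in>(\<lambda>m. m - {#e#}) ` X1. r (add_mset e m) * prod_mset m)"
    proof -
      have inj: "inj_on (\<lambda>m. m - {#e#}) X1"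
        by (rule inj_onI) (metis (no_types, lifting) X1_def insert_DiffM mem_Collect_eq)
      show ?thesis
        unfolding f1_def sum.reindex[OF inj] by (rule sum.cong) (auto simp: X1_def)
    qed
    ultimately have f1: "(\<Sum>m\<in>(\<lambda>m. m - {#e#}) ` X1. r (add_mset e m) * prod_mset m) \<in> mpow ?D (Suc n)"
      by simp
    have r1: "r m \<in> M" if m: "m \<in> X1" for m
    proof -
      have "r (add_mset e (m - {#e#})) \<in> M"
      proof (rule Suc.IH[OF _ _ f1])
        show "finite ((\<lambda>m. m - {#e#}) ` X1)" using X by simp
        show "m - {#e#} \<in> (\<lambda>m. m - {#e#}) ` X1" using m by simp
        show "set_mset k \<subseteq> insert e E \<and> size k = n \<and> r (add_mset e k) \<in> A" if k: "k \<in> (\<lambda>m. m - {#e#}) ` X1" for k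
        proof -
          obtain l where l: "l \<in> X" "e \<in># l" "k = l - {#e#}" using k by (auto simp: X1_def)
          then show ?thesis
            using Suc.prems(2)[OF l(1)] by (auto simp: size_Diff_singleton dest: in_diffD)
        qed
      qed
      then show ?thesis using m by (simp add: X1_def)
    qed
    show ?case using Suc.prems(4) r0 r1 X(1) by auto
  qed
qed

lemma analytic_independence:
  assumes "finite X" "\<And>m. m \<in> X \<Longrightarrow> set_mset m \<subseteq> G \<and> size m = n \<and> r m \<in> A"
    "(\<Sum>m\<in>X. r m * prod_mset m) = 0" "m \<in> X"
  shows "r m \<in> M"
proof -
  have "(\<Sum>m\<in>X. r m * prod_mset m) \<in> mpow (G - G) (Suc n)"
    unfolding assms(3) by (rule ideal_0[OF ideal_mpow]) simp
  then show ?thesis using analytic_independence_mod[OF fin order_refl assms(1,2) _ assms(4)] by blast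
qed

end

section \<open>Order valuations and discrete valuation rings\<close>

locale regular_quotient = regular_system +
  assumes qf: "has_quotient_field_F A"
begin

text \<open>Separatedness bounds the exponents, so the \<open>GREATEST\<close> in
  \<open>ordR\<close> is attained.\<close>

lemma ord_iff:
  assumes a: "a \<in> A" "a \<noteq> 0"
  shows "a \<in> ideal_pow A M n \<longleftrightarrow> n \<le> ordR A a"
proof -
  obtain N where N: "a \<notin> ideal_pow A M N" using M_pow_Inter[of a] a(2) by blast
  have bd: "n \<le> N" if "a \<in> ideal_pow A M n" for n
    using ideal_pow_antimono[OF A ideal_M, of N n] that N by (cases "n \<le> N") auto
  have 0: "a \<in> ideal_pow A M 0" using a by simp
  have eq: "ordR A a = (GREATEST n. a \<in> ideal_pow A M n)" unfolding ordR_def max_ideal_eq ..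
  have in_ord: "a \<in> ideal_pow A M (ordR A a)"
    unfolding eq by (rule GreatestI_nat[where P = "\<lambda>n. a \<in> ideal_pow A M n", OF 0 bd])
  show ?thesis
  proof
    assume "a \<in> ideal_pow A M n"
    then show "n \<le> ordR A a"
      unfolding eq by (rule Greatest_le_nat[where P = "\<lambda>n. a \<in> ideal_pow A M n", OF _ bd])
  next
    assume "n \<le> ordR A a"
    then show "a \<in> ideal_pow A M n" using ideal_pow_antimono[OF A ideal_M] in_ord by blast
  qed
qed

lemma ordR_mult:
  assumes "a \<in> A" "a \<noteq> 0" "b \<in> A" "b \<noteq> 0"
  shows "ordR A (a * b) = ordR A a + ordR A b"
proof (rule antisym)
  have ab: "a * b \<in> A" "a * b \<noteq> 0" using assms subring_mult[OF A] by auto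
  have a: "a \<in> ideal_pow A M (ordR A a)" and b: "b \<in> ideal_pow A M (ordR A b)"
    using ord_iff assms by auto
  show "ordR A a + ordR A b \<le> ordR A (a * b)"
    using ord_iff[OF ab] ideal_pow_mult[OF A ideal_M a b] by blast
  show "ordR A (a * b) \<le> ordR A a + ordR A b"
  proof (rule ccontr)
    assume "\<not> ?thesis"
    then have "Suc (ordR A a + ordR A b) \<le> ordR A (a * b)" by simp
    then have "a * b \<in> ideal_pow A M (Suc (ordR A a + ordR A b))" unfolding ord_iff[OF ab] .
    from M_pow_order_multiplicative[OF a b this] show False
      unfolding ord_iff[OF assms(1,2)] ord_iff[OF assms(3,4)] by simp
  qed
qed

text \<open>Additivity of \<open>ordR\<close> makes the difference independent of the fraction, so
  the \<open>THE\<close> in \<open>ordF\<close> is met by exactly one integer.\<close>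

lemma ordF_divide:
  assumes b: "b \<in> A" "b \<noteq> 0" and c: "c \<in> A" "c \<noteq> 0"
  shows "ordF A (b / c) = int (ordR A b) - int (ordR A c)"
proof -
  have "(THE k. \<exists>b'\<in>A. \<exists>c'\<in>A. b' \<noteq> 0 \<and> c' \<noteq> 0 \<and> b / c = b' / c' \<and> k = int (ordR A b') - int (ordR A c'))
    = int (ordR A b) - int (ordR A c)"
  proof (rule the_equality)
    show "\<exists>b'\<in>A. \<exists>c'\<in>A. b' \<noteq> 0 \<and> c' \<noteq> 0 \<and> b / c = b' / c' \<and>
      int (ordR A b) - int (ordR A c) = int (ordR A b') - int (ordR A c')"
      using b c by blast
    fix k assume "\<exists>b'\<in>A. \<exists>c'\<in>A. b' \<noteq> 0 \<and> c' \<noteq> 0 \<and> b / c = b' / c' \<and> k = int (ordR A b') - int (ordR A c')"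
    then obtain b' c' where *: "b' \<in> A" "c' \<in> A" "b' \<noteq> 0" "c' \<noteq> 0" "b / c = b' / c'"
      "k = int (ordR A b') - int (ordR A c')" by blast
    have "b * c' = b' * c" using * b c by (simp add: field_simps)
    then have "ordR A b + ordR A c' = ordR A b' + ordR A c"
      using ordR_mult[OF b *(2,4)] ordR_mult[OF *(1,3) c] by simp
    then show "k = int (ordR A b) - int (ordR A c)" using *(6) by linarith
  qed
  then show ?thesis using b c unfolding ordF_def by simp
qed

lemma frac_obtain:
  assumes "q \<noteq> 0"
  obtains a b where "a \<in> A" "b \<in> A" "a \<noteq> 0" "b \<noteq> 0" "q = a / b"
proof -
  obtain a b where "a \<in> A" "b \<in> A" "b \<noteq> 0" "q = a / b"
    using qf unfolding has_quotient_field_F_def by blast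
  moreover then have "a \<noteq> 0" using assms by auto
  ultimately show thesis using that by blast
qed

lemma ordR_one: "ordR A 1 = 0"
proof -
  have "1 \<notin> ideal_pow A M (Suc 0)" using one_notin ideal_pow_one[OF A ideal_M] by simp
  then show ?thesis using ord_iff[OF subring_1[OF A], of "Suc 0"] by simp
qed

lemma ordF_elem: "a \<in> A \<Longrightarrow> a \<noteq> 0 \<Longrightarrow> ordF A a = int (ordR A a)"
  using ordF_divide[of a 1] subring_1[OF A] by (simp add: ordR_one)

lemma ordF_mult:
  assumes "p \<noteq> 0" "q \<noteq> 0" shows "ordF A (p * q) = ordF A p + ordF A q"
proof -
  obtain a b where ab: "a \<in> A" "b \<in> A" "a \<noteq> 0" "b \<noteq> 0" "p = a / b" using assms(1) by (rule frac_obtain)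
  obtain c d where cd: "c \<in> A" "d \<in> A" "c \<noteq> 0" "d \<noteq> 0" "q = c / d" using assms(2) by (rule frac_obtain)
  have "p * q = (a * c) / (b * d)" using ab cd by simp
  moreover have "a * c \<in> A" "b * d \<in> A" "a * c \<noteq> 0" "b * d \<noteq> 0" using ab cd subring_mult[OF A] by auto
  ultimately have "ordF A (p * q) = int (ordR A (a * c)) - int (ordR A (b * d))"
    using ordF_divide by simp
  then show ?thesis using ab cd by (simp add: ordR_mult ordF_divide)
qed

lemma ordF_one: "ordF A 1 = 0"
  using ordF_elem[OF subring_1[OF A]] ordR_one by simp

lemma ordF_inverse: "q \<noteq> 0 \<Longrightarrow> ordF A (inverse q) = - ordF A q"
  using ordF_mult[of q "inverse q"] ordF_one by simp

lemma ordF_divide': "p \<noteq> 0 \<Longrightarrow> q \<noteq> 0 \<Longrightarrow> ordF A (p / q) = ordF A p - ordF A q"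
  using ordF_mult[of p "inverse q"] ordF_inverse[of q] by (simp add: divide_inverse)

lemma ordF_power: "q \<noteq> 0 \<Longrightarrow> ordF A (q ^ n) = int n * ordF A q"
  by (induction n) (simp_all add: ordF_one ordF_mult algebra_simps)

lemma ordF_uminus: "ordF A (- q) = ordF A q"
proof (cases "q = 0")
  case False
  have "2 * ordF A (- 1) = ordF A ((- 1) ^ 2)" using ordF_power[of "- 1" 2] by simp
  then have "ordF A (- 1) = 0" by (simp add: ordF_one)
  then show ?thesis using ordF_mult[of "- 1" q] False by simp
qed simp

lemma ordF_nonneg_A: "a \<in> A \<Longrightarrow> ordF A a \<ge> 0"
  by (cases "a = 0") (simp_all add: ordF_elem, simp add: ordF_def)

lemma ordF_pos_M:
  assumes "a \<in> M" "a \<noteq> 0" shows "ordF A a > 0"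
proof -
  have "Suc 0 \<le> ordR A a"
    using ord_iff[OF M_sub[OF assms(1)] assms(2), of "Suc 0"] assms(1) ideal_pow_one[OF A ideal_M] by simp
  then show ?thesis using ordF_elem[OF M_sub[OF assms(1)] assms(2)] by simp
qed

lemma ordF_nonneg_add:
  assumes "ordF A p \<ge> 0" "ordF A q \<ge> 0" shows "ordF A (p + q) \<ge> 0"
proof (cases "p = 0 \<or> q = 0 \<or> p + q = 0")
  case True
  then show ?thesis using assms by (auto simp: ordF_def)
next
  case False
  then have nz: "p \<noteq> 0" "q \<noteq> 0" "p + q \<noteq> 0" by auto
  obtain a b where ab: "a \<in> A" "b \<in> A" "a \<noteq> 0" "b \<noteq> 0" "p = a / b" using nz(1) by (rule frac_obtain)
  obtain c d where cd: "c \<in> A" "d \<in> A" "c \<noteq> 0" "d \<noteq> 0" "q = c / d" using nz(2) by (rule frac_obtain)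
  have bd: "b * d \<in> A" "b * d \<noteq> 0" "a * d \<in> A" "a * d \<noteq> 0" "c * b \<in> A" "c * b \<noteq> 0"
    using ab cd subring_mult[OF A] by auto
  have "p + q = (a * d + c * b) / (b * d)" using ab cd by (simp add: field_simps)
  moreover then have s: "a * d + c * b \<in> A" "a * d + c * b \<noteq> 0"
    using bd nz subring_add[OF A] by auto
  ultimately have eq: "ordF A (p + q) = int (ordR A (a * d + c * b)) - int (ordR A (b * d))"
    using ordF_divide bd by simp
  let ?n = "ordR A (b * d)"
  have "?n \<le> ordR A (a * d)" "?n \<le> ordR A (c * b)"
    using assms ab cd by (simp_all add: ordF_divide ordR_mult)
  then have "a * d \<in> ideal_pow A M ?n" "c * b \<in> ideal_pow A M ?n" using ord_iff bd by auto
  then have "a * d + c * b \<in> ideal_pow A M ?n" by (rule ideal_add[OF ideal_ideal_pow[OF A ideal_M]])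
  then have "?n \<le> ordR A (a * d + c * b)" using ord_iff[OF s] by blast
  then show ?thesis using eq by simp
qed

lemma ordF_nonneg_mult:
  assumes "ordF A p \<ge> 0" "ordF A q \<ge> 0" shows "ordF A (p * q) \<ge> 0"
proof (cases "p = 0 \<or> q = 0")
  case True
  then show ?thesis by (auto simp: ordF_def)
qed (use assms in \<open>simp add: ordF_mult\<close>)

lemma subring_ord: "subring {q. ordF A q \<ge> 0}"
  unfolding subring_def
  using ordF_nonneg_add ordF_nonneg_mult ordF_uminus ordF_one by (simp add: ordF_def[of A 0])

end

section \<open>Valuation rings and discrete valuation rings\<close>

definition nonunits :: "'a::field set \<Rightarrow> 'a set" where
  "nonunits W = {w \<in> W. w = 0 \<or> inverse w \<notin> W}"

lemma valuation_ring_quasi_local: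
  assumes W: "valuation_ring W"
  shows "quasi_local W (nonunits W)"
proof
  have sW: "subring W" and val: "\<And>x. x \<noteq> 0 \<Longrightarrow> x \<in> W \<or> inverse x \<in> W"
    using W by (auto simp: valuation_ring_def)
  show "subring W" by (rule sW)
  have scale: "r * a \<in> nonunits W" if a: "a \<in> nonunits W" and r: "r \<in> W" for a r
  proof (cases "r * a = 0")
    case True
    then show ?thesis using subring_0[OF sW] unfolding True by (simp add: nonunits_def)
  next
    case False
    have "inverse (r * a) \<notin> W"
    proof
      assume "inverse (r * a) \<in> W"
      then have "r * inverse (r * a) \<in> W" by (rule subring_mult[OF sW r])
      moreover have "r * inverse (r * a) = inverse a" using False by simp
      ultimately have "inverse a \<in> W" by metis
      then show False using a False by (simp add: nonunits_def)
    qed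
    then show ?thesis using a r subring_mult[OF sW] by (simp add: nonunits_def)
  qed
  have add: "a + b \<in> nonunits W" if a: "a \<in> nonunits W" and b: "b \<in> nonunits W" and ba: "b \<noteq> 0" "a / b \<in> W" for a b
  proof -
    have "a + b = (a / b + 1) * b" using ba by (simp add: field_simps)
    then show ?thesis using scale[OF b subring_add[OF sW ba(2) subring_1[OF sW]]] by simp
  qed
  show "ideal W (nonunits W)"
    unfolding ideal_def
  proof (intro conjI ballI)
    show "nonunits W \<subseteq> W" "0 \<in> nonunits W" using subring_0[OF sW] by (auto simp: nonunits_def)
    show "r * a \<in> nonunits W" if "a \<in> nonunits W" "r \<in> W" for a r by (rule scale[OF that])
    show "a + b \<in> nonunits W" if a: "a \<in> nonunits W" and b: "b \<in> nonunits W" for a b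
    proof (cases "a = 0 \<or> b = 0")
      case True
      then show ?thesis using a b by auto
    next
      case False
      then have "a / b \<in> W \<or> b / a \<in> W" using val[of "a / b"] by auto
      then show ?thesis using add[OF a b] add[OF b a] False by (auto simp: add.commute)
    qed
  qed
  show "1 \<notin> nonunits W" using subring_1[OF sW] by (simp add: nonunits_def)
  show "inverse a \<in> W" if "a \<in> W" "a \<notin> nonunits W" for a using that by (simp add: nonunits_def)
qed

lemma DVR_noetherian_local: "DVR W \<Longrightarrow> noetherian_local W (nonunits W)"
  unfolding noetherian_local_def noetherian_local_axioms_def
  by (auto simp: DVR_def intro: valuation_ring_quasi_local)

lemma DVR_subring: "DVR W \<Longrightarrow> subring W"
  by (simp add: DVR_def valuation_ring_def)

lemma DVR_val: "DVR W \<Longrightarrow> x \<notin> W \<Longrightarrow> inverse x \<in> W"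
  using subring_0[OF DVR_subring, of W] by (cases "x = 0") (auto simp: DVR_def valuation_ring_def)

text \<open>Rank one comes from the noetherian property: the powers of a nonunit intersect in zero,
  so \<open>w\<close> is not a multiple of some \<open>a ^ n\<close>, and in a valuation ring it
  then divides \<open>a ^ n\<close>.\<close>

lemma DVR_power_divides:
  assumes W: "DVR W" and a: "a \<in> nonunits W" and w: "w \<in> W" "w \<noteq> 0"
  shows "\<exists>n. a ^ n / w \<in> W"
proof (cases "a = 0")
  case True
  then show ?thesis using subring_0[OF DVR_subring[OF W]] by (intro exI[of _ 1]) simp
next
  case False
  interpret noetherian_local W "nonunits W" by (rule DVR_noetherian_local[OF W])
  obtain n where n: "w \<notin> adjoin_elem W {0} (a ^ n)"
    using krull_intersection_elem[OF ideal_zero[OF A] a, of w] w(2) by auto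
  have "w / a ^ n \<notin> W"
    using n adjoin_elemI[of 0 "{0}" "w / a ^ n" W w "a ^ n"] False by auto
  then have "inverse (w / a ^ n) \<in> W" by (rule DVR_val[OF W])
  then show ?thesis by (intro exI[of _ n]) simp
qed

text \<open>An element of \<open>V\<close> outside \<open>W\<close> is the inverse of a nonunit of
  \<open>W\<close>, and its powers clear every denominator.\<close>

lemma DVR_overring:
  assumes W: "DVR W" and V: "subring V" "W \<subseteq> V" "V \<noteq> W"
  shows "V = UNIV"
proof -
  obtain v where v: "v \<in> V" "v \<notin> W" using V by blast
  have v0: "v \<noteq> 0" using v subring_0[OF DVR_subring[OF W]] by auto
  have iv: "inverse v \<in> nonunits W" using DVR_val[OF W v(2)] v by (simp add: nonunits_def)
  have "f \<in> V" for f
  proof (cases "f \<in> W")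
    case False
    then have f: "inverse f \<in> W" "f \<noteq> 0" using DVR_val[OF W] subring_0[OF DVR_subring[OF W]] by auto
    then have "inverse f \<noteq> 0" by simp
    with f(1) obtain n where "inverse v ^ n / inverse f \<in> W" using DVR_power_divides[OF W iv] by blast
    then have "v ^ n * (inverse v ^ n / inverse f) \<in> V"
      using V by (intro subring_mult subring_power v) auto
    then show ?thesis using v0 f by (simp add: field_simps)
  qed (use V in auto)
  then show ?thesis by auto
qed

lemma DVR_completely_integrally_closed:
  assumes W: "DVR W" and d: "d \<in> W" "d \<noteq> 0" and h: "\<And>n. d * q ^ n \<in> W"
  shows "q \<in> W"
proof (rule ccontr)
  assume q: "q \<notin> W"
  then have q0: "q \<noteq> 0" using subring_0[OF DVR_subring[OF W]] by auto
  have "inverse q \<in> nonunits W" using DVR_val[OF W q] q by (simp add: nonunits_def)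
  then obtain n where n: "inverse q ^ n / d \<in> W" using DVR_power_divides[OF W _ d] by blast
  have "(inverse q ^ n / d) * (d * q ^ Suc n) \<in> W" by (rule subring_mult[OF DVR_subring[OF W] n h])
  moreover have "(inverse q ^ n / d) * (d * q ^ Suc n) = q" using q0 d by (simp add: field_simps)
  ultimately show False using q by simp
qed

text \<open>The intersection theorem bounds the powers of \<open>t\<close> dividing a nonzero
  element, which is therefore a unit times a power of \<open>t\<close>; the exponents of numerator
  and denominator decide the valuation property.\<close>

lemma (in noetherian_local) principal_maximal_DVR:
  assumes t: "t \<in> M" "t \<noteq> 0" and M: "\<And>a. a \<in> M \<Longrightarrow> a / t \<in> A" and qf: "has_quotient_field_F A"
  shows "DVR A"
proof -
  note pwA = subring_power[OF A M_sub[OF t(1)]]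
  have rep: "\<exists>n u. u \<in> A \<and> u \<notin> M \<and> a = u * t ^ n" if a: "a \<in> A" "a \<noteq> 0" for a
  proof -
    have "\<exists>n. a / t ^ n \<notin> A"
    proof (rule ccontr)
      assume "\<not> ?thesis"
      then have "a \<in> adjoin_elem A {0} (t ^ n)" for n
        by (intro adjoin_elemI[of 0 "{0}" "a / t ^ n"]) (use t in auto)
      then have "a \<in> {0}" by (rule krull_intersection_elem[OF ideal_zero[OF A] t(1)])
      with a show False by simp
    qed
    then obtain n where n: "a / t ^ n \<notin> A" "\<And>k. k < n \<Longrightarrow> a / t ^ k \<in> A"
      using exists_least_iff[of "\<lambda>n. a / t ^ n \<notin> A"] by blast
    then obtain m where m: "n = Suc m" using a by (cases n) auto
    have "a / t ^ m \<in> A" "a / t ^ m \<notin> M"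
      using n M[of "a / t ^ m"] unfolding m by (auto simp: field_simps)
    moreover have "a = (a / t ^ m) * t ^ m" using t by simp
    ultimately show ?thesis by blast
  qed
  have "x \<in> A \<or> inverse x \<in> A" if x: "x \<noteq> 0" for x
  proof -
    obtain a b where ab: "a \<in> A" "b \<in> A" "b \<noteq> 0" "x = a / b"
      using qf unfolding has_quotient_field_F_def by blast
    have "a \<noteq> 0" using ab x by auto
    obtain n u where u: "u \<in> A" "u \<notin> M" "a = u * t ^ n" using rep[OF ab(1) \<open>a \<noteq> 0\<close>] by blast
    obtain m v where v: "v \<in> A" "v \<notin> M" "b = v * t ^ m" using rep[OF ab(2,3)] by blast
    have iu: "inverse u \<in> A" "inverse v \<in> A" using inverse_in u v by auto
    have nz: "u \<noteq> 0" "v \<noteq> 0" using u v ideal_0[OF ideal_M] by auto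
    show ?thesis
    proof (cases "m \<le> n")
      case True
      then have "t ^ n = t ^ m * t ^ (n - m)" by (simp flip: power_add)
      then have "x = u * inverse v * t ^ (n - m)"
        unfolding ab(4) u(3) v(3) using t nz by (simp add: field_simps)
      then show ?thesis using u iu pwA subring_mult[OF A] by simp
    next
      case False
      then have "t ^ m = t ^ n * t ^ (m - n)" by (simp flip: power_add)
      then have "inverse x = v * inverse u * t ^ (m - n)"
        unfolding ab(4) u(3) v(3) using t nz by (simp add: field_simps)
      then show ?thesis using v iu pwA subring_mult[OF A] by simp
    qed
  qed
  moreover have "inverse t \<notin> A"
    using ideal_mult[OF ideal_M t(1), of "inverse t"] one_notin t by auto
  ultimately show ?thesis using A noeth by (auto simp: DVR_def valuation_ring_def)
qed

section \<open>Localizations that are discrete valuation rings\<close>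

lemma ideal_conductor: "subring A \<Longrightarrow> ideal A {r \<in> A. r * \<theta> \<in> A}"
  by (auto simp: ideal_def subring_def distrib_right mult.assoc)

lemma has_quotient_field_superset: "has_quotient_field_F A \<Longrightarrow> A \<subseteq> B \<Longrightarrow> has_quotient_field_F B"
  unfolding has_quotient_field_F_def by (meson subsetD)

text \<open>The prime is a maximal conductor among those of the multiples of q that avoid the powers of y.\<close>
lemma exists_localization_DVR:
  assumes n: "noetherian A" and qf: "has_quotient_field_F A"
    and cic: "\<And>d \<theta>. d \<in> A \<Longrightarrow> d \<noteq> 0 \<Longrightarrow> (\<And>n. d * \<theta> ^ n \<in> A) \<Longrightarrow> \<theta> \<in> A"
    and y: "y \<in> A" and q: "\<And>k. y ^ k * q \<notin> A"
  shows "\<exists>p. prime_ideal A p \<and> y \<notin> p \<and> DVR (localize_at A p) \<and> q \<notin> localize_at A p"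
proof -
  have A: "subring A" using n by (rule noetherian_subring)
  note pwA = subring_power[OF A y]
  define C where "C \<theta> = {r \<in> A. r * \<theta> \<in> A}" for \<theta>
  have iC: "ideal A (C \<theta>)" for \<theta> unfolding C_def by (rule ideal_conductor[OF A])
  let ?Q = "\<lambda>X. \<exists>c\<in>A. X = C (c * q) \<and> (\<forall>k. y ^ k \<notin> X)"
  have "?Q (C q)" using q subring_1[OF A] by (intro bexI[of _ 1]) (auto simp: C_def)
  then obtain X where X: "?Q X" and mx: "\<And>L. ?Q L \<Longrightarrow> X \<subseteq> L \<Longrightarrow> L = X"
    by (rule noetherian_maximal_pred[OF n, of ?Q]) (use iC in blast, rule that)
  then obtain c where c: "c \<in> A" "X = C (c * q)" "\<And>k. y ^ k \<notin> X" by blast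
  define \<theta> where "\<theta> = c * q"
  define p where "p = C \<theta>"
  have yp: "y ^ k \<notin> p" for k using c by (simp add: p_def \<theta>_def)
  have mxp: "C (e * \<theta>) = p" if "e \<in> A" "\<And>k. y ^ k \<notin> C (e * \<theta>)" for e
  proof -
    have "?Q (C (e * \<theta>))"
      using that c(1) subring_mult[OF A] by (intro bexI[of _ "e * c"]) (auto simp: \<theta>_def mult.assoc)
    moreover have "X \<subseteq> C (e * \<theta>)"
      unfolding c(2) C_def \<theta>_def using subring_mult[OF A that(1)] by (auto simp: mult.left_commute[of _ e])
    ultimately show ?thesis using mx c(2) by (simp add: p_def \<theta>_def)
  qed
  have ip: "ideal A p" unfolding p_def by (rule iC)
  have one: "1 \<notin> p" using yp[of 0] by simp
  have p: "prime_ideal A p"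
    unfolding prime_ideal_def
  proof (intro conjI ballI impI ip)
    show "p \<noteq> A" using one subring_1[OF A] by auto
    fix r s assume rs: "r \<in> A" "s \<in> A" "r * s \<in> p"
    \<comment> \<open>Either the conductor of \<open>s * \<theta>\<close> avoids the powers of
      \<open>y\<close> and equals \<open>p\<close> by maximality, or it contains some
      \<open>y ^ k\<close>; then \<open>s\<close> is in the conductor of
      \<open>y ^ k * \<theta>\<close>, which also equals \<open>p\<close>.\<close>
    show "r \<in> p \<or> s \<in> p"
    proof (cases "\<exists>k. y ^ k \<in> C (s * \<theta>)")
      case False
      then have "C (s * \<theta>) = p" using mxp[OF rs(2)] by blast
      moreover have "r \<in> C (s * \<theta>)" using rs by (simp add: p_def C_def mult.assoc)
      ultimately show ?thesis by simp
    next
      case True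
      then obtain k where k: "y ^ k \<in> C (s * \<theta>)" by blast
      have "y ^ l \<notin> C (y ^ k * \<theta>)" for l
        using yp[of "l + k"] pwA[of "l + k"] by (auto simp: p_def C_def power_add mult.assoc)
      then have "C (y ^ k * \<theta>) = p" by (rule mxp[OF pwA])
      moreover have "s \<in> C (y ^ k * \<theta>)" using k rs by (simp add: C_def mult.left_commute)
      ultimately show ?thesis by simp
    qed
  qed
  have "q \<notin> localize_at A p"
  proof
    assume "q \<in> localize_at A p"
    then obtain a b where ab: "a \<in> A" "b \<in> A" "b \<notin> p" "q = a / b" by (rule localize_atE)
    have "b \<noteq> 0" using ab ideal_0[OF ip] by auto
    then have "b * \<theta> = c * a" using ab by (simp add: \<theta>_def)
    then have "b \<in> p" using ab c subring_mult[OF A] by (simp add: p_def C_def)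
    with ab show False by simp
  qed
  moreover have "DVR (localize_at A p)"
  proof -
    interpret L: noetherian_local "localize_at A p" "extend_ideal A p p"
      by (rule noetherian_local_localize_at[OF A p n])
    have pD: "r \<in> A" "r * \<theta> \<in> A" if "r \<in> p" for r using that by (auto simp: p_def C_def)
    \<comment> \<open>If multiplication by \<open>\<theta>\<close> mapped \<open>p\<close> into
      itself, a denominator of \<open>\<theta>\<close> would be a common denominator of all its
      powers, and complete integral closedness would put \<open>\<theta>\<close> into
      \<open>A\<close>.\<close>
    obtain t where t: "t \<in> p" "t * \<theta> \<notin> p"
    proof (rule ccontr)
      assume "\<not> thesis"
      then have st: "r * \<theta> \<in> p" if "r \<in> p" for r using that \<open>\<And>t. t \<in> p \<Longrightarrow> t * \<theta> \<notin> p \<Longrightarrow> thesis\<close> by blast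
      obtain a b where ab: "a \<in> A" "b \<in> A" "b \<noteq> 0" "\<theta> = a / b"
        using qf unfolding has_quotient_field_F_def by blast
      then have "b \<in> p" by (simp add: p_def C_def)
      then have "b * \<theta> ^ n \<in> p" for n
        by (induction n) (use st in \<open>simp_all add: mult.assoc[symmetric] mult.commute[of \<theta>]\<close>)
      then have "\<theta> \<in> A" using cic[OF ab(2,3)] pD by blast
      then have "1 \<in> p" using subring_1[OF A] by (simp add: p_def C_def)
      with one show False by simp
    qed
    have t0: "t \<noteq> 0" and t\<theta>: "t * \<theta> \<noteq> 0" using t ideal_0[OF ip] by auto
    show ?thesis
    proof (rule L.principal_maximal_DVR)
      show "t \<in> extend_ideal A p p" using extend_prime_Int[OF A p p order_refl] t pD by blast
      show "t \<noteq> 0" by (rule t0)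
      show "has_quotient_field_F (localize_at A p)"
        by (rule has_quotient_field_superset[OF qf localize_at_superset[OF A p]])
      fix w assume "w \<in> extend_ideal A p p"
      then obtain a s where as: "a \<in> p" "s \<in> A" "s \<notin> p" "w = a / s"
        unfolding extend_ideal_def[OF A p] by blast
      have "s \<noteq> 0" using as ideal_0[OF ip] by auto
      \<comment> \<open>The element \<open>t * \<theta>\<close> is a unit of the localization and
        \<open>\<theta>\<close> maps \<open>p\<close> into \<open>A\<close>, so \<open>t\<close>
        divides the whole maximal ideal.\<close>
      show "w / t \<in> localize_at A p"
      proof (rule localize_atI)
        show "a * \<theta> \<in> A" by (rule pD[OF as(1)])
        show "s * (t * \<theta>) \<in> A" by (rule subring_mult[OF A as(2) pD(2)[OF t(1)]])
        show "s * (t * \<theta>) \<notin> p" using prime_ideal_mult[OF p as(2) pD(2)[OF t(1)]] as(3) t(2) by blast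
        show "w / t = a * \<theta> / (s * (t * \<theta>))" using as t0 t\<theta> \<open>s \<noteq> 0\<close> by simp
      qed
    qed
  qed
  ultimately show ?thesis using p yp[of 1] by auto
qed

text \<open>In the localization \<open>w\<close> divides a power of each element of
  \<open>p\<close>; clearing the denominator puts that power into \<open>p'\<close>.\<close>

lemma localization_DVR_height_one:
  assumes A: "subring A" and p: "prime_ideal A p" and W: "DVR (localize_at A p)"
    and p': "prime_ideal A p'" "p' \<subseteq> p" "w \<in> p'" "w \<noteq> 0"
  shows "p' = p"
proof
  note sup = localize_at_superset[OF A p]
  show "p \<subseteq> p'"
  proof
    fix a assume a: "a \<in> p"
    have aA: "a \<in> A" and wA: "w \<in> A"
      using a p' ideal_subset[OF prime_ideal_ideal[OF p]] by auto
    have "a \<in> nonunits (localize_at A p)"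
    proof -
      have "inverse a \<notin> localize_at A p" if "a \<noteq> 0"
      proof
        assume "inverse a \<in> localize_at A p"
        then obtain c d where cd: "c \<in> A" "d \<in> A" "d \<notin> p" "inverse a = c / d" by (rule localize_atE)
        have "d \<noteq> 0" using cd ideal_0[OF prime_ideal_ideal[OF p]] by auto
        then have "d = c * a" using cd(4) that by (simp add: field_simps)
        then show False using cd ideal_mult[OF prime_ideal_ideal[OF p] a cd(1)] by simp
      qed
      then show ?thesis using aA sup by (auto simp: nonunits_def)
    qed
    then obtain n where "a ^ n / w \<in> localize_at A p"
      using DVR_power_divides[OF W _ _ p'(4)] wA sup by blast
    then obtain c d where cd: "c \<in> A" "d \<in> A" "d \<notin> p" "a ^ n / w = c / d" by (rule localize_atE)
    have "d \<noteq> 0" using cd ideal_0[OF prime_ideal_ideal[OF p]] by auto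
    then have "d * a ^ n = c * w" using cd(4) p'(4) by (simp add: field_simps)
    then have "d * a ^ n \<in> p'" using ideal_mult[OF prime_ideal_ideal[OF p'(1)] p'(3) cd(1)] by simp
    then have "a ^ n \<in> p'"
      using prime_ideal_mult[OF p'(1) cd(2) subring_power[OF A aA]] cd(3) p'(2) by blast
    then show "a \<in> p'" by (rule prime_ideal_power[OF A p'(1) aA])
  qed
qed (rule p')

section \<open>Local quadratic transforms\<close>

text \<open>Summands with coefficient in \<open>M\<close> lie in the square of \<open>M\<close>, so
  they can be peeled off until a unit coefficient appears.\<close>

lemma (in regular_system) gid_unit_coefficient:
  assumes "finite D" "D \<subseteq> G" "w \<in> gid D" "w \<notin> ideal_pow A M 2"
  shows "\<exists>g\<in>D. \<exists>r\<in>A. r \<notin> M \<and> w - g * r \<in> gid (D - {g})"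
  using assms
proof (induction D arbitrary: w rule: finite_induct)
  case empty
  then have "w = 0" by (simp add: gen_ideal_empty[OF A])
  then show ?case using empty.prems(3) ideal_0[OF ideal_ideal_pow[OF A ideal_M, of 2]] by metis
next
  case (insert e D)
  have D: "D \<subseteq> G" and e: "e \<in> G" and eM: "e \<in> M" using insert.prems G_sub by auto
  obtain d r where dr: "d \<in> gid D" "r \<in> A" "w = d + e * r"
    using insert.prems(2) by (rule gid_insertE[OF D e])
  show ?case
  proof (cases "r \<in> M")
    case False
    have "insert e D - {e} = D" using insert.hyps by auto
    then have "w - e * r \<in> gid (insert e D - {e})" using dr by simp
    with False dr(2) show ?thesis by blast
  next
    case True
    then have "r \<in> ideal_pow A M (Suc 0)" using ideal_pow_one[OF A ideal_M] by simp
    from ideal_pow_mult_elem[OF A ideal_M eM this] have er: "e * r \<in> ideal_pow A M 2"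
      by (simp add: numeral_2_eq_2)
    have "d \<notin> ideal_pow A M 2"
      using insert.prems(3) ideal_add[OF ideal_ideal_pow[OF A ideal_M, of 2] _ er, of d] dr(3) by metis
    then obtain g s where gs: "g \<in> D" "s \<in> A" "s \<notin> M" "d - g * s \<in> gid (D - {g})"
      using insert.IH[OF D dr(1)] by blast
    have "insert e D - {g} = insert e (D - {g})" using gs insert.hyps by auto
    moreover have "w - g * s \<in> gid (insert e (D - {g}))"
      by (rule gid_insertI[OF _ e gs(4) dr(2)]) (use D dr in auto)
    ultimately have "w - g * s \<in> gid (insert e D - {g})" by simp
    with gs(1-3) show ?thesis by blast
  qed
qed

text \<open>A transform is defined with any \<open>z\<close> outside the square of \<open>M\<close>.
  Exchanging \<open>z\<close> for a parameter that it contains with unit coefficient makes it a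
  member of a regular system, as the locale \<open>quadratic_transform\<close> demands.\<close>

lemma (in regular_system) exchange_parameter:
  assumes z: "z \<in> M" "z \<notin> ideal_pow A M 2"
  shows "\<exists>G'. regular_system A M G' \<and> z \<in> G'"
proof (cases "z \<in> G")
  case True
  then show ?thesis using regular_system_axioms by blast
next
  case False
  obtain g r where gr: "g \<in> G" "r \<in> A" "r \<notin> M" "z - g * r \<in> gid (G - {g})"
    using gid_unit_coefficient[OF fin order_refl _ z(2)] z(1) gid_G by blast
  let ?G = "insert z (G - {g})"
  have zA: "z \<in> A" using z M_sub by blast
  have GA: "?G \<subseteq> A" "?G \<subseteq> M" using zA z G_sub M_sub by auto
  have iG: "ideal A (gid ?G)" by (rule ideal_gen_ideal[OF A GA(1)])
  have r0: "r \<noteq> 0" using gr ideal_0[OF ideal_M] by auto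
  have "gid (G - {g}) \<subseteq> gid ?G" by (rule gen_ideal_mono) auto
  then have "z - g * r \<in> gid ?G" using gr(4) by blast
  then have "z - (z - g * r) \<in> gid ?G"
    by (rule ideal_diff[OF A iG G_gid[OF insertI1]])
  then have "inverse r * (z - (z - g * r)) \<in> gid ?G" by (rule ideal_mult[OF iG _ inverse_in[OF gr(2,3)]])
  moreover have "inverse r * (z - (z - g * r)) = g" using r0 by simp
  ultimately have "g \<in> gid ?G" by metis
  then have "G \<subseteq> gid ?G" using G_gid[of _ ?G] by blast
  then have "M \<subseteq> gid ?G" unfolding gen by (rule gen_ideal_least[OF iG])
  moreover have "gid ?G \<subseteq> M" by (rule gen_ideal_least[OF ideal_M GA(2)])
  moreover have "card ?G = card G"
    using False fin gr(1) by (metis Diff_iff card.remove card_insert_disjoint finite_Diff)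
  ultimately have "regular_system A M ?G"
    using noetherian_local_axioms fin chain
    by (auto simp: regular_system_def regular_system_axioms_def)
  then show ?thesis by blast
qed

text \<open>Linear combinations of the family \<open>E\<close> with coefficients from
  \<open>A\<close> transported by \<open>\<phi>\<close>. It serves both for forms in the parameters,
  with \<open>\<phi>\<close> the identity, and for polynomials, with \<open>\<phi>\<close> the
  embedding of constants.\<close>

definition lspan :: "('a \<Rightarrow> 'r::comm_ring_1) \<Rightarrow> 'a set \<Rightarrow> 'i set \<Rightarrow> ('i \<Rightarrow> 'r) \<Rightarrow> 'r set" where
  "lspan \<phi> A I E = {\<Sum>m\<in>X. \<phi> (r m) * E m | X r. finite X \<and> X \<subseteq> I \<and> (\<forall>m\<in>X. r m \<in> A)}"

lemma lspanI: "finite X \<Longrightarrow> X \<subseteq> I \<Longrightarrow> (\<And>m. m \<in> X \<Longrightarrow> r m \<in> A) \<Longrightarrow> s = (\<Sum>m\<in>X. \<phi> (r m) * E m) \<Longrightarrow> s \<in> lspan \<phi> A I E"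
  by (auto simp: lspan_def)

lemma lspanE:
  assumes "s \<in> lspan \<phi> A I E"
  obtains X r where "finite X" "X \<subseteq> I" "\<forall>m\<in>X. r m \<in> A" "s = (\<Sum>m\<in>X. \<phi> (r m) * E m)"
  using assms by (auto simp: lspan_def)

context
  fixes \<phi> :: "'a::field \<Rightarrow> 'r::comm_ring_1" and A :: "'a set"
  assumes \<phi>_add: "\<And>a b. \<phi> (a + b) = \<phi> a + \<phi> b" and \<phi>_mult: "\<And>a b. \<phi> (a * b) = \<phi> a * \<phi> b"
    and \<phi>_one: "\<phi> 1 = 1" and A: "subring A"
begin

lemma \<phi>_zero: "\<phi> 0 = 0"
  using \<phi>_add[of 0 0] by simp

lemma lspan_zero: "0 \<in> lspan \<phi> A I E"
  by (rule lspanI[of "{}" _ "\<lambda>_. 0"]) auto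

lemma lspan_add:
  assumes "s \<in> lspan \<phi> A I E" "t \<in> lspan \<phi> A I E" shows "s + t \<in> lspan \<phi> A I E"
proof -
  obtain X r where X: "finite X" "X \<subseteq> I" "\<forall>m\<in>X. r m \<in> A" "s = (\<Sum>m\<in>X. \<phi> (r m) * E m)"
    using assms(1) by (rule lspanE)
  obtain Y u where Y: "finite Y" "Y \<subseteq> I" "\<forall>m\<in>Y. u m \<in> A" "t = (\<Sum>m\<in>Y. \<phi> (u m) * E m)"
    using assms(2) by (rule lspanE)
  define v where "v m = (if m \<in> X then r m else 0) + (if m \<in> Y then u m else 0)" for m
  have "s = (\<Sum>m\<in>X \<union> Y. \<phi> (if m \<in> X then r m else 0) * E m)"
    unfolding X(4) by (rule sum.mono_neutral_cong_left) (use X Y in \<open>auto simp: \<phi>_zero\<close>)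
  moreover have "t = (\<Sum>m\<in>X \<union> Y. \<phi> (if m \<in> Y then u m else 0) * E m)"
    unfolding Y(4) by (rule sum.mono_neutral_cong_left) (use X Y in \<open>auto simp: \<phi>_zero\<close>)
  ultimately have "s + t = (\<Sum>m\<in>X \<union> Y. \<phi> (v m) * E m)"
    by (simp add: sum.distrib[symmetric] v_def \<phi>_add distrib_right)
  then show ?thesis
    by (rule lspanI[of "X \<union> Y" I v, rotated 3])
       (use X Y in \<open>auto simp: v_def intro: subring_0[OF A] subring_add[OF A]\<close>)
qed

lemma lspan_sum: "(\<And>i. i \<in> X \<Longrightarrow> f i \<in> lspan \<phi> A I E) \<Longrightarrow> sum f X \<in> lspan \<phi> A I E"
  by (induction X rule: infinite_finite_induct) (auto intro: lspan_zero lspan_add)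

lemma lspan_scale:
  assumes c: "c \<in> A" and s: "s \<in> lspan \<phi> A I E" shows "\<phi> c * s \<in> lspan \<phi> A I E"
proof -
  obtain X r where X: "finite X" "X \<subseteq> I" "\<forall>m\<in>X. r m \<in> A" "s = (\<Sum>m\<in>X. \<phi> (r m) * E m)"
    using s by (rule lspanE)
  show ?thesis
    by (rule lspanI[OF X(1,2), of "\<lambda>m. c * r m"])
       (use X c in \<open>auto simp: \<phi>_mult sum_distrib_left mult.assoc intro: subring_mult[OF A]\<close>)
qed

lemma lspan_base: "m \<in> I \<Longrightarrow> E m \<in> lspan \<phi> A I E"
  by (rule lspanI[of "{m}" _ "\<lambda>_. 1"]) (auto simp: \<phi>_one subring_1[OF A])

lemma lspan_reindex:
  assumes h: "\<And>m. m \<in> I \<Longrightarrow> h m \<in> I'" "\<And>m. m \<in> I \<Longrightarrow> w * E m = E' (h m)"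
    and s: "s \<in> lspan \<phi> A I E"
  shows "w * s \<in> lspan \<phi> A I' E'"
proof -
  obtain X r where X: "finite X" "X \<subseteq> I" "\<forall>m\<in>X. r m \<in> A" "s = (\<Sum>m\<in>X. \<phi> (r m) * E m)"
    using s by (rule lspanE)
  have "w * s = (\<Sum>m\<in>X. \<phi> (r m) * E' (h m))"
    unfolding X(4) sum_distrib_left
    by (rule sum.cong) (use X(2) h(2) in \<open>auto simp: mult.left_commute[of w]\<close>)
  also have "\<dots> \<in> lspan \<phi> A I' E'"
    using X h(1) by (intro lspan_sum lspan_scale lspan_base) auto
  finally show ?thesis .
qed

lemma lspan_mult:
  assumes I: "\<And>m n. m \<in> I \<Longrightarrow> n \<in> I \<Longrightarrow> m + n \<in> I" and E: "\<And>m n. E (m + n) = E m * E n"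
    and s: "s \<in> lspan \<phi> A I (E :: 'b multiset \<Rightarrow> 'r)" and t: "t \<in> lspan \<phi> A I E"
  shows "s * t \<in> lspan \<phi> A I E"
proof -
  obtain X r where X: "finite X" "X \<subseteq> I" "\<forall>m\<in>X. r m \<in> A" "s = (\<Sum>m\<in>X. \<phi> (r m) * E m)"
    using s by (rule lspanE)
  have "s * t = (\<Sum>m\<in>X. \<phi> (r m) * (E m * t))" by (simp add: X(4) sum_distrib_right mult.assoc)
  also have "\<dots> \<in> lspan \<phi> A I E"
  proof (intro lspan_sum lspan_scale)
    fix m assume m: "m \<in> X"
    show "r m \<in> A" using X(3) m by blast
    show "E m * t \<in> lspan \<phi> A I E"
      by (rule lspan_reindex[of I "(+) m" I "E m" E E, OF _ _ t])
         (use m X(2) I E in auto)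
  qed
  finally show ?thesis .
qed

end

context regular_system
begin

abbreviation monoms where "monoms n \<equiv> {m. set_mset m \<subseteq> G \<and> size m = n}"

lemma M_pow_span: "f \<in> ideal_pow A M n \<Longrightarrow> f \<in> lspan (\<lambda>a. a) A (monoms n) prod_mset"
proof (induction n arbitrary: f)
  case 0
  show ?case by (rule lspanI[of "{{#}}" _ "\<lambda>_. f"]) (use 0 in auto)
next
  case (Suc n)
  note * = lspan_add[of "\<lambda>a. a", OF refl refl refl A] lspan_scale[of "\<lambda>a. a", OF refl refl refl A]
    lspan_zero[of "\<lambda>a. a", OF refl refl refl A] lspan_reindex[of "\<lambda>a. a", OF refl refl refl A]
  let ?K = "{i \<in> A. \<forall>s\<in>lspan (\<lambda>a. a) A (monoms n) prod_mset. i * s \<in> lspan (\<lambda>a. a) A (monoms (Suc n)) prod_mset}"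
  have iK: "ideal A ?K"
    unfolding ideal_def
    using *(1)[of _ "monoms (Suc n)" prod_mset] *(2)[of _ _ "monoms (Suc n)" prod_mset]
      *(3)[of "monoms (Suc n)" prod_mset] subring_0[OF A] subring_add[OF A] subring_mult[OF A]
    by (auto simp: distrib_right mult.assoc)
  have "G \<subseteq> ?K"
  proof
    fix g assume g: "g \<in> G"
    have "g * s \<in> lspan (\<lambda>a. a) A (monoms (Suc n)) prod_mset"
      if "s \<in> lspan (\<lambda>a. a) A (monoms n) prod_mset" for s
      by (rule *(4)[of "monoms n" "add_mset g" "monoms (Suc n)" g prod_mset prod_mset, OF _ _ that])
         (use g in auto)
    then show "g \<in> ?K" using g G_A[OF order_refl] by auto
  qed
  then have MK: "M \<subseteq> ?K" unfolding gen by (rule gen_ideal_least[OF iK])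
  have "ideal_prod M (ideal_pow A M n) \<subseteq> lspan (\<lambda>a. a) A (monoms (Suc n)) prod_mset"
    by (rule ideal_prod_least) (use MK Suc.IH *(1,3) in auto)
  with Suc.prems show ?case by auto
qed

end

section \<open>Polynomials with multisets as monomials\<close>

lemma lookup_mult_keys:
  fixes p q :: "'k::monoid_add \<Rightarrow>\<^sub>0 'a::comm_ring_1"
  shows "Poly_Mapping.lookup (p * q) k = (\<Sum>a\<in>Poly_Mapping.keys p. \<Sum>b\<in>Poly_Mapping.keys q.
    if a + b = k then Poly_Mapping.lookup p a * Poly_Mapping.lookup q b else 0)"
proof -
  have dec: "u = (\<Sum>a\<in>Poly_Mapping.keys u. Poly_Mapping.single a (Poly_Mapping.lookup u a))" for u :: "'k \<Rightarrow>\<^sub>0 'a"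
  proof (rule poly_mapping_eqI)
    fix l
    have "Poly_Mapping.lookup (\<Sum>a\<in>Poly_Mapping.keys u. Poly_Mapping.single a (Poly_Mapping.lookup u a)) l = (\<Sum>a\<in>Poly_Mapping.keys u. if a = l then Poly_Mapping.lookup u a else 0)"
      by (simp add: lookup_sum lookup_single when_def)
    also have "\<dots> = Poly_Mapping.lookup u l"
      by (simp add: not_in_keys_iff_lookup_eq_zero)
    finally show "Poly_Mapping.lookup u l = Poly_Mapping.lookup (\<Sum>a\<in>Poly_Mapping.keys u. Poly_Mapping.single a (Poly_Mapping.lookup u a)) l" by simp
  qed
  have "p * q = (\<Sum>a\<in>Poly_Mapping.keys p. \<Sum>b\<in>Poly_Mapping.keys q. Poly_Mapping.single (a + b) (Poly_Mapping.lookup p a * Poly_Mapping.lookup q b))"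
    by (subst (1) dec[of p], subst (1) dec[of q]) (simp add: sum_product mult_single)
  then show ?thesis
    by (simp add: lookup_sum lookup_single when_def)
qed

text \<open>The variable belonging to a parameter \<open>g\<close> is indexed by \<open>g\<close>
  itself, so a monomial is a multiset of field elements and also denotes the product of these
  elements.\<close>

type_synonym 'a mpoly = "'a multiset \<Rightarrow>\<^sub>0 'a"

lemma lookup_single_mult:
  fixes p :: "'a::field mpoly"
  shows "Poly_Mapping.lookup (Poly_Mapping.single a c * p) k = (if a \<subseteq># k then c * Poly_Mapping.lookup p (k - a) else 0)"
proof (cases "c = 0")
  case False
  have eq: "(a + b = k) = (a \<subseteq># k \<and> b = k - a)" for b
    by (metis add_diff_cancel_left' mset_subset_eq_add_left subset_mset.add_diff_inverse)
  have "Poly_Mapping.lookup (Poly_Mapping.single a c * p) k = (\<Sum>b\<in>Poly_Mapping.keys p. if a + b = k then c * Poly_Mapping.lookup p b else 0)"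
    unfolding lookup_mult_keys using False by (simp cong: if_cong)
  also have "\<dots> = (if a \<subseteq># k then c * Poly_Mapping.lookup p (k - a) else 0)"
    unfolding eq by (auto simp: not_in_keys_iff_lookup_eq_zero)
  finally show ?thesis .
qed simp

lemma lookup_mult_zero:
  fixes p q :: "'a::field mpoly"
  shows "Poly_Mapping.lookup (p * q) {#} = Poly_Mapping.lookup p {#} * Poly_Mapping.lookup q {#}"
proof -
  have delta: "(\<Sum>a\<in>Poly_Mapping.keys u. if a = {#} then Poly_Mapping.lookup u a else 0) = Poly_Mapping.lookup u {#}"
    for u :: "'a mpoly"
    by (simp add: not_in_keys_iff_lookup_eq_zero)
  have "Poly_Mapping.lookup (p * q) {#} = (\<Sum>a\<in>Poly_Mapping.keys p. \<Sum>b\<in>Poly_Mapping.keys q.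
      (if a = {#} then Poly_Mapping.lookup p a else 0) * (if b = {#} then Poly_Mapping.lookup q b else 0))"
    unfolding lookup_mult_keys by (intro sum.cong refl) auto
  also have "\<dots> = Poly_Mapping.lookup p {#} * Poly_Mapping.lookup q {#}"
    by (simp only: sum_product[symmetric] delta)
  finally show ?thesis .
qed

section \<open>One transform: the chart \<open>B\<close> and its local ring \<open>C\<close>\<close>

locale quadratic_transform = regular_quotient A M G for A M G :: "'a::field set" +
  fixes z :: 'a and B q C :: "'a set"
  assumes zG: "z \<in> G" and B_def: "B = ring_adjoin A {a / z | a. a \<in> M}"
    and q: "prime_ideal B q" and Mq: "M \<subseteq> q" and C_def: "C = localize_at B q"
begin

lemma zM: "z \<in> M" and zA: "z \<in> A"
  using zG G_sub M_sub by auto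

lemma z0: "z \<noteq> 0"
  using params_independent[of "{}" z] zG gen_ideal_empty[OF A] by auto

lemma ord_z: "ordR A z = 1"
proof -
  have "z \<notin> ideal_pow A M (Suc (Suc 0))"
  proof
    assume "z \<in> ideal_pow A M (Suc (Suc 0))"
    then have *: "z * 1 \<in> mpow {} (Suc (Suc 0))" unfolding mpow_empty by simp
    have "1 \<in> mpow {} (Suc 0)" by (rule param_cancel[OF _ zG _ subring_1[OF A] *]) auto
    then show False unfolding mpow_empty ideal_pow_one[OF A ideal_M] using one_notin by simp
  qed
  then have "\<not> Suc (Suc 0) \<le> ordR A z" using ord_iff[OF zA z0] by blast
  moreover have "Suc 0 \<le> ordR A z"
    using ord_iff[OF zA z0, of "Suc 0"] zM ideal_pow_one[OF A ideal_M] by simp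
  ultimately show ?thesis by simp
qed

lemma z_pow: "z ^ n \<in> ideal_pow A M n"
  by (rule power_in_ideal_pow[OF A ideal_M zM])

lemma B_eq: "B = {r / z ^ n | r n. r \<in> ideal_pow A M n}" (is "B = ?B")
proof
  note iP = ideal_ideal_pow[OF A ideal_M]
  have "subring ?B"
    unfolding subring_def
  proof (intro conjI ballI)
    show "0 \<in> ?B" using subring_0[OF A] by (intro CollectI exI[of _ 0]) auto
    show "1 \<in> ?B" using subring_1[OF A] by (intro CollectI exI[of _ 1] exI[of _ 0]) auto
    fix a b assume "a \<in> ?B" "b \<in> ?B"
    then obtain r n s k where *: "r \<in> ideal_pow A M n" "a = r / z ^ n" "s \<in> ideal_pow A M k" "b = s / z ^ k"
      by blast
    have "a + b = (r * z ^ k + z ^ n * s) / z ^ (n + k)"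
      unfolding *(2,4) using z0 by (simp add: field_simps power_add)
    moreover have "r * z ^ k + z ^ n * s \<in> ideal_pow A M (n + k)"
      by (intro ideal_add[OF iP] ideal_pow_mult[OF A ideal_M] * z_pow)
    ultimately show "a + b \<in> ?B" by blast
    have "a * b = (r * s) / z ^ (n + k)" using * by (simp add: power_add)
    then show "a * b \<in> ?B" using ideal_pow_mult[OF A ideal_M *(1,3)] by blast
    have "- a = (- r) / z ^ n" using * by simp
    then show "- a \<in> ?B" using ideal_uminus[OF A iP *(1)] by blast
  qed
  moreover have "A \<subseteq> ?B"
  proof
    fix a assume "a \<in> A"
    then show "a \<in> ?B" by (intro CollectI exI[of _ a] exI[of _ 0]) auto
  qed
  moreover have "{a / z | a. a \<in> M} \<subseteq> ?B"
  proof
    fix x assume "x \<in> {a / z | a. a \<in> M}"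
    then obtain a where "a \<in> ideal_pow A M (Suc 0)" "x = a / z ^ Suc 0"
      using ideal_pow_one[OF A ideal_M] by auto
    then show "x \<in> ?B" by blast
  qed
  ultimately show "B \<subseteq> ?B" unfolding B_def ring_adjoin_def by (intro Inter_lower) simp
  have sup: "A \<union> {a / z | a. a \<in> M} \<subseteq> B" and sB: "subring B"
    unfolding B_def ring_adjoin_def by (blast, auto simp: subring_def)
  have "r / z ^ n \<in> B" if "r \<in> ideal_pow A M n" for r n
    using that
  proof (induction n arbitrary: r)
    case 0
    then show ?case using sup by auto
  next
    case (Suc n)
    have "ideal_prod M (ideal_pow A M n) \<subseteq> {r. r / z ^ Suc n \<in> B}"
    proof (rule ideal_prod_least)
      fix i j assume "i \<in> M" "j \<in> ideal_pow A M n"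
      then have "(i / z) * (j / z ^ n) \<in> B" using sup Suc.IH by (intro subring_mult[OF sB]) auto
      then show "i * j \<in> {r. r / z ^ Suc n \<in> B}" by simp
    qed (auto simp: add_divide_distrib intro: subring_0[OF sB] subring_add[OF sB])
    then show ?case using Suc.prems by auto
  qed
  then show "?B \<subseteq> B" by blast
qed

lemma BI: "r \<in> ideal_pow A M n \<Longrightarrow> r / z ^ n \<in> B"
  unfolding B_eq by blast

lemma BE:
  assumes "b \<in> B" obtains r n where "r \<in> ideal_pow A M n" "b = r / z ^ n"
  using assms unfolding B_eq by blast

lemma B: "subring B"
  unfolding B_def ring_adjoin_def by (auto simp: subring_def)

lemma AB: "A \<subseteq> B"
  unfolding B_def ring_adjoin_def by blast

lemma C: "subring C"
  unfolding C_def by (rule subring_localize_at[OF B q])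

lemma BC: "B \<subseteq> C"
  unfolding C_def by (rule localize_at_superset[OF B q])

lemma AC: "A \<subseteq> C"
  using AB BC by blast

definition MC where "MC = extend_ideal B q q"

lemma quasi_local_C: "quasi_local C MC"
  unfolding C_def MC_def by (rule quasi_local_localize_at[OF B q])

sublocale C: quasi_local C MC
  by (rule quasi_local_C)

lemma B_MC_iff: "b \<in> B \<Longrightarrow> b \<in> MC \<longleftrightarrow> b \<in> q"
  unfolding MC_def by (rule extend_prime_Int[OF B q q order_refl])

lemma A_MC_iff: "a \<in> A \<Longrightarrow> a \<in> MC \<longleftrightarrow> a \<in> M"
proof
  assume a: "a \<in> A" "a \<in> MC"
  show "a \<in> M"
  proof (rule ccontr)
    assume "a \<notin> M"
    then have "inverse a \<in> C" "a \<noteq> 0" using inverse_in[OF a(1)] AC ideal_0[OF ideal_M] by auto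
    then have "1 \<in> MC" using ideal_mult[OF C.ideal_M a(2), of "inverse a"] by simp
    then show False using C.one_notin by simp
  qed
qed (use Mq AB B_MC_iff in blast)

lemma M_pow_divide: "r \<in> ideal_pow A M n \<Longrightarrow> r / z ^ n \<in> C"
  using BI BC by blast

lemma M_divide: "a \<in> M \<Longrightarrow> a / z \<in> C"
  using M_pow_divide[of a "Suc 0"] ideal_pow_one[OF A ideal_M] by simp

lemma ord_B:
  assumes "b \<in> B" shows "ordF A b \<ge> 0"
proof (cases "b = 0")
  case False
  obtain r n where r: "r \<in> ideal_pow A M n" "b = r / z ^ n" using assms by (rule BE)
  have rA: "r \<in> A" "r \<noteq> 0" using r False ideal_subset[OF ideal_ideal_pow[OF A ideal_M]] by auto
  have "n \<le> ordR A r" using ord_iff[OF rA] r(1) by blast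
  moreover have "ordF A (z ^ n) = int n" using ordF_power[OF z0] ordF_elem[OF zA z0] ord_z by simp
  ultimately show ?thesis
    unfolding r(2) using ordF_divide'[OF rA(2), of "z ^ n"] z0 ordF_elem[OF rA] by simp
qed (simp add: ordF_def)

lemma ord_B_pos:
  assumes "b \<in> B" "ordF A b > 0" shows "b / z \<in> B"
proof -
  have b0: "b \<noteq> 0" using assms(2) by (auto simp: ordF_def)
  obtain r n where r: "r \<in> ideal_pow A M n" "b = r / z ^ n" using assms(1) by (rule BE)
  have rA: "r \<in> A" "r \<noteq> 0" using r b0 ideal_subset[OF ideal_ideal_pow[OF A ideal_M]] by auto
  have "ordF A (z ^ n) = int n" using ordF_power[OF z0] ordF_elem[OF zA z0] ord_z by simp
  then have "Suc n \<le> ordR A r"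
    using assms(2) ordF_divide'[OF rA(2), of "z ^ n"] z0 ordF_elem[OF rA] unfolding r(2) by simp
  then have "r / z ^ Suc n \<in> B" using ord_iff[OF rA] BI by blast
  then show ?thesis by (simp add: r(2) mult.commute)
qed

lemma ord_B_unit:
  assumes "b \<in> B" "b \<notin> q" shows "ordF A b = 0"
proof (rule ccontr)
  assume "ordF A b \<noteq> 0"
  then have "ordF A b > 0" using ord_B[OF assms(1)] by simp
  then have "b / z \<in> B" by (rule ord_B_pos[OF assms(1)])
  moreover have "z \<in> q" using zM Mq by blast
  ultimately have "(b / z) * z \<in> q" by (intro ideal_mult[OF prime_ideal_ideal[OF q]])
  then show False using assms(2) z0 by simp
qed

text \<open>Elements of \<open>B\<close> of positive order are multiples of \<open>z\<close> and so
  lie in \<open>q\<close>; denominators outside \<open>q\<close> thus have order zero. Hence the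
  order valuation ring of \<open>A\<close> contains \<open>C\<close> and is centred on
  \<open>zC\<close>.\<close>

lemma ord_C:
  assumes "c \<in> C" shows "ordF A c \<ge> 0" and "ordF A c > 0 \<Longrightarrow> c / z \<in> C"
proof -
  obtain a b where ab: "a \<in> B" "b \<in> B" "b \<notin> q" "c = a / b" using assms unfolding C_def by (rule localize_atE)
  have b0: "b \<noteq> 0" using ab ideal_0[OF prime_ideal_ideal[OF q]] by auto
  have eq: "ordF A c = ordF A a"
  proof (cases "a = 0")
    case False
    then show ?thesis using ordF_divide'[OF False b0] ord_B_unit[OF ab(2,3)] ab(4) by simp
  qed (use ab in simp)
  show "ordF A c \<ge> 0" using eq ord_B[OF ab(1)] by simp
  assume "ordF A c > 0"
  then have "a / z \<in> B" using ord_B_pos[OF ab(1)] eq by simp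
  then show "c / z \<in> C"
    unfolding C_def by (rule localize_atI[OF _ ab(2,3)]) (simp add: ab(4))
qed

text \<open>The transform changes nothing away from the exceptional locus: \<open>z\<close> divides
  all of \<open>M\<close> in \<open>C\<close>, so a prime not containing \<open>M\<close> omits
  \<open>z\<close>, and the denominators of \<open>C\<close> become units at its
  contraction.\<close>

lemma C_subset_localize:
  assumes P: "prime_ideal C P" and MP: "\<not> M \<subseteq> P"
  shows "C \<subseteq> localize_at A (P \<inter> A)"
proof
  note iP = prime_ideal_ideal[OF P]
  have zP: "z \<notin> P"
  proof
    assume "z \<in> P"
    then have "a \<in> P" if "a \<in> M" for a
      using ideal_mult[OF iP \<open>z \<in> P\<close> M_divide[OF that]] z0 by simp
    with MP show False by blast
  qed
  have zC: "z \<in> C" using zA AC by blast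
  fix c assume "c \<in> C"
  then obtain a b where ab: "a \<in> B" "b \<in> B" "b \<notin> q" "c = a / b" unfolding C_def by (rule localize_atE)
  obtain r n where r: "r \<in> ideal_pow A M n" "a = r / z ^ n" using ab(1) by (rule BE)
  obtain s k where s: "s \<in> ideal_pow A M k" "b = s / z ^ k" using ab(2) by (rule BE)
  have rs: "r \<in> A" "s \<in> A" using r s ideal_subset[OF ideal_ideal_pow[OF A ideal_M]] by auto
  have zk: "z ^ j \<in> A" "z ^ j \<in> C" "z ^ j \<notin> P" for j
    using subring_power[OF A zA] AC prime_ideal_power[OF C P zC] zP by auto
  have bC: "b \<in> C" using ab BC by auto
  have "b \<notin> MC" using ab B_MC_iff by blast
  then have "b \<notin> P" using C.prime_subset_M[OF P] by blast
  then have "b * z ^ k \<notin> P" using prime_ideal_mult[OF P bC zk(2)] zk(3) by blast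
  then have sP: "s \<notin> P" using s(2) z0 by simp
  show "c \<in> localize_at A (P \<inter> A)"
  proof (rule localize_atI)
    show "r * z ^ k \<in> A" "s * z ^ n \<in> A" using rs zk subring_mult[OF A] by auto
    show "s * z ^ n \<notin> P \<inter> A" using prime_ideal_mult[OF P _ zk(2)] sP zk(3) rs AC by blast
    show "c = r * z ^ k / (s * z ^ n)" using ab(4) r(2) s(2) z0 by (simp add: field_simps)
  qed
qed

end

section \<open>The order does not increase under transforms\<close>

text \<open>Elements of A[M/z] are lifted to polynomials in new variables by Taylor expansion, the
  generator g/z going to g/z + X_g.  Coefficients in degree below n of the lift of an element
  of the n-th power of the maximal ideal lie in the maximal ideal, whereas a form of degree n that is
  nonzero modulo M has a lift of degree at most n with a unit among its top coefficients.\<close>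

context quadratic_transform
begin

abbreviation lk where "lk \<equiv> Poly_Mapping.lookup"

definition cst :: "'a \<Rightarrow> 'a mpoly" where "cst c = Poly_Mapping.single {#} c"

definition shifted :: "'a \<Rightarrow> 'a mpoly" where "shifted g = cst (g / z) + Poly_Mapping.single {#g#} 1"

definition shifted_mono :: "'a multiset \<Rightarrow> 'a mpoly" where
  "shifted_mono m = prod_mset (image_mset shifted m)"

text \<open>The parameter \<open>z\<close> gets no variable because \<open>z / z = 1\<close>. A lift
  is not determined by its constant coefficient; \<open>lifts_kernel\<close> controls the
  ambiguity.\<close>

definition lifts :: "'a mpoly set" where
  "lifts = lspan cst A {m. set_mset m \<subseteq> G - {z}} shifted_mono"

text \<open>The ideal generated by \<open>MC\<close> and the \<open>N\<close>-th power of the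
  variables, that is, vanishing to order \<open>N\<close> at the origin over the residue field of
  \<open>C\<close>.\<close>

definition filt :: "nat \<Rightarrow> 'a mpoly set" where
  "filt N = {p. \<forall>k. lk p k \<in> C \<and> (size k < N \<longrightarrow> lk p k \<in> MC)}"

lemma cst_hom: "cst (a + b) = cst a + cst b" "cst (a * b) = cst a * cst b" "cst 1 = 1"
  by (simp_all add: cst_def single_add mult_single)

lemma lk_cst: "lk (cst c) k = (if k = {#} then c else 0)"
  by (simp add: cst_def lookup_single when_def)

lemma lk_cst_mult: "lk (cst c * p) k = c * lk p k"
  by (simp add: cst_def lookup_single_mult)

lemma lk_single_elem_mult:
  "lk (Poly_Mapping.single {#g#} 1 * p) k = (if g \<in># k then lk (p :: 'a mpoly) (k - {#g#}) else 0)"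
  by (simp add: lookup_single_mult)

lemma lk_shifted_mono_zero: "lk (shifted_mono m) {#} = prod_mset m / z ^ size m"
  by (induction m) (simp_all add: shifted_mono_def shifted_def lookup_mult_zero lookup_add lk_cst
      lookup_single when_def lookup_one)

text \<open>Among the terms of degree at least \<open>size m\<close>, the product of the factors
  \<open>g / z + X_g\<close> has only the monomial \<open>m\<close>; the shift changes lower degrees
  only.\<close>

lemma lk_shifted_mono_top:
  "size m \<le> size k \<Longrightarrow> lk (shifted_mono m) k = (if m = k then 1 else 0)"
proof (induction m arbitrary: k)
  case empty
  then show ?case by (simp add: shifted_mono_def lookup_one when_def)
next
  case (add g m)
  have "lk (shifted_mono (add_mset g m)) k =
    (g / z) * lk (shifted_mono m) k + (if g \<in># k then lk (shifted_mono m) (k - {#g#}) else 0)"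
    by (simp add: shifted_mono_def shifted_def distrib_right lookup_add lk_cst_mult lk_single_elem_mult)
  moreover have "lk (shifted_mono m) k = 0" using add.IH[of k] add.prems by auto
  moreover have "lk (shifted_mono m) (k - {#g#}) = (if m = k - {#g#} then 1 else 0)" if "g \<in># k"
    using add.IH[of "k - {#g#}"] add.prems that by (simp add: size_Diff_singleton)
  moreover have "(add_mset g m = k) = (g \<in># k \<and> m = k - {#g#})" by auto
  ultimately show ?case by auto
qed

lemma filt_add: "p \<in> filt N \<Longrightarrow> r \<in> filt N \<Longrightarrow> p + r \<in> filt N"
  by (auto simp: filt_def lookup_add intro: subring_add[OF C] ideal_add[OF C.ideal_M])

lemma filt_mult:
  assumes "p \<in> filt a" "r \<in> filt b" shows "p * r \<in> filt (a + b)"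
  unfolding filt_def
proof (intro CollectI allI conjI impI)
  fix k
  have p: "lk p i \<in> C" "size i < a \<Longrightarrow> lk p i \<in> MC" for i using assms(1) by (auto simp: filt_def)
  have r: "lk r i \<in> C" "size i < b \<Longrightarrow> lk r i \<in> MC" for i using assms(2) by (auto simp: filt_def)
  show "lk (p * r) k \<in> C"
    unfolding lookup_mult_keys using p(1) r(1)
    by (intro subring_sum[OF C]) (auto intro: subring_mult[OF C] subring_0[OF C])
  assume k: "size k < a + b"
  have "lk p i * lk r j \<in> MC" if "i + j = k" for i j
  proof -
    have "size i + size j < a + b" using k that by auto
    then have "size i < a \<or> size j < b" by linarith
    then show ?thesis
      using p r ideal_mult[OF C.ideal_M] ideal_mult'[OF C.ideal_M] by blast
  qed
  then show "lk (p * r) k \<in> MC"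
    unfolding lookup_mult_keys
    by (intro ideal_sum[OF C.ideal_M]) (auto intro: ideal_0[OF C.ideal_M])
qed

text \<open>The coefficient of the product at \<open>k\<close> is \<open>lk p k * lk s {#}\<close>
  plus terms with coefficients of \<open>p\<close> in smaller degree. Since \<open>lk s {#}\<close>
  is a unit, induction on the degree applies.\<close>

lemma filt_cancel:
  assumes p: "p \<in> filt 0" and s: "s \<in> filt 0" "lk s {#} \<notin> MC" and ps: "p * s \<in> filt N"
  shows "p \<in> filt N"
proof -
  have pC: "lk p i \<in> C" and sC: "lk s i \<in> C" for i using p s by (auto simp: filt_def)
  have "size k < N \<Longrightarrow> lk p k \<in> MC" for k
  proof (induction "size k" arbitrary: k rule: less_induct)
    case less
    show ?case
    proof (cases "k \<in> Poly_Mapping.keys p")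
      case False
      then show ?thesis using ideal_0[OF C.ideal_M] by (simp add: not_in_keys_iff_lookup_eq_zero)
    next
      case True
      have s0: "{#} \<in> Poly_Mapping.keys s"
        using s(2) ideal_0[OF C.ideal_M] by (metis not_in_keys_iff_lookup_eq_zero)
      let ?t = "\<lambda>i j. if i + j = k then lk p i * lk s j else 0"
      have "lk (p * s) k = (\<Sum>(i, j)\<in>Poly_Mapping.keys p \<times> Poly_Mapping.keys s. ?t i j)"
        unfolding lookup_mult_keys by (rule sum.cartesian_product)
      also have "\<dots> = lk p k * lk s {#} +
          (\<Sum>(i, j)\<in>Poly_Mapping.keys p \<times> Poly_Mapping.keys s - {(k, {#})}. ?t i j)"
        using True s0 by (subst sum.remove[of _ "(k, {#})"]) auto
      finally have eq: "lk p k * lk s {#} = lk (p * s) k -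
          (\<Sum>(i, j)\<in>Poly_Mapping.keys p \<times> Poly_Mapping.keys s - {(k, {#})}. ?t i j)" by simp
      have "?t i j \<in> MC" if "(i, j) \<noteq> (k, {#})" for i j
      proof (cases "i + j = k")
        case True
        then have "j \<noteq> {#}" using that by auto
        then have "size i < size k" using True by (auto simp: size_eq_0_iff_empty[symmetric] simp del: size_eq_0_iff_empty)
        then have "lk p i \<in> MC" using less by auto
        then show ?thesis using ideal_mult'[OF C.ideal_M _ sC] True by simp
      qed (use ideal_0[OF C.ideal_M] in simp)
      then have "(\<Sum>(i, j)\<in>Poly_Mapping.keys p \<times> Poly_Mapping.keys s - {(k, {#})}. ?t i j) \<in> MC"
        by (intro ideal_sum[OF C.ideal_M]) auto
      moreover have "lk (p * s) k \<in> MC" using ps less.prems by (auto simp: filt_def)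
      ultimately have "lk p k * lk s {#} \<in> MC" unfolding eq by (intro ideal_diff[OF C C.ideal_M])
      then show ?thesis using prime_ideal_mult[OF C.prime_M pC sC] s(2) by blast
    qed
  qed
  then show ?thesis using pC by (auto simp: filt_def)
qed

lemma lifts_add: "p \<in> lifts \<Longrightarrow> r \<in> lifts \<Longrightarrow> p + r \<in> lifts"
  unfolding lifts_def by (rule lspan_add[OF cst_hom A])

lemma lifts_mult: "p \<in> lifts \<Longrightarrow> r \<in> lifts \<Longrightarrow> p * r \<in> lifts"
  unfolding lifts_def
  by (rule lspan_mult[OF cst_hom A, of "{m. set_mset m \<subseteq> G - {z}}" shifted_mono])
     (auto simp: shifted_mono_def)

lemma lifts_cst: "a \<in> A \<Longrightarrow> cst a \<in> lifts"
  unfolding lifts_def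
  by (rule lspanI[of "{{#}}" _ "\<lambda>_. a"]) (auto simp: shifted_mono_def)

lemma lifts_uminus: "p \<in> lifts \<Longrightarrow> - p \<in> lifts"
  using lifts_mult[OF lifts_cst[of "- 1"], of p] subring_uminus[OF A subring_1[OF A]]
  by (simp add: cst_def single_uminus)

lemma lifts_shifted_mono: "set_mset m \<subseteq> G - {z} \<Longrightarrow> shifted_mono m \<in> lifts"
  unfolding lifts_def by (rule lspan_base[OF cst_hom A]) simp

lemma G_divide: "g \<in> G \<Longrightarrow> g / z \<in> C"
  using M_divide G_sub by blast

lemma shifted_mono_filt: "set_mset m \<subseteq> G - {z} \<Longrightarrow> shifted_mono m \<in> filt 0"
proof (induction m)
  case empty
  then show ?case using subring_1[OF C] subring_0[OF C]
    by (simp add: shifted_mono_def filt_def lookup_one when_def)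
next
  case (add g m)
  have "shifted g \<in> filt 0"
    using G_divide[of g] add.prems subring_1[OF C] subring_0[OF C] subring_add[OF C]
    by (simp add: shifted_def filt_def lookup_add lk_cst lookup_single when_def)
  then have "shifted g * shifted_mono m \<in> filt (0 + 0)" using add by (intro filt_mult) auto
  then show ?case by (simp add: shifted_mono_def)
qed

lemma lifts_filt:
  assumes "p \<in> lifts" shows "p \<in> filt 0"
proof -
  obtain X r where X: "finite X" "X \<subseteq> {m. set_mset m \<subseteq> G - {z}}" "\<forall>m\<in>X. r m \<in> A"
    "p = (\<Sum>m\<in>X. cst (r m) * shifted_mono m)"
    using assms unfolding lifts_def by (rule lspanE)
  have "lk p k \<in> C" for k
    unfolding X(4) lookup_sum lk_cst_mult
    using X(2,3) AC shifted_mono_filt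
    by (intro subring_sum[OF C] subring_mult[OF C]) (auto simp: filt_def)
  then show ?thesis by (simp add: filt_def)
qed

text \<open>A lift of zero is a polynomial relation over \<open>A\<close> among the fractions
  \<open>g / z\<close>. Homogenised with \<open>z\<close> it becomes a relation among the
  parameters, and analytic independence puts its coefficients into \<open>M\<close>.\<close>

lemma lifts_kernel:
  assumes "p \<in> lifts" "lk p {#} = 0" shows "lk p k \<in> MC"
proof -
  obtain X r where X: "finite X" "X \<subseteq> {m. set_mset m \<subseteq> G - {z}}" "\<forall>m\<in>X. r m \<in> A"
    "p = (\<Sum>m\<in>X. cst (r m) * shifted_mono m)"
    using assms(1) unfolding lifts_def by (rule lspanE)
  \<comment> \<open>Any common bound of the degrees would do. Monomials are padded with copies of
    \<open>z\<close> up to degree \<open>K\<close>; as they contain no \<open>z\<close> themselves,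
    a filter undoes the padding and \<open>h\<close> is injective on \<open>X\<close>.\<close>
  define K where "K = (\<Sum>m\<in>X. size m)"
  have sz: "size m \<le> K" if "m \<in> X" for m
    unfolding K_def using X(1) that by (intro member_le_sum) auto
  define h where "h m = m + replicate_mset (K - size m) z" for m :: "'a multiset"
  have unpad: "filter_mset (\<lambda>g. g \<noteq> z) (h m) = m" if "m \<in> X" for m
  proof -
    have "set_mset m \<subseteq> G - {z}" using X(2) that by auto
    then have "filter_mset (\<lambda>g. g \<noteq> z) m = m" by (subst filter_mset_eq_conv) auto
    moreover have "filter_mset (\<lambda>g. g \<noteq> z) (replicate_mset j z) = {#}" for j by (induction j) auto
    ultimately show ?thesis by (simp add: h_def)
  qed
  have inj: "inj_on h X" by (metis unpad inj_onI)
  have "(\<Sum>m\<in>h ` X. r (filter_mset (\<lambda>g. g \<noteq> z) m) * prod_mset m) = (\<Sum>m\<in>X. r m * prod_mset (h m))"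
    unfolding sum.reindex[OF inj] by (rule sum.cong) (auto simp: unpad)
  also have "\<dots> = (\<Sum>m\<in>X. z ^ K * (r m * lk (shifted_mono m) {#}))"
  proof (rule sum.cong)
    fix m assume m: "m \<in> X"
    have "z ^ K = z ^ size m * z ^ (K - size m)" using sz[OF m] by (simp flip: power_add)
    then show "r m * prod_mset (h m) = z ^ K * (r m * lk (shifted_mono m) {#})"
      using z0 by (simp add: h_def lk_shifted_mono_zero)
  qed simp
  also have "\<dots> = z ^ K * lk p {#}" by (simp add: X(4) lookup_sum lk_cst_mult sum_distrib_left)
  finally have sum: "(\<Sum>m\<in>h ` X. r (filter_mset (\<lambda>g. g \<noteq> z) m) * prod_mset m) = 0" using assms(2) by simp
  have rM: "r m \<in> M" if "m \<in> X" for m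
  proof -
    have "r (filter_mset (\<lambda>g. g \<noteq> z) (h m)) \<in> M"
    proof (rule analytic_independence[OF _ _ sum, where n = K])
      show "finite (h ` X)" using X(1) by simp
      show "h m \<in> h ` X" using that by simp
      fix l assume "l \<in> h ` X"
      then obtain m' where m': "m' \<in> X" "l = h m'" by blast
      have "set_mset l \<subseteq> G" unfolding m'(2) h_def using X(2) m'(1) zG by (auto simp: in_replicate_mset)
      moreover have "size l = K" unfolding m'(2) h_def using sz[OF m'(1)] by simp
      ultimately show "set_mset l \<subseteq> G \<and> size l = K \<and> r (filter_mset (\<lambda>g. g \<noteq> z) l) \<in> A"
        using unpad[OF m'(1)] X(3) m' by simp
    qed
    then show ?thesis using unpad[OF that] by simp
  qed
  show ?thesis
    unfolding X(4) lookup_sum lk_cst_mult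
  proof (intro ideal_sum[OF C.ideal_M] ideal_mult'[OF C.ideal_M])
    fix m assume m: "m \<in> X"
    show "r m \<in> MC" using rM[OF m] A_MC_iff M_sub by blast
    show "lk (shifted_mono m) k \<in> C" using shifted_mono_filt[of m] X(2) m by (auto simp: filt_def)
  qed
qed

text \<open>The constant coefficients of lifts form a ring containing \<open>A\<close> and the
  fractions \<open>g / z\<close>, hence all of \<open>B\<close>.\<close>

lemma B_lift:
  assumes "b \<in> B" shows "\<exists>p\<in>lifts. lk p {#} = b"
proof -
  let ?K = "{lk p {#} | p. p \<in> lifts}"
  have K: "subring ?K"
    unfolding subring_def
  proof (intro conjI ballI)
    show "0 \<in> ?K" using lifts_cst[OF subring_0[OF A]] lk_cst[of 0 "{#}"] by force
    show "1 \<in> ?K" using lifts_cst[OF subring_1[OF A]] lk_cst[of 1 "{#}"] by force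
    fix a b assume "a \<in> ?K" "b \<in> ?K"
    then obtain p r where pr: "p \<in> lifts" "r \<in> lifts" "a = lk p {#}" "b = lk r {#}" by blast
    show "a + b \<in> ?K" using lifts_add[OF pr(1,2)] pr(3,4) lookup_add[of p r "{#}"] by force
    show "a * b \<in> ?K" using lifts_mult[OF pr(1,2)] pr(3,4) lookup_mult_zero[of p r] by force
    show "- a \<in> ?K" using lifts_uminus[OF pr(1)] pr(3) lookup_uminus[of p "{#}"] by force
  qed
  have AK: "A \<subseteq> ?K"
  proof
    fix a assume "a \<in> A"
    then show "a \<in> ?K" using lifts_cst lk_cst[of a "{#}"] by force
  qed
  let ?I = "{a \<in> A. a / z \<in> ?K}"
  have iI: "ideal A ?I"
    unfolding ideal_def
  proof (intro conjI ballI)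
    show "0 \<in> ?I" using subring_0[OF A] subring_0[OF K] by simp
    show "a + b \<in> ?I" if "a \<in> ?I" "b \<in> ?I" for a b
      using that subring_add[OF K, of "a / z" "b / z"] subring_add[OF A] by (simp add: add_divide_distrib)
    show "r * a \<in> ?I" if "a \<in> ?I" "r \<in> A" for a r
    proof -
      have "r * (a / z) \<in> ?K" by (rule subring_mult[OF K]) (use that AK in auto)
      then show ?thesis using that subring_mult[OF A] by simp
    qed
  qed auto
  have "G \<subseteq> ?I"
  proof
    fix g assume g: "g \<in> G"
    have "g / z \<in> ?K"
    proof (cases "g = z")
      case True
      then show ?thesis using z0 subring_1[OF K] by simp
    next
      case False
      then have "shifted_mono {#g#} \<in> lifts" using g by (intro lifts_shifted_mono) auto
      then show ?thesis using lk_shifted_mono_zero[of "{#g#}"] by force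
    qed
    then show "g \<in> ?I" using g G_A[OF order_refl] by auto
  qed
  then have "M \<subseteq> ?I" unfolding gen by (rule gen_ideal_least[OF iI])
  then have "{a / z | a. a \<in> M} \<subseteq> ?K" by blast
  then have "B \<subseteq> ?K" unfolding B_def ring_adjoin_def using K AK by (intro Inter_lower) simp
  with assms show ?thesis by blast
qed

text \<open>A denominator \<open>s\<close> with unit constant coefficient is carried along because
  lifts are available for \<open>B\<close>, while \<open>C\<close> is a localization of
  \<open>B\<close>. The sets are built so as to contain the powers of \<open>MC\<close>.\<close>

definition ford :: "nat \<Rightarrow> 'a set" where
  "ford N = {c. \<exists>p\<in>lifts. \<exists>s\<in>lifts. p \<in> filt N \<and> lk s {#} \<notin> MC \<and> c * lk s {#} = lk p {#}}"

lemma fordI: "p \<in> lifts \<Longrightarrow> s \<in> lifts \<Longrightarrow> p \<in> filt N \<Longrightarrow> lk s {#} \<notin> MC \<Longrightarrow> c * lk s {#} = lk p {#} \<Longrightarrow> c \<in> ford N"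
  unfolding ford_def by blast

lemma fordE:
  assumes "c \<in> ford N"
  obtains p s where "p \<in> lifts" "s \<in> lifts" "p \<in> filt N" "lk s {#} \<notin> MC" "c * lk s {#} = lk p {#}"
  using assms unfolding ford_def by blast

lemma lk_lifts_C: "s \<in> lifts \<Longrightarrow> lk s k \<in> C"
  using lifts_filt by (auto simp: filt_def)

lemma ford_add:
  assumes "c \<in> ford N" "d \<in> ford N" shows "c + d \<in> ford N"
proof -
  obtain p s where 1: "p \<in> lifts" "s \<in> lifts" "p \<in> filt N" "lk s {#} \<notin> MC" "c * lk s {#} = lk p {#}"
    using assms(1) by (rule fordE)
  obtain r t where 2: "r \<in> lifts" "t \<in> lifts" "r \<in> filt N" "lk t {#} \<notin> MC" "d * lk t {#} = lk r {#}"
    using assms(2) by (rule fordE)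
  show ?thesis
  proof (rule fordI)
    show "p * t + r * s \<in> lifts" "s * t \<in> lifts" by (simp_all add: 1 2 lifts_add lifts_mult)
    show "p * t + r * s \<in> filt N"
      using filt_mult[OF 1(3) lifts_filt[OF 2(2)]] filt_mult[OF 2(3) lifts_filt[OF 1(2)]]
      by (intro filt_add) auto
    show "lk (s * t) {#} \<notin> MC"
      unfolding lookup_mult_zero
      using prime_ideal_mult[OF C.prime_M lk_lifts_C[OF 1(2)] lk_lifts_C[OF 2(2)]] 1(4) 2(4) by blast
    have "(c + d) * (lk s {#} * lk t {#}) = (c * lk s {#}) * lk t {#} + (d * lk t {#}) * lk s {#}"
      by (simp add: algebra_simps)
    then show "(c + d) * lk (s * t) {#} = lk (p * t + r * s) {#}"
      by (simp add: lookup_mult_zero lookup_add 1(5) 2(5))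
  qed
qed

lemma ford_mult:
  assumes "c \<in> ford N" "d \<in> ford K" shows "c * d \<in> ford (N + K)"
proof -
  obtain p s where 1: "p \<in> lifts" "s \<in> lifts" "p \<in> filt N" "lk s {#} \<notin> MC" "c * lk s {#} = lk p {#}"
    using assms(1) by (rule fordE)
  obtain r t where 2: "r \<in> lifts" "t \<in> lifts" "r \<in> filt K" "lk t {#} \<notin> MC" "d * lk t {#} = lk r {#}"
    using assms(2) by (rule fordE)
  show ?thesis
  proof (rule fordI)
    show "p * r \<in> lifts" "s * t \<in> lifts" by (simp_all add: 1 2 lifts_mult)
    show "p * r \<in> filt (N + K)" by (rule filt_mult[OF 1(3) 2(3)])
    show "lk (s * t) {#} \<notin> MC"
      unfolding lookup_mult_zero
      using prime_ideal_mult[OF C.prime_M lk_lifts_C[OF 1(2)] lk_lifts_C[OF 2(2)]] 1(4) 2(4) by blast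
    have "(c * d) * (lk s {#} * lk t {#}) = (c * lk s {#}) * (d * lk t {#})"
      by (simp add: algebra_simps)
    then show "(c * d) * lk (s * t) {#} = lk (p * r) {#}"
      by (simp add: lookup_mult_zero 1(5) 2(5))
  qed
qed

lemma ford_C_MC:
  shows "c \<in> C \<Longrightarrow> c \<in> ford 0" and "c \<in> MC \<Longrightarrow> c \<in> ford (Suc 0)"
proof -
  have gen: "c \<in> ford N"
    if a: "a \<in> B" "b \<in> B" "b \<notin> q" "c = a / b" and N: "\<And>p. p \<in> lifts \<Longrightarrow> lk p {#} = a \<Longrightarrow> p \<in> filt N" for a b N
  proof -
    obtain p where p: "p \<in> lifts" "lk p {#} = a" using B_lift[OF a(1)] by blast
    obtain s where s: "s \<in> lifts" "lk s {#} = b" using B_lift[OF a(2)] by blast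
    have b0: "b \<noteq> 0" using a ideal_0[OF prime_ideal_ideal[OF q]] by auto
    show ?thesis
    proof (rule fordI[OF p(1) s(1) N[OF p]])
      show "lk s {#} \<notin> MC" unfolding s(2) using B_MC_iff a by blast
      show "c * lk s {#} = lk p {#}" unfolding p s a(4) using b0 by simp
    qed
  qed
  {
    assume "c \<in> C"
    then obtain a b where "a \<in> B" "b \<in> B" "b \<notin> q" "c = a / b" unfolding C_def by (rule localize_atE)
    then show "c \<in> ford 0" by (rule gen) (rule lifts_filt)
  }
  assume "c \<in> MC"
  then obtain a b where ab: "a \<in> q" "b \<in> B" "b \<notin> q" "c = a / b"
    unfolding MC_def extend_ideal_def[OF B q] by blast
  have aB: "a \<in> B" using ab ideal_subset[OF prime_ideal_ideal[OF q]] by blast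
  show "c \<in> ford (Suc 0)"
  proof (rule gen[OF aB ab(2-4)])
    fix p assume p: "p \<in> lifts" "lk p {#} = a"
    have "a \<in> MC" using B_MC_iff[OF aB] ab by blast
    then show "p \<in> filt (Suc 0)" using lk_lifts_C[OF p(1)] p(2) by (auto simp: filt_def)
  qed
qed

lemma MC_pow_ford: "c \<in> ideal_pow C MC N \<Longrightarrow> c \<in> ford N"
proof (induction N arbitrary: c)
  case 0
  then show ?case using ford_C_MC(1) by simp
next
  case (Suc N)
  have z: "0 \<in> ford (Suc N)"
    by (rule fordI[OF lifts_cst[OF subring_0[OF A]] lifts_cst[OF subring_1[OF A]]])
       (use C.one_notin subring_0[OF C] ideal_0[OF C.ideal_M] in \<open>auto simp: lk_cst filt_def\<close>)
  have "ideal_prod MC (ideal_pow C MC N) \<subseteq> ford (Suc N)"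
  proof (rule ideal_prod_least[OF z ford_add])
    fix i j assume "i \<in> MC" "j \<in> ideal_pow C MC N"
    then show "i * j \<in> ford (Suc N)" using ford_mult[OF ford_C_MC(2) Suc.IH] by simp
  qed
  with Suc.prems show ?case by auto
qed

text \<open>If the order grew, the lift \<open>F\<close> of \<open>f / z ^ n\<close> read off from a
  form for \<open>f\<close> would lie in \<open>filt (Suc n)\<close>. All its coefficients in degree
  at most \<open>n\<close> would then be in \<open>MC\<close>; but such coefficients show, modulo
  \<open>MC\<close>, the leading unit coefficients of the form for \<open>f\<close>.\<close>

theorem order_transform_le:
  assumes f: "f \<in> ideal_pow A M n" "f \<notin> ideal_pow A M (Suc n)"
  shows "f / z ^ n \<notin> ideal_pow C MC (Suc n)"
proof
  assume "f / z ^ n \<in> ideal_pow C MC (Suc n)"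
  then have "f / z ^ n \<in> ford (Suc n)" by (rule MC_pow_ford)
  then obtain p s where ps: "p \<in> lifts" "s \<in> lifts" "p \<in> filt (Suc n)" "lk s {#} \<notin> MC"
    "f / z ^ n * lk s {#} = lk p {#}" by (rule fordE)
  obtain X r where X: "finite X" "X \<subseteq> monoms n" "\<forall>m\<in>X. r m \<in> A" "f = (\<Sum>m\<in>X. r m * prod_mset m)"
    using M_pow_span[OF f(1)] by (rule lspanE)
  define red where "red m = filter_mset (\<lambda>g. g \<noteq> z) m" for m :: "'a multiset"
  define F where "F = (\<Sum>m\<in>X. cst (r m) * shifted_mono (red m))"
  have split: "m = red m + replicate_mset (n - size (red m)) z \<and> size (red m) \<le> n" if "m \<in> X" for m
  proof -
    have "m = red m + filter_mset (\<lambda>g. g = z) m"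
      using multiset_partition[of m "\<lambda>g. g \<noteq> z"] by (simp add: red_def)
    also have "filter_mset (\<lambda>g. g = z) m = replicate_mset (count m z) z" by (rule filter_eq_replicate_mset)
    finally have m: "m = red m + replicate_mset (count m z) z" .
    then have "size m = size (red m) + count m z" by (metis size_union size_replicate_mset)
    moreover have "size m = n" using X(2) that by auto
    ultimately show ?thesis using m by auto
  qed
  have red_inj: "inj_on red X"
    by (rule inj_onI) (metis split)
  have redG: "set_mset (red m) \<subseteq> G - {z}" if "m \<in> X" for m using X(2) that by (auto simp: red_def)
  have Fl: "F \<in> lifts"
    unfolding F_def lifts_def
    using redG X(3) by (intro lspan_sum[OF cst_hom A] lspan_scale[OF cst_hom A] lspan_base[OF cst_hom A]) auto
  have F0: "lk F {#} = f / z ^ n"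
    unfolding F_def lookup_sum lk_cst_mult X(4) sum_divide_distrib
  proof (rule sum.cong)
    fix m assume m: "m \<in> X"
    have "prod_mset m = prod_mset (red m) * z ^ (n - size (red m))"
      using split[OF m] by (metis prod_mset.union prod_mset_replicate_mset)
    moreover have "z ^ n = z ^ size (red m) * z ^ (n - size (red m))"
      using split[OF m] by (simp flip: power_add)
    ultimately show "r m * lk (shifted_mono (red m)) {#} = r m * prod_mset m / z ^ n"
      using z0 by (simp add: lk_shifted_mono_zero)
  qed simp
  \<comment> \<open>Both \<open>F * s\<close> and \<open>p\<close> lift the same element, so their
    difference is a lift of zero.\<close>
  have "lk (F * s + - p) k \<in> MC" for k
  proof (rule lifts_kernel)
    show "F * s + - p \<in> lifts" using Fl ps by (intro lifts_add lifts_mult lifts_uminus)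
    show "lk (F * s + - p) {#} = 0" using ps(5) by (simp add: lookup_minus lookup_mult_zero F0)
  qed
  then have "F * s + - p \<in> filt (Suc n)" using C.M_sub by (auto simp: filt_def)
  then have "F * s + - p + p \<in> filt (Suc n)" by (rule filt_add[OF _ ps(3)])
  then have "F \<in> filt (Suc n)"
    by (intro filt_cancel[OF lifts_filt[OF Fl] lifts_filt[OF ps(2)] ps(4)]) simp
  then have FM: "lk F k \<in> MC" if "size k \<le> n" for k using that by (auto simp: filt_def)
  have "\<forall>m\<in>X. r m \<in> M"
  proof (rule ccontr)
    assume "\<not> ?thesis"
    define X' where "X' = {m \<in> X. r m \<notin> M}"
    have "finite X'" "X' \<noteq> {}" using X(1) \<open>\<not> (\<forall>m\<in>X. r m \<in> M)\<close> by (auto simp: X'_def)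
    then have "Max ((\<lambda>m. size (red m)) ` X') \<in> (\<lambda>m. size (red m)) ` X'" by (intro Max_in) auto
    \<comment> \<open>A unit coefficient with \<open>red m\<close> of maximal degree: terms of
      larger degree have coefficients in \<open>M\<close>, and the remaining ones do not contribute
      to the monomial \<open>red m\<close>.\<close>
    then obtain m where "m \<in> X'" and mx: "size (red m) = Max ((\<lambda>m. size (red m)) ` X')" by auto
    moreover have "size (red l) \<le> size (red m)" if "l \<in> X'" for l
      unfolding mx using \<open>finite X'\<close> that by (intro Max_ge) auto
    ultimately have m: "m \<in> X'" "\<And>l. l \<in> X' \<Longrightarrow> size (red l) \<le> size (red m)" by auto
    have mX: "m \<in> X" "r m \<notin> M" using m(1) by (auto simp: X'_def)
    let ?k = "red m"
    have "lk F ?k = (\<Sum>l\<in>X. r l * lk (shifted_mono (red l)) ?k)"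
      by (simp add: F_def lookup_sum lk_cst_mult)
    also have "\<dots> = r m * lk (shifted_mono ?k) ?k + (\<Sum>l\<in>X - {m}. r l * lk (shifted_mono (red l)) ?k)"
      using X(1) mX(1) by (rule sum.remove)
    also have "lk (shifted_mono ?k) ?k = 1" using lk_shifted_mono_top[of ?k ?k] by simp
    finally have eq: "r m = lk F ?k - (\<Sum>l\<in>X - {m}. r l * lk (shifted_mono (red l)) ?k)" by simp
    have "r l * lk (shifted_mono (red l)) ?k \<in> MC" if l: "l \<in> X - {m}" for l
    proof (cases "size (red l) \<le> size ?k")
      case True
      have "red l \<noteq> ?k" using red_inj l mX(1) by (auto dest: inj_onD)
      then have "lk (shifted_mono (red l)) ?k = 0" using lk_shifted_mono_top[OF True] by simp
      then show ?thesis using ideal_0[OF C.ideal_M] by simp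
    next
      case False
      then have "r l \<in> M" using m(2)[of l] l by (auto simp: X'_def)
      then have "r l \<in> MC" using A_MC_iff M_sub by blast
      moreover have "lk (shifted_mono (red l)) ?k \<in> C"
        using lk_lifts_C[OF lifts_shifted_mono[OF redG]] l by blast
      ultimately show ?thesis by (rule ideal_mult'[OF C.ideal_M])
    qed
    then have "(\<Sum>l\<in>X - {m}. r l * lk (shifted_mono (red l)) ?k) \<in> MC" by (rule ideal_sum[OF C.ideal_M])
    moreover have "lk F ?k \<in> MC" using FM split[OF mX(1)] by blast
    ultimately have "r m \<in> MC" unfolding eq by (intro ideal_diff[OF C C.ideal_M])
    then show False using A_MC_iff X(3) mX by blast
  qed
  then have "f \<in> ideal_pow A M (Suc n)"
    unfolding X(4)
  proof (intro ideal_sum[OF ideal_ideal_pow[OF A ideal_M]] ideal_pow_mult_elem[OF A ideal_M])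
    fix m assume m: "m \<in> X"
    have "m \<in> monoms n" using X(2) m by (rule subsetD)
    then have "set_mset m \<subseteq> M" "size m = n" using G_sub by auto
    then show "prod_mset m \<in> ideal_pow A M n" using prod_mset_M_pow by blast
  qed auto
  with f(2) show False by simp
qed

end

section \<open>Localizations shared by a sequence of overrings\<close>

text \<open>A maximal counterexample \<open>K\<close> is proper and not prime, so it contains some
  \<open>a * b\<close> with neither factor in it; every prime over \<open>K\<close> contains one of
  the larger ideals \<open>K + aA\<close> and \<open>K + bA\<close>.\<close>

lemma finite_primes_over_ideal:
  assumes n: "noetherian A" and I: "ideal A I"
  shows "\<exists>F. finite F \<and> (\<forall>P\<in>F. prime_ideal A P \<and> I \<subseteq> P) \<and>
    (\<forall>Q. prime_ideal A Q \<longrightarrow> I \<subseteq> Q \<longrightarrow> (\<exists>P\<in>F. P \<subseteq> Q))"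
proof -
  have A: "subring A" using n by (rule noetherian_subring)
  define fin where "fin I \<longleftrightarrow> (\<exists>F. finite F \<and> (\<forall>P\<in>F. prime_ideal A P \<and> I \<subseteq> P) \<and>
    (\<forall>Q. prime_ideal A Q \<longrightarrow> I \<subseteq> Q \<longrightarrow> (\<exists>P\<in>F. P \<subseteq> Q)))" for I
  have finI: "fin I" if "finite F" "\<And>P. P \<in> F \<Longrightarrow> prime_ideal A P \<and> I \<subseteq> P"
    "\<And>Q. prime_ideal A Q \<Longrightarrow> I \<subseteq> Q \<Longrightarrow> \<exists>P\<in>F. P \<subseteq> Q" for F I
    unfolding fin_def using that by (intro exI[of _ F]) simp
  have "fin I"
  proof (rule ccontr)
    assume nf: "\<not> fin I"
    let ?Q = "\<lambda>I. ideal A I \<and> \<not> fin I"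
    have "?Q I" using I nf by simp
    then obtain K where K: "?Q K" and mx: "\<And>L. ?Q L \<Longrightarrow> K \<subseteq> L \<Longrightarrow> L = K"
      by (rule noetherian_maximal_pred[OF n, of ?Q]) (erule conjunct1, rule that)
    have iK: "ideal A K" and nK: "\<not> fin K" using K by auto
    have np: "\<not> prime_ideal A K"
    proof
      assume "prime_ideal A K"
      then have "fin K" by (intro finI[of "{K}"]) auto
      with nK show False by simp
    qed
    have KA: "K \<noteq> A"
    proof
      assume KA: "K = A"
      have "\<not> A \<subseteq> Q" if "prime_ideal A Q" for Q
        using prime_ideal_1[OF A that] subring_1[OF A] by auto
      then have "fin K" unfolding KA by (intro finI[of "{}"]) auto
      with nK show False by simp
    qed
    have "\<not> (\<forall>a\<in>A. \<forall>b\<in>A. a * b \<in> K \<longrightarrow> a \<in> K \<or> b \<in> K)"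
      using np iK KA by (simp add: prime_ideal_def)
    then obtain a b where ab: "a \<in> A" "b \<in> A" "a * b \<in> K" "a \<notin> K" "b \<notin> K" by auto
    have fin: "fin (adjoin_elem A K c)" if c: "c \<in> A" "c \<notin> K" for c
    proof (rule ccontr)
      assume *: "\<not> fin (adjoin_elem A K c)"
      have "adjoin_elem A K c = K"
        by (rule mx) (use * ideal_adjoin_elem[OF A iK c(1)] subset_adjoin_elem[OF A, of K c] in simp_all)
      then show False using elem_adjoin_elem[OF A iK, of c] c by simp
    qed
    obtain F1 where F1: "finite F1" "\<forall>P\<in>F1. prime_ideal A P \<and> adjoin_elem A K a \<subseteq> P"
      "\<forall>Q. prime_ideal A Q \<longrightarrow> adjoin_elem A K a \<subseteq> Q \<longrightarrow> (\<exists>P\<in>F1. P \<subseteq> Q)"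
      using fin[OF ab(1,4)] unfolding fin_def by (elim exE conjE)
    obtain F2 where F2: "finite F2" "\<forall>P\<in>F2. prime_ideal A P \<and> adjoin_elem A K b \<subseteq> P"
      "\<forall>Q. prime_ideal A Q \<longrightarrow> adjoin_elem A K b \<subseteq> Q \<longrightarrow> (\<exists>P\<in>F2. P \<subseteq> Q)"
      using fin[OF ab(2,5)] unfolding fin_def by (elim exE conjE)
    have "fin K"
    proof (rule finI[of "F1 \<union> F2"])
      show "finite (F1 \<union> F2)" using F1(1) F2(1) by simp
      show "prime_ideal A P \<and> K \<subseteq> P" if P: "P \<in> F1 \<union> F2" for P
      proof -
        have "prime_ideal A P \<and> (adjoin_elem A K a \<subseteq> P \<or> adjoin_elem A K b \<subseteq> P)"
          using P F1(2) F2(2) by auto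
        then show ?thesis
          using subset_adjoin_elem[OF A, of K a] subset_adjoin_elem[OF A, of K b] by auto
      qed
      fix Q assume Q: "prime_ideal A Q" "K \<subseteq> Q"
      have "a \<in> Q \<or> b \<in> Q" using prime_ideal_mult[OF Q(1) ab(1,2)] ab(3) Q(2) by auto
      then show "\<exists>P\<in>F1 \<union> F2. P \<subseteq> Q"
      proof
        assume "a \<in> Q"
        then have "adjoin_elem A K a \<subseteq> Q" by (rule adjoin_elem_least[OF prime_ideal_ideal[OF Q(1)] Q(2)])
        then have "\<exists>P\<in>F1. P \<subseteq> Q" by (rule F1(3)[rule_format, OF Q(1)])
        then show ?thesis by blast
      next
        assume "b \<in> Q"
        then have "adjoin_elem A K b \<subseteq> Q" by (rule adjoin_elem_least[OF prime_ideal_ideal[OF Q(1)] Q(2)])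
        then have "\<exists>P\<in>F2. P \<subseteq> Q" by (rule F2(3)[rule_format, OF Q(1)])
        then show ?thesis by blast
      qed
    qed
    with nK show False by simp
  qed
  then show ?thesis unfolding fin_def .
qed

text \<open>Such a \<open>p\<close> has no smaller prime containing \<open>b\<close>, so it is one
  of the finitely many primes minimal over \<open>bA\<close>.\<close>

lemma finite_DVR_localizations:
  assumes n: "noetherian A" and b: "b \<in> A" "b \<noteq> 0"
  shows "finite {p. prime_ideal A p \<and> b \<in> p \<and> DVR (localize_at A p)}"
proof -
  have A: "subring A" using n by (rule noetherian_subring)
  have ib: "ideal A (principal A b)" by (rule ideal_principal[OF A b(1)])
  have bb: "b \<in> principal A b" using subring_1[OF A] by (auto simp: principal_def)
  obtain F where F: "finite F" "\<forall>P\<in>F. prime_ideal A P \<and> principal A b \<subseteq> P"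
    "\<forall>Q. prime_ideal A Q \<longrightarrow> principal A b \<subseteq> Q \<longrightarrow> (\<exists>P\<in>F. P \<subseteq> Q)"
    using finite_primes_over_ideal[OF n ib] by blast
  have "p \<in> F" if p: "prime_ideal A p" "b \<in> p" "DVR (localize_at A p)" for p
  proof -
    have "principal A b \<subseteq> p"
      using ideal_mult'[OF prime_ideal_ideal[OF p(1)] p(2)] by (auto simp: principal_def)
    then obtain P where P: "P \<in> F" "P \<subseteq> p" using F(3) p(1) by blast
    have "prime_ideal A P" "b \<in> P" using F(2) P(1) bb by auto
    then have "P = p" using localization_DVR_height_one[OF A p(1,3) _ P(2) _ b(2)] by blast
    then show ?thesis using P(1) by simp
  qed
  then show ?thesis by (intro finite_subset[OF _ F(1)]) auto
qed

lemma localize_at_intermediate: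
  assumes A: "subring A" and B: "subring B" "A \<subseteq> B" and p: "prime_ideal B p"
    and sub: "B \<subseteq> localize_at A (p \<inter> A)"
  shows "localize_at B p = localize_at A (p \<inter> A)"
proof
  show "localize_at A (p \<inter> A) \<subseteq> localize_at B p"
    using B(2) by (auto simp: localize_at_def)
  have pA: "prime_ideal A (p \<inter> A)" by (rule prime_contract[OF A B p])
  have 0: "0 \<in> p" by (rule ideal_0[OF prime_ideal_ideal[OF p]])
  show "localize_at B p \<subseteq> localize_at A (p \<inter> A)"
  proof
    fix w assume "w \<in> localize_at B p"
    then obtain a b where ab: "a \<in> B" "b \<in> B" "b \<notin> p" "w = a / b" by (rule localize_atE)
    obtain r s where rs: "r \<in> A" "s \<in> A" "s \<notin> p \<inter> A" "a = r / s"
      using subsetD[OF sub ab(1)] by (rule localize_atE)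
    obtain u t where ut: "u \<in> A" "t \<in> A" "t \<notin> p \<inter> A" "b = u / t"
      using subsetD[OF sub ab(2)] by (rule localize_atE)
    have nz: "s \<noteq> 0" "t \<noteq> 0" using rs ut 0 subring_0[OF A] by auto
    have "b * t \<notin> p" using prime_ideal_mult[OF p ab(2)] ab(3) ut B(2) by blast
    then have "u \<notin> p" using ut(4) nz by simp
    then have "s * u \<notin> p" using prime_ideal_mult[OF p] rs ut B(2) by blast
    then show "w \<in> localize_at A (p \<inter> A)"
      by (intro localize_atI[of "r * t" _ "s * u"])
         (use rs ut ab nz subring_mult[OF A] in auto)
  qed
qed

lemma ring_adjoin1I: "\<forall>k<n. c k \<in> A \<Longrightarrow> a = (\<Sum>k<n. c k * \<theta> ^ k) \<Longrightarrow> a \<in> ring_adjoin1 A \<theta>"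
  unfolding ring_adjoin1_def by blast

lemma power_in_ring_adjoin1:
  assumes "subring A" shows "\<theta> ^ k \<in> ring_adjoin1 A \<theta>"
  by (rule ring_adjoin1I[of "Suc k" "\<lambda>i. if i = k then 1 else 0"])
     (use subring_0[OF assms] subring_1[OF assms] in \<open>auto simp: if_distrib[of "\<lambda>c. c * _"] cong: if_cong\<close>)

section \<open>Shannon extensions\<close>

locale shannon_sequence =
  fixes Rs :: "nat \<Rightarrow> 'a::field set"
  assumes qf0: "has_quotient_field_F (Rs 0)"
    and reg: "\<And>i. regular_local (Rs i)"
    and dim: "\<And>i. krull_dim (Rs i) \<ge> 2"
    and lqt: "\<And>i. local_quadratic_transform (Rs i) (Rs (Suc i))"
    and strict: "\<And>i. Rs i \<subset> Rs (Suc i)"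
begin

abbreviation m where "m i \<equiv> max_ideal (Rs i)"
abbreviation v where "v i \<equiv> ordF (Rs i)"

lemma Rs_mono: "i \<le> j \<Longrightarrow> Rs i \<subseteq> Rs j"
  by (rule lift_Suc_mono_le[of Rs]) (use strict in auto)

lemma qf: "has_quotient_field_F (Rs i)"
  by (rule has_quotient_field_superset[OF qf0 Rs_mono]) simp

lemma nloc: "noetherian_local (Rs i) (m i)"
  by (rule regular_local_noetherian_local[OF reg])

lemma Rs: "subring (Rs i)"
  using nloc[of i] by (simp add: noetherian_local_def quasi_local_def)

lemma ideal_m: "ideal (Rs i) (m i)"
  using nloc[of i] by (simp add: noetherian_local_def quasi_local_def)

lemma transform: "\<exists>G z B q. quadratic_transform (Rs i) (m i) G z B q (Rs (Suc i))"
proof -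
  obtain G0 where "regular_system (Rs i) (m i) G0" using regular_local_regular_system[OF reg dim] by blast
  then interpret R0: regular_system "Rs i" "m i" G0 .
  obtain z q where z: "z \<in> m i" "z \<notin> ideal_pow (Rs i) (m i) 2"
    and q: "prime_ideal (ring_adjoin (Rs i) {a / z | a. a \<in> m i}) q" "m i \<subseteq> q"
      "Rs (Suc i) = localize_at (ring_adjoin (Rs i) {a / z | a. a \<in> m i}) q"
    using lqt[of i] unfolding local_quadratic_transform_def Let_def by blast
  obtain G where G: "regular_system (Rs i) (m i) G" "z \<in> G" using R0.exchange_parameter[OF z] by blast
  have "quadratic_transform (Rs i) (m i) G z (ring_adjoin (Rs i) {a / z | a. a \<in> m i}) q (Rs (Suc i))"
    unfolding quadratic_transform_def regular_quotient_def regular_quotient_axioms_def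
      quadratic_transform_axioms_def
    using G q qf by simp
  then show ?thesis by blast
qed

lemma ex_regular_quotient: "\<exists>G. regular_quotient (Rs i) (m i) G"
  using transform[of i] unfolding quadratic_transform_def by blast

lemma v_facts:
  shows v_divide: "p \<noteq> 0 \<Longrightarrow> r \<noteq> 0 \<Longrightarrow> v i (p / r) = v i p - v i r"
    and v_inverse: "p \<noteq> 0 \<Longrightarrow> v i (inverse p) = - v i p"
    and v_power: "p \<noteq> 0 \<Longrightarrow> v i (p ^ n) = int n * v i p"
    and v_uminus: "v i (- p) = v i p"
    and v_nonneg: "a \<in> Rs i \<Longrightarrow> v i a \<ge> 0"
    and v_pos: "a \<in> m i \<Longrightarrow> a \<noteq> 0 \<Longrightarrow> v i a > 0"
    and v_add: "v i p \<ge> 0 \<Longrightarrow> v i r \<ge> 0 \<Longrightarrow> v i (p + r) \<ge> 0"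
    and v_nonneg_mult: "v i p \<ge> 0 \<Longrightarrow> v i r \<ge> 0 \<Longrightarrow> v i (p * r) \<ge> 0"
    and v_subring: "subring {q. v i q \<ge> 0}"
    and v_elem: "a \<in> Rs i \<Longrightarrow> a \<noteq> 0 \<Longrightarrow> v i a = int (ordR (Rs i) a)"
    and cic: "d \<in> Rs i \<Longrightarrow> d \<noteq> 0 \<Longrightarrow> (\<And>n. d * \<theta> ^ n \<in> Rs i) \<Longrightarrow> \<theta> \<in> Rs i"
proof -
  obtain G where "regular_quotient (Rs i) (m i) G" using ex_regular_quotient by blast
  then interpret regular_quotient "Rs i" "m i" G .
  show "p \<noteq> 0 \<Longrightarrow> r \<noteq> 0 \<Longrightarrow> v i (p / r) = v i p - v i r" by (rule ordF_divide')
  show "p \<noteq> 0 \<Longrightarrow> v i (inverse p) = - v i p" by (rule ordF_inverse)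
  show "p \<noteq> 0 \<Longrightarrow> v i (p ^ n) = int n * v i p" by (rule ordF_power)
  show "v i (- p) = v i p" by (rule ordF_uminus)
  show "a \<in> Rs i \<Longrightarrow> v i a \<ge> 0" by (rule ordF_nonneg_A)
  show "a \<in> m i \<Longrightarrow> a \<noteq> 0 \<Longrightarrow> v i a > 0" by (rule ordF_pos_M)
  show "v i p \<ge> 0 \<Longrightarrow> v i r \<ge> 0 \<Longrightarrow> v i (p + r) \<ge> 0" by (rule ordF_nonneg_add)
  show "v i p \<ge> 0 \<Longrightarrow> v i r \<ge> 0 \<Longrightarrow> v i (p * r) \<ge> 0" by (rule ordF_nonneg_mult)
  show "subring {q. v i q \<ge> 0}" by (rule subring_ord)
  show "a \<in> Rs i \<Longrightarrow> a \<noteq> 0 \<Longrightarrow> v i a = int (ordR (Rs i) a)" by (rule ordF_elem)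
  show "d \<in> Rs i \<Longrightarrow> d \<noteq> 0 \<Longrightarrow> (\<And>n. d * \<theta> ^ n \<in> Rs i) \<Longrightarrow> \<theta> \<in> Rs i"
    by (rule completely_integrally_closed[OF qf])
qed

lemma m_Suc_iff:
  assumes "a \<in> Rs i" shows "a \<in> m (Suc i) \<longleftrightarrow> a \<in> m i"
proof -
  obtain G z B q where "quadratic_transform (Rs i) (m i) G z B q (Rs (Suc i))" using transform by blast
  then interpret quadratic_transform "Rs i" "m i" G z B q "Rs (Suc i)" .
  show ?thesis using A_MC_iff[OF assms] C.max_ideal_eq by simp
qed

lemma m_iff: "i \<le> j \<Longrightarrow> a \<in> Rs i \<Longrightarrow> a \<in> m j \<longleftrightarrow> a \<in> m i"
proof (induction j rule: dec_induct)
  case (step j)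
  have "a \<in> Rs j" using Rs_mono[OF step(1)] step.prems by blast
  then show ?case using m_Suc_iff step by blast
qed simp

lemma m_sub: "a \<in> m i \<Longrightarrow> a \<in> Rs i"
  by (rule ideal_subset[OF ideal_m])

lemma m_mono: "i \<le> j \<Longrightarrow> m i \<subseteq> m j"
  using m_iff m_sub by blast

text \<open>The element \<open>z\<close> generates the extension of \<open>m i\<close> to
  \<open>Rs (Suc i)\<close>. Together with \<open>m_Suc_iff\<close> and \<open>localize_Suc\<close>
  this carries what later arguments use about the passage from one ring to the next.\<close>

lemma exceptional:
  "\<exists>z\<in>m i. z \<noteq> 0 \<and> (\<forall>a\<in>m i. a / z \<in> Rs (Suc i)) \<and>
    (\<forall>c\<in>Rs (Suc i). v i c \<ge> 0 \<and> (v i c > 0 \<longrightarrow> c / z \<in> Rs (Suc i))) \<and>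
    (\<forall>f\<in>Rs i. f \<noteq> 0 \<longrightarrow> (\<forall>n\<le>ordR (Rs i) f. f / z ^ n \<in> Rs (Suc i)) \<and>
      ordR (Rs (Suc i)) (f / z ^ ordR (Rs i) f) \<le> ordR (Rs i) f)"
proof -
  obtain G z B q where "quadratic_transform (Rs i) (m i) G z B q (Rs (Suc i))" using transform by blast
  then interpret quadratic_transform "Rs i" "m i" G z B q "Rs (Suc i)" .
  obtain G' where "regular_quotient (Rs (Suc i)) (m (Suc i)) G'" using ex_regular_quotient by blast
  then interpret R': regular_quotient "Rs (Suc i)" "m (Suc i)" G' .
  have "f / z ^ n \<in> Rs (Suc i)" if "f \<in> Rs i" "f \<noteq> 0" "n \<le> ordR (Rs i) f" for f n
    using M_pow_divide ord_iff[OF that(1,2)] that(3) by blast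
  moreover have "ordR (Rs (Suc i)) (f / z ^ ordR (Rs i) f) \<le> ordR (Rs i) f"
    if f: "f \<in> Rs i" "f \<noteq> 0" for f
  proof -
    let ?n = "ordR (Rs i) f" and ?g = "f / z ^ ordR (Rs i) f"
    have "f \<in> ideal_pow (Rs i) (m i) ?n" "f \<notin> ideal_pow (Rs i) (m i) (Suc ?n)"
      unfolding ord_iff[OF f] by auto
    then have "?g \<notin> ideal_pow (Rs (Suc i)) (m (Suc i)) (Suc ?n)"
      using order_transform_le C.max_ideal_eq by simp
    moreover have "?g \<in> Rs (Suc i)" "?g \<noteq> 0" using calculation(1) z0 f
      by (auto intro: M_pow_divide simp: ord_iff[OF f])
    ultimately have "\<not> Suc ?n \<le> ordR (Rs (Suc i)) ?g" using R'.ord_iff by blast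
    then show ?thesis by simp
  qed
  ultimately show ?thesis
    using zM z0 M_divide ord_C by (intro bexI[of _ z] conjI ballI impI allI) auto
qed

lemma localize_Suc:
  assumes "prime_ideal (Rs (Suc i)) P" "\<not> m i \<subseteq> P"
  shows "Rs (Suc i) \<subseteq> localize_at (Rs i) (P \<inter> Rs i)"
proof -
  obtain G z B q where "quadratic_transform (Rs i) (m i) G z B q (Rs (Suc i))" using transform by blast
  then interpret quadratic_transform "Rs i" "m i" G z B q "Rs (Suc i)" .
  show ?thesis by (rule C_subset_localize[OF assms])
qed

text \<open>The maximal ideals increase along the sequence, so a prime not containing
  \<open>m i\<close> contains none of the later ones, and every transform from stage
  \<open>i\<close> to stage \<open>j\<close> is an isomorphism there.\<close>

lemma localize_eq:
  "i \<le> j \<Longrightarrow> prime_ideal (Rs j) p \<Longrightarrow> \<not> m i \<subseteq> p \<Longrightarrow> localize_at (Rs j) p = localize_at (Rs i) (p \<inter> Rs i)"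
proof (induction j arbitrary: p rule: dec_induct)
  case base
  have "p \<inter> Rs i = p" using ideal_subset[OF prime_ideal_ideal[OF base(1)]] by blast
  then show ?case by simp
next
  case (step j)
  have sub: "Rs j \<subseteq> Rs (Suc j)" by (rule Rs_mono) simp
  have "\<not> m j \<subseteq> p" using step.prems(2) m_mono[OF step(1)] by blast
  then have "localize_at (Rs (Suc j)) p = localize_at (Rs j) (p \<inter> Rs j)"
    by (intro localize_at_intermediate[OF Rs Rs sub] localize_Suc step.prems)
  also have "\<dots> = localize_at (Rs i) (p \<inter> Rs j \<inter> Rs i)"
  proof (rule step.IH)
    show "prime_ideal (Rs j) (p \<inter> Rs j)" by (rule prime_contract[OF Rs Rs sub step.prems(1)])
    show "\<not> m i \<subseteq> p \<inter> Rs j" using step.prems(2) by blast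
  qed
  also have "p \<inter> Rs j \<inter> Rs i = p \<inter> Rs i" using Rs_mono[OF step(1)] by blast
  finally show ?case .
qed

section \<open>The union \<open>S\<close> and discrete valuation rings dominating it\<close>

definition S where "S = (\<Union>i. Rs i)"
definition N where "N = (\<Union>i. m i)"
abbreviation V where "V \<equiv> boundary_valuation_ring Rs"

lemma S_I: "a \<in> Rs i \<Longrightarrow> a \<in> S"
  by (auto simp: S_def)

lemma S_common: "a \<in> S \<Longrightarrow> b \<in> S \<Longrightarrow> \<exists>i. a \<in> Rs i \<and> b \<in> Rs i"
proof -
  assume "a \<in> S" "b \<in> S"
  then obtain i j where "a \<in> Rs i" "b \<in> Rs j" by (auto simp: S_def)
  then show ?thesis using Rs_mono[of i "max i j"] Rs_mono[of j "max i j"] by auto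
qed

lemma N_m: "a \<in> N \<Longrightarrow> a \<in> Rs i \<Longrightarrow> a \<in> m i"
proof -
  assume "a \<in> N" and a: "a \<in> Rs i"
  then obtain j where "a \<in> m j" by (auto simp: N_def)
  then have "a \<in> m (max i j)" using m_mono[of j "max i j"] by auto
  then show ?thesis using m_iff[of i "max i j"] a by simp
qed

lemma N_I: "a \<in> m i \<Longrightarrow> a \<in> N"
  by (auto simp: N_def)

sublocale S: quasi_local S N
proof
  show "subring S"
    unfolding subring_def
  proof (intro conjI ballI)
    show "0 \<in> S" "1 \<in> S" by (rule S_I[OF subring_0[OF Rs]], rule S_I[OF subring_1[OF Rs]])
    fix a b assume ab: "a \<in> S" "b \<in> S"
    obtain i where i: "a \<in> Rs i" "b \<in> Rs i" using S_common[OF ab] by blast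
    show "a + b \<in> S" by (rule S_I[OF subring_add[OF Rs i]])
    show "a * b \<in> S" by (rule S_I[OF subring_mult[OF Rs i]])
    show "- a \<in> S" by (rule S_I[OF subring_uminus[OF Rs i(1)]])
  qed
  have NS: "a \<in> S" if "a \<in> N" for a using that S_I[OF m_sub] by (auto simp: N_def)
  show "ideal S N"
    unfolding ideal_def
  proof (intro conjI ballI)
    show "N \<subseteq> S" using NS by blast
    show "0 \<in> N" by (rule N_I[OF ideal_0[OF ideal_m]])
    show "a + b \<in> N" if ab: "a \<in> N" "b \<in> N" for a b
    proof -
      obtain i where i: "a \<in> Rs i" "b \<in> Rs i" using S_common[OF NS[OF ab(1)] NS[OF ab(2)]] by blast
      show ?thesis
        by (rule N_I[of _ i], rule ideal_add[OF ideal_m N_m[OF ab(1) i(1)] N_m[OF ab(2) i(2)]])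
    qed
    show "r * a \<in> N" if ra: "a \<in> N" "r \<in> S" for a r
    proof -
      obtain i where i: "a \<in> Rs i" "r \<in> Rs i" using S_common[OF NS[OF ra(1)] ra(2)] by blast
      show ?thesis by (rule N_I[of _ i], rule ideal_mult[OF ideal_m N_m[OF ra(1) i(1)] i(2)])
    qed
  qed
  show "1 \<notin> N"
  proof
    assume "1 \<in> N"
    then have "1 \<in> m 0" by (rule N_m) (rule subring_1[OF Rs])
    then show False using nloc[of 0] by (simp add: noetherian_local_def quasi_local_def)
  qed
  fix a assume a: "a \<in> S" "a \<notin> N"
  then obtain i where "a \<in> Rs i" "a \<notin> m i" using N_I by (auto simp: S_def)
  then have "inverse a \<in> Rs i" using nloc[of i] by (simp add: noetherian_local_def quasi_local_def)
  then show "inverse a \<in> S" by (rule S_I)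
qed

lemma N_inverse: "a \<in> N \<Longrightarrow> a \<noteq> 0 \<Longrightarrow> inverse a \<notin> S"
  using ideal_mult[OF S.ideal_M, of a "inverse a"] S.one_notin by auto

lemma S_frac: "\<exists>a\<in>Rs 0. \<exists>b\<in>Rs 0. b \<noteq> 0 \<and> f = a / b"
  using qf0 unfolding has_quotient_field_F_def by blast

text \<open>For f in W outside S take i and b in R_i with b*f in R_i and bW maximal; dividing b by the next
  exceptional parameter enlarges bW.\<close>
lemma dominating_DVR_subset:
  assumes W: "DVR W" and SW: "S \<subseteq> W" and NW: "N \<subseteq> nonunits W"
  shows "W \<subseteq> S"
proof (rule ccontr)
  interpret W: noetherian_local W "nonunits W" by (rule DVR_noetherian_local[OF W])
  assume "\<not> W \<subseteq> S"
  then obtain f where f: "f \<in> W" "f \<notin> S" by blast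
  let ?Q = "\<lambda>X. \<exists>i. \<exists>b\<in>Rs i. b \<noteq> 0 \<and> b * f \<in> Rs i \<and> X = principal W b"
  obtain a b where ab: "a \<in> Rs 0" "b \<in> Rs 0" "b \<noteq> 0" "f = a / b" using S_frac by blast
  then have "?Q (principal W b)" by (intro exI[of _ 0] bexI[of _ b]) auto
  then obtain X where X: "?Q X" and mx: "\<And>L. ?Q L \<Longrightarrow> X \<subseteq> L \<Longrightarrow> L = X"
  proof (rule noetherian_maximal_pred[OF W.noeth, of ?Q])
    fix X assume "?Q X"
    then show "ideal W X" using ideal_principal[OF W.A] SW S_I by blast
  qed (rule that)
  obtain i b where b: "b \<in> Rs i" "b \<noteq> 0" "b * f \<in> Rs i" "X = principal W b" using X by blast
  have unit: "inverse u \<in> S" if "u \<in> Rs i" "u \<notin> m i" for u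
    using S.inverse_in[OF S_I[OF that(1)]] N_m that by blast
  have bm: "b \<in> m i"
  proof (rule ccontr)
    assume "b \<notin> m i"
    then have "inverse b * (b * f) \<in> S" by (rule subring_mult[OF S.A unit[OF b(1)] S_I[OF b(3)]])
    moreover have "inverse b * (b * f) = f" using b(2) by simp
    ultimately show False using f(2) by metis
  qed
  \<comment> \<open>A multiple of the nonunit \<open>b\<close> is a nonunit of \<open>W\<close>,
    whereas units of \<open>Rs i\<close> are units of \<open>W\<close>.\<close>
  have fm: "b * f \<in> m i"
  proof (rule ccontr)
    assume n: "b * f \<notin> m i"
    then have "inverse (b * f) \<in> W" "b * f \<noteq> 0"
      using unit[OF b(3)] SW ideal_0[OF ideal_m] by auto
    moreover have "b * f \<in> nonunits W"
      by (rule ideal_mult'[OF W.ideal_M _ f(1)]) (use NW N_I[OF bm] in blast)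
    ultimately show False by (simp add: nonunits_def)
  qed
  obtain z where z: "z \<in> m i" "z \<noteq> 0" "\<forall>a\<in>m i. a / z \<in> Rs (Suc i)" using exceptional[of i] by blast
  have bz: "b / z \<in> Rs (Suc i)" "b / z \<noteq> 0" "(b / z) * f \<in> Rs (Suc i)"
    using z bm fm b(2) by (auto simp flip: times_divide_eq_left)
  have zW: "z \<in> nonunits W" using NW N_I[OF z(1)] by blast
  have "principal W (b / z) = X"
  proof (rule mx)
    show "?Q (principal W (b / z))" using bz by blast
    have "b * w = b / z * (z * w)" for w using z(2) by simp
    then show "X \<subseteq> principal W (b / z)"
      unfolding b(4) principal_def using subring_mult[OF W.A W.M_sub[OF zW]] by blast
  qed
  moreover have "b / z \<in> principal W (b / z)" using subring_1[OF W.A] by (auto simp: principal_def)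
  ultimately obtain w where w: "w \<in> W" "b / z = b * w" unfolding b(4) principal_def by blast
  \<comment> \<open>Maximality gives \<open>bW = (b / z)W\<close>, which would make \<open>z\<close>
    a unit of \<open>W\<close>.\<close>
  have "inverse z = w" using w(2) b(2) z(2) by (simp add: field_simps)
  then show False using w(1) zW z(2) by (simp add: nonunits_def)
qed

section \<open>The boundary valuation ring\<close>

lemma V_I: "(\<And>j. j \<ge> i \<Longrightarrow> v j f \<ge> 0) \<Longrightarrow> f \<in> V"
  by (auto simp: boundary_valuation_ring_def eventually_sequentially)

lemma V_E:
  assumes "f \<in> V" obtains i where "\<forall>j\<ge>i. v j f \<ge> 0"
  using assms unfolding boundary_valuation_ring_def eventually_sequentially by blast

lemma S_V: "S \<subseteq> V"
proof
  fix a assume "a \<in> S"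
  then obtain i where "a \<in> Rs i" by (auto simp: S_def)
  then show "a \<in> V" using Rs_mono v_nonneg by (intro V_I[of i]) blast
qed

lemma N_inverse_V:
  assumes "a \<in> N" "a \<noteq> 0" shows "inverse a \<notin> V"
proof
  assume "inverse a \<in> V"
  then obtain i where i: "\<forall>j\<ge>i. v j (inverse a) \<ge> 0" by (rule V_E)
  obtain k where k: "a \<in> m k" using assms(1) by (auto simp: N_def)
  have "a \<in> m (max i k)" using m_mono[of k "max i k"] k by auto
  then have "v (max i k) a > 0" using v_pos assms(2) by blast
  then show False using i[rule_format, of "max i k"] v_inverse[OF assms(2)] by simp
qed

lemma subring_V: "subring V"
  unfolding subring_def
proof (intro conjI ballI)
  show "0 \<in> V" "1 \<in> V" using S_V subring_0[OF S.A] subring_1[OF S.A] by auto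
  fix p r assume "p \<in> V" "r \<in> V"
  then obtain i k where ik: "\<forall>j\<ge>i. v j p \<ge> 0" "\<forall>j\<ge>k. v j r \<ge> 0"
    by (meson V_E)
  show "p + r \<in> V" by (rule V_I[of "max i k"]) (use ik v_add in auto)
  show "p * r \<in> V" by (rule V_I[of "max i k"]) (use ik v_nonneg_mult in auto)
  show "- p \<in> V" by (rule V_I[of i]) (use ik v_uminus in auto)
qed

text \<open>Among all representations f = a/b over all R_i, one with the least minimum of the orders of a and b
  is stable under transforms, since orders of transforms do not increase.\<close>
lemma V_dichotomy:
  assumes f: "f \<noteq> 0" shows "f \<in> V \<or> inverse f \<in> V"
proof -
  define rep where "rep f \<mu> \<longleftrightarrow> (\<exists>i. \<exists>a\<in>Rs i. \<exists>b\<in>Rs i. a \<noteq> 0 \<and> b \<noteq> 0 \<and> f = a / b \<and>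
    \<mu> = min (ordR (Rs i) a) (ordR (Rs i) b))" for f \<mu>
  have repI: "rep f (min (ordR (Rs i) a) (ordR (Rs i) b))"
    if "a \<in> Rs i" "b \<in> Rs i" "a \<noteq> 0" "b \<noteq> 0" "f = a / b" for f a b i
    unfolding rep_def using that by (intro exI[of _ i] bexI[of _ a] bexI[of _ b] conjI) auto
  obtain a0 b0 where 0: "a0 \<in> Rs 0" "b0 \<in> Rs 0" "b0 \<noteq> 0" "f = a0 / b0" using S_frac by blast
  then have "a0 \<noteq> 0" using f by auto
  from repI[OF 0(1,2) this 0(3,4)] obtain \<mu> where mu: "rep f \<mu>" "\<And>k. k < \<mu> \<Longrightarrow> \<not> rep f k"
    using exists_least_iff[of "rep f"] by auto
  obtain i a b where ab: "a \<in> Rs i" "b \<in> Rs i" "a \<noteq> 0" "b \<noteq> 0" "f = a / b"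
    "\<mu> = min (ordR (Rs i) a) (ordR (Rs i) b)"
    using mu(1) unfolding rep_def by (elim exE bexE conjE)
  have stable: "v j g \<le> 0"
    if least: "\<And>k. k < \<mu> \<Longrightarrow> \<not> rep g k" and ab: "a \<in> Rs i" "b \<in> Rs i" "a \<noteq> 0" "b \<noteq> 0" "g = a / b"
      "ordR (Rs i) a = \<mu>" "\<mu> \<le> ordR (Rs i) b" and j: "j \<ge> i" for g a b i j
  proof -
    have "\<exists>a\<in>Rs j. \<exists>b\<in>Rs j. a \<noteq> 0 \<and> b \<noteq> 0 \<and> g = a / b \<and> ordR (Rs j) a = \<mu> \<and> \<mu> \<le> ordR (Rs j) b"
      using j
    proof (induction j rule: dec_induct)
      case base
      show ?case by (rule bexI[OF _ ab(1)], rule bexI[OF _ ab(2)]) (use ab in simp)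
    next
      case (step j)
      from step.IH obtain a b where s: "a \<in> Rs j" "b \<in> Rs j" "a \<noteq> 0" "b \<noteq> 0" "g = a / b"
        "ordR (Rs j) a = \<mu>" "\<mu> \<le> ordR (Rs j) b" by (elim bexE conjE)
      obtain z where z: "z \<noteq> 0"
        "\<forall>f\<in>Rs j. f \<noteq> 0 \<longrightarrow> (\<forall>n\<le>ordR (Rs j) f. f / z ^ n \<in> Rs (Suc j)) \<and>
          ordR (Rs (Suc j)) (f / z ^ ordR (Rs j) f) \<le> ordR (Rs j) f"
        using exceptional[of j] by (elim bexE conjE)
      let ?a = "a / z ^ \<mu>" and ?b = "b / z ^ \<mu>"
      have le: "ordR (Rs (Suc j)) ?a \<le> \<mu>" and a': "?a \<in> Rs (Suc j)"
        using z(2)[rule_format, OF s(1,3)] s(6) by auto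
      have b': "?b \<in> Rs (Suc j)" using z(2)[rule_format, OF s(2,4)] s(7) by auto
      have nz: "?a \<noteq> 0" "?b \<noteq> 0" "g = ?a / ?b" using s z(1) by auto
      \<comment> \<open>The order of \<open>?a\<close> does not exceed \<open>\<mu>\<close> by the
        comparison of orders, and minimality of \<open>\<mu>\<close> excludes smaller values on
        either side, so both conditions persist.\<close>
      have "\<not> min (ordR (Rs (Suc j)) ?a) (ordR (Rs (Suc j)) ?b) < \<mu>"
        using least repI[OF a' b' nz] by blast
      then have "ordR (Rs (Suc j)) ?a = \<mu>" "\<mu> \<le> ordR (Rs (Suc j)) ?b" using le by auto
      then show ?case using nz by (intro bexI[OF _ a'] bexI[OF _ b'] conjI)
    qed
    then obtain a b where s: "a \<in> Rs j" "b \<in> Rs j" "a \<noteq> 0" "b \<noteq> 0" "g = a / b" "ordR (Rs j) a = \<mu>"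
      "\<mu> \<le> ordR (Rs j) b" by (elim bexE conjE)
    have "v j g = int (ordR (Rs j) a) - int (ordR (Rs j) b)"
      unfolding s(5) using v_divide[OF s(3,4), of j] v_elem[OF s(1,3)] v_elem[OF s(2,4)] by simp
    then show ?thesis using s(6,7) by simp
  qed
  show ?thesis
  proof (cases "ordR (Rs i) a \<le> ordR (Rs i) b")
    case True
    then have o: "ordR (Rs i) a = \<mu>" "\<mu> \<le> ordR (Rs i) b" using ab(6) by auto
    have "v j f \<le> 0" if "j \<ge> i" for j by (rule stable[OF mu(2) ab(1-5) o that])
    then have "inverse f \<in> V" using v_inverse[OF f] by (intro V_I[of i]) auto
    then show ?thesis by simp
  next
    case False
    then have o: "ordR (Rs i) b = \<mu>" "\<mu> \<le> ordR (Rs i) a" using ab(6) by auto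
    have "\<not> rep (inverse f) k" if k: "k < \<mu>" for k
    proof
      assume "rep (inverse f) k"
      then obtain i a b where r: "a \<in> Rs i" "b \<in> Rs i" "a \<noteq> 0" "b \<noteq> 0" "inverse f = a / b"
        "k = min (ordR (Rs i) a) (ordR (Rs i) b)" unfolding rep_def by (elim exE bexE conjE)
      have "f = b / a" using r(5) by (metis inverse_divide inverse_inverse_eq)
      from repI[OF r(2,1,4,3) this] have "rep f k" using r(6) by (simp add: min.commute)
      then show False using mu(2)[OF k] by simp
    qed
    moreover have "inverse f = b / a" using ab(5) by simp
    ultimately have "v j (inverse f) \<le> 0" if "j \<ge> i" for j
      using stable[OF _ ab(2,1,4,3) _ o that, of "inverse f"] by blast
    then have "f \<in> V" using v_inverse[OF f] by (intro V_I[of i]) auto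
    then show ?thesis by simp
  qed
qed

lemma valuation_ring_V: "valuation_ring V"
  using subring_V V_dichotomy by (simp add: valuation_ring_def)

text \<open>The contractions of the \<open>p j\<close> to \<open>Rs i\<close> contain
  \<open>b\<close> and localize to discrete valuation rings, so they are finite in number and one
  recurs for arbitrarily large \<open>j\<close>. Its localization is the same ring each time and
  contains those \<open>Rs j\<close>.\<close>

lemma persistent_localization:
  assumes b: "b \<in> Rs i" "b \<noteq> 0"
    and p: "\<And>j. j \<ge> i \<Longrightarrow> prime_ideal (Rs j) (p j)" "\<And>j. j \<ge> i \<Longrightarrow> \<not> m i \<subseteq> p j"
      "\<And>j. j \<ge> i \<Longrightarrow> DVR (localize_at (Rs j) (p j))" "\<And>j. j \<ge> i \<Longrightarrow> b \<in> p j"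
  shows "\<exists>j\<ge>i. S \<subseteq> localize_at (Rs j) (p j)"
proof -
  let ?F = "{P. prime_ideal (Rs i) P \<and> b \<in> P \<and> DVR (localize_at (Rs i) P)}"
  have n: "noetherian (Rs i)"
    using nloc[of i] by (simp add: noetherian_local_def noetherian_local_axioms_def)
  have eq: "localize_at (Rs j) (p j) = localize_at (Rs i) (p j \<inter> Rs i)" if "j \<ge> i" for j
    by (rule localize_eq[OF that p(1)[OF that] p(2)[OF that]])
  have "p j \<inter> Rs i \<in> ?F" if j: "j \<ge> i" for j
    using prime_contract[OF Rs Rs Rs_mono[OF j] p(1)[OF j]] p(3,4)[OF j] eq[OF j] b(1) by auto
  then have "finite ((\<lambda>j. p j \<inter> Rs i) ` {i..})"
    by (intro finite_subset[OF _ finite_DVR_localizations[OF n b]]) auto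
  then obtain j0 where j0: "j0 \<in> {i..}" "infinite {j \<in> {i..}. p j \<inter> Rs i = p j0 \<inter> Rs i}"
    using pigeonhole_infinite[of "{i..}" "\<lambda>j. p j \<inter> Rs i"] infinite_Ici[of i] by blast
  have "S \<subseteq> localize_at (Rs j0) (p j0)"
  proof
    fix a assume "a \<in> S"
    then obtain k where k: "a \<in> Rs k" by (auto simp: S_def)
    obtain j where j: "j \<ge> k" "j \<ge> i" "p j \<inter> Rs i = p j0 \<inter> Rs i"
      using j0(2) unfolding infinite_nat_iff_unbounded_le by blast
    have "a \<in> Rs j" using k Rs_mono[OF j(1)] by blast
    then have "a \<in> localize_at (Rs j) (p j)" using localize_at_superset[OF Rs p(1)[OF j(2)]] by blast
    then show "a \<in> localize_at (Rs j0) (p j0)" using eq[OF j(2)] eq[of j0] j0(1) j(3) by simp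
  qed
  then show ?thesis using j0(1) by auto
qed

lemma exists_prime_DVR:
  assumes "y \<in> Rs j" "\<And>k. y ^ k * f \<notin> Rs j"
  shows "\<exists>p. prime_ideal (Rs j) p \<and> y \<notin> p \<and> DVR (localize_at (Rs j) p) \<and> f \<notin> localize_at (Rs j) p"
proof (rule exists_localization_DVR[OF _ qf cic assms])
  show "noetherian (Rs j)"
    using nloc[of j] by (simp add: noetherian_local_def noetherian_local_axioms_def)
qed

text \<open>A proper overring of a discrete valuation ring is the whole field, whereas
  \<open>Rs (Suc i)\<close> has a nonzero nonunit.\<close>

lemma not_DVR: "\<not> DVR (Rs i)"
proof
  assume D: "DVR (Rs i)"
  have "Rs (Suc i) = UNIV"
    using strict[of i] by (intro DVR_overring[OF D Rs]) auto
  obtain z where z: "z \<in> m (Suc i)" "z \<noteq> 0" using exceptional[of "Suc i"] by blast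
  then have "inverse z * z \<in> m (Suc i)"
    using \<open>Rs (Suc i) = UNIV\<close> by (intro ideal_mult[OF ideal_m]) auto
  then show False using z nloc[of "Suc i"] by (simp add: noetherian_local_def quasi_local_def)
qed

lemma localize_at_m: "localize_at (Rs i) (m i) = Rs i"
proof
  show "localize_at (Rs i) (m i) \<subseteq> Rs i"
  proof
    fix w assume "w \<in> localize_at (Rs i) (m i)"
    then obtain a b where ab: "a \<in> Rs i" "b \<in> Rs i" "b \<notin> m i" "w = a / b" by (rule localize_atE)
    have "inverse b \<in> Rs i" using nloc[of i] ab by (simp add: noetherian_local_def quasi_local_def)
    then show "w \<in> Rs i" using subring_mult[OF Rs ab(1)] ab(4) by (simp add: divide_inverse)
  qed
  show "Rs i \<subseteq> localize_at (Rs i) (m i)"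
    using nloc[of i] by (intro localize_at_superset[OF Rs] quasi_local.prime_M) (simp add: noetherian_local_def)
qed

text \<open>A discrete valuation ring that is a localization of R_j and is centered on the maximal ideal of an
  earlier R_i is the order valuation ring of some R_h with h between i and j.\<close>
lemma contract_not_maximal:
  assumes j: "i \<le> j" and p: "prime_ideal (Rs j) p" "DVR (localize_at (Rs j) p)"
    and f: "f \<notin> localize_at (Rs j) p" "\<And>h. i \<le> h \<Longrightarrow> v h f \<ge> 0"
  shows "\<not> m i \<subseteq> p"
proof
  assume mp: "m i \<subseteq> p"
  have pm: "p \<subseteq> m j"
    using nloc[of j] by (intro quasi_local.prime_subset_M[OF _ p(1)]) (simp add: noetherian_local_def)
  \<comment> \<open>The last stage up to \<open>j\<close> whose maximal ideal is contained in
    \<open>p\<close>; from \<open>Suc h\<close> on the localization no longer changes.\<close>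
  let ?H = "{h. i \<le> h \<and> h \<le> j \<and> m h \<subseteq> p}"
  define h where "h = Max ?H"
  have fin: "finite ?H" by (rule finite_subset[of _ "{..j}"]) auto
  have "h \<in> ?H" unfolding h_def using fin j mp by (intro Max_in) auto
  then have h: "i \<le> h" "h \<le> j" "m h \<subseteq> p" by auto
  have "h \<noteq> j"
  proof
    assume "h = j"
    then have "p = m j" using h(3) pm by auto
    then show False using p(2) localize_at_m not_DVR by simp
  qed
  then have hj: "Suc h \<le> j" using h(2) by simp
  have "\<not> m (Suc h) \<subseteq> p"
  proof
    assume "m (Suc h) \<subseteq> p"
    then have "Suc h \<in> ?H" using hj h(1) by simp
    then have "Suc h \<le> h" unfolding h_def using fin by (intro Max_ge)
    then show False by simp
  qed
  then have eq: "localize_at (Rs j) p = localize_at (Rs (Suc h)) (p \<inter> Rs (Suc h))"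
    by (rule localize_eq[OF hj p(1)])
  obtain z where z: "z \<in> m h" "z \<noteq> 0"
    "\<forall>c\<in>Rs (Suc h). v h c \<ge> 0 \<and> (v h c > 0 \<longrightarrow> c / z \<in> Rs (Suc h))" using exceptional[of h] by blast
  have "localize_at (Rs j) p \<subseteq> {q. v h q \<ge> 0}"
  proof
    fix w assume "w \<in> localize_at (Rs j) p"
    then have "w \<in> localize_at (Rs (Suc h)) (p \<inter> Rs (Suc h))" unfolding eq .
    then obtain r s where "r \<in> Rs (Suc h)" "s \<in> Rs (Suc h)" "s \<notin> p \<inter> Rs (Suc h)" "w = r / s"
      by (rule localize_atE)
    then have rs: "r \<in> Rs (Suc h)" "s \<in> Rs (Suc h)" "s \<notin> p" "w = r / s" by auto
    have s0: "s \<noteq> 0" using rs(3) ideal_0[OF prime_ideal_ideal[OF p(1)]] by auto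
    \<comment> \<open>Positive order at stage \<open>h\<close> means divisibility by
      \<open>z\<close> in \<open>Rs (Suc h)\<close>, hence membership in \<open>p\<close>.\<close>
    have "\<not> v h s > 0"
    proof
      assume "v h s > 0"
      then have "s / z \<in> Rs j" using z(3) rs(2) Rs_mono[OF hj] by blast
      then have "(s / z) * z \<in> p" using ideal_mult[OF prime_ideal_ideal[OF p(1)]] z(1) h(3) by blast
      then show False using rs(3) z(2) by simp
    qed
    then have "v h s = 0" using z(3) rs(2) by force
    then have "v h w \<ge> 0" if "r \<noteq> 0" using v_divide[OF that s0, of h] z(3) rs by auto
    then show "w \<in> {q. v h q \<ge> 0}" using rs(4) by (cases "r = 0") (auto simp: ordF_def)
  qed
  moreover have "{q. v h q \<ge> 0} \<noteq> UNIV"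
  proof
    assume "{q. v h q \<ge> 0} = UNIV"
    then have "v h (inverse z) \<ge> 0" by blast
    then show False using v_inverse[OF z(2), of h] v_pos[OF z(1,2)] by simp
  qed
  ultimately have "{q. v h q \<ge> 0} = localize_at (Rs j) p"
    using DVR_overring[OF p(2) v_subring, of h] by blast
  then show False using f(1) f(2)[OF h(1)] by blast
qed

end

section \<open>An element generating an \<open>N\<close>-primary ideal\<close>

locale shannon_primary = shannon_sequence +
  fixes x :: 'a
  assumes xS: "x \<in> S" and primary: "radical S (principal S x) = N"
begin

lemma xN: "x \<in> N"
proof -
  have "x ^ 1 \<in> principal S x" using subring_1[OF S.A] by (auto simp: principal_def)
  then have "x \<in> radical S (principal S x)" using xS unfolding radical_def by blast
  then show ?thesis using primary by simp
qed

text \<open>If \<open>x\<close> were zero, so would be the radical of its ideal, although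
  \<open>N\<close> contains the nonzero \<open>z\<close>. Exponent zero is impossible because
  \<open>x\<close> is a nonunit.\<close>

lemma N_power: "a \<in> N \<Longrightarrow> \<exists>k>0. a ^ k / x \<in> S \<and> x \<noteq> 0"
proof -
  obtain z where z: "z \<in> m 0" "z \<noteq> 0" using exceptional[of 0] by blast
  have x0: "x \<noteq> 0"
  proof
    assume "x = 0"
    then have "principal S x = {0}" using subring_0[OF S.A] by (auto simp: principal_def)
    then have "N \<subseteq> {0}" using primary unfolding radical_def by auto
    then show False using N_I[OF z(1)] z(2) by blast
  qed
  assume "a \<in> N"
  then have "\<exists>n. a ^ n \<in> principal S x" using primary unfolding radical_def by blast
  then obtain n s where ns: "s \<in> S" "a ^ n = x * s" unfolding principal_def by blast
  have "n > 0"
  proof (rule ccontr)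
    assume "\<not> n > 0"
    then have "x * s = 1" using ns(2) by simp
    then show False using ideal_mult'[OF S.ideal_M xN ns(1)] S.one_notin by simp
  qed
  then show ?thesis using ns x0 by (intro exI[of _ n]) simp
qed

lemma x0: "x \<noteq> 0"
  using N_power[OF xN] by blast

lemma x_pow_S: "x ^ n \<in> S"
  by (rule subring_power[OF S.A xS])

text \<open>Each element of \<open>N\<close> has a power in \<open>xS\<close>, so \<open>W\<close>
  dominates \<open>S\<close> as soon as \<open>x\<close> is a nonunit of \<open>W\<close>.\<close>

lemma N_nonunits:
  assumes W: "valuation_ring W" "S \<subseteq> W" and xW: "x \<in> nonunits W"
  shows "N \<subseteq> nonunits W"
proof
  interpret W: quasi_local W "nonunits W" by (rule valuation_ring_quasi_local[OF W(1)])
  fix a assume a: "a \<in> N"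
  then obtain k where k: "a ^ k / x \<in> S" using N_power by blast
  have "a ^ k / x * x \<in> nonunits W" using k W(2) by (intro ideal_mult[OF W.ideal_M xW]) auto
  then have "a ^ k \<in> nonunits W" using x0 by simp
  moreover have "a \<in> W" using ideal_subset[OF S.ideal_M a] W(2) by blast
  ultimately show "a \<in> nonunits W" using prime_ideal_power[OF W.A W.prime_M] by blast
qed

section \<open>The ring \<open>S[1/x]\<close>, the hull \<open>T\<close> and the boundary valuation
  ring\<close>

definition Sx where "Sx = {s / x ^ k | s k. s \<in> S}"

lemma Sx_I: "s \<in> S \<Longrightarrow> s / x ^ k \<in> Sx"
  by (auto simp: Sx_def)

abbreviation T where "T \<equiv> noetherian_hull S"

lemma DVR_over_inverse_x:
  assumes W: "DVR W" "S \<subset> W" shows "inverse x \<in> W"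
proof (rule ccontr)
  assume n: "inverse x \<notin> W"
  have V: "valuation_ring W" using W(1) by (simp add: DVR_def)
  have "x \<in> nonunits W" using n xS W(2) by (auto simp: nonunits_def)
  then have "N \<subseteq> nonunits W" using N_nonunits[OF V] W(2) by blast
  then have "W \<subseteq> S" using dominating_DVR_subset[OF W(1)] W(2) by blast
  then show False using W(2) by blast
qed

lemma Sx_T: "Sx \<subseteq> T"
proof
  fix f assume "f \<in> Sx"
  then obtain s k where f: "s \<in> S" "f = s / x ^ k" by (auto simp: Sx_def)
  have "f \<in> W" if W: "DVR W" "S \<subset> W" for W
  proof -
    have "s * inverse x ^ k \<in> W"
      using f(1) W(2) DVR_over_inverse_x[OF W] DVR_subring[OF W(1)]
      by (intro subring_mult subring_power) auto
    then show ?thesis using f(2) by (simp add: divide_inverse power_inverse)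
  qed
  then show "f \<in> T" by (auto simp: noetherian_hull_def)
qed

lemma subring_T: "subring T"
  unfolding noetherian_hull_def using DVR_subring unfolding subring_def by blast

lemma S_T: "S \<subseteq> T"
  unfolding noetherian_hull_def by blast

text \<open>It suffices to invert the denominators \<open>u\<close> of the localization. If
  \<open>1 / u\<close> were not in \<open>S[1/x]\<close>, each late \<open>Rs j\<close> would have a
  discrete valuation localization containing \<open>1 / x\<close> but not \<open>1 / u\<close>. Its
  prime contains the fixed element \<open>u\<close>, so one of these rings contains
  \<open>S\<close>, properly because of \<open>1 / x\<close>, and hence contains
  \<open>T\<close>.\<close>

lemma T_Sx:
  assumes loc: "is_localization_of T (Rs 0)" shows "T \<subseteq> Sx"
proof
  obtain U where U: "U \<subseteq> Rs 0" "1 \<in> U" "0 \<notin> U" "T = {r / u | r u. r \<in> Rs 0 \<and> u \<in> U}"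
    using loc unfolding is_localization_of_def by blast
  have inv: "inverse u \<in> Sx" if u: "u \<in> U" for u
  proof (rule ccontr)
    assume n: "inverse u \<notin> Sx"
    have u0: "u \<noteq> 0" and uR: "u \<in> Rs 0" using u U by auto
    obtain i where i: "x \<in> m i" using xN by (auto simp: N_def)
    have "x ^ k * inverse u \<notin> Rs j" for j k
    proof
      assume "x ^ k * inverse u \<in> Rs j"
      then have "x ^ k * inverse u / x ^ k \<in> Sx" by (intro Sx_I S_I)
      then show False using n x0 by simp
    qed
    moreover have xj: "x \<in> Rs j" if "j \<ge> i" for j using m_sub[OF i] Rs_mono[OF that] by blast
    ultimately have "\<forall>j. \<exists>p. j \<ge> i \<longrightarrow> prime_ideal (Rs j) p \<and> x \<notin> p \<and> DVR (localize_at (Rs j) p) \<and>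
        inverse u \<notin> localize_at (Rs j) p"
      using exists_prime_DVR[of x] by blast
    from choice[OF this] obtain p where p: "\<And>j. j \<ge> i \<Longrightarrow> prime_ideal (Rs j) (p j)"
      "\<And>j. j \<ge> i \<Longrightarrow> x \<notin> p j" "\<And>j. j \<ge> i \<Longrightarrow> DVR (localize_at (Rs j) (p j))"
      "\<And>j. j \<ge> i \<Longrightarrow> inverse u \<notin> localize_at (Rs j) (p j)" by blast
    have uj: "u \<in> Rs j" for j using uR Rs_mono[of 0 j] by auto
    have "\<exists>j\<ge>i. S \<subseteq> localize_at (Rs j) (p j)"
    proof (rule persistent_localization[OF uj[of i] u0 p(1) _ p(3)])
      show "\<not> m i \<subseteq> p j" if "j \<ge> i" for j using i p(2)[OF that] by blast
      show "u \<in> p j" if j: "j \<ge> i" for j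
      proof (rule ccontr)
        assume "u \<notin> p j"
        then have "inverse u \<in> localize_at (Rs j) (p j)"
          by (intro localize_atI[OF subring_1[OF Rs] uj]) (simp_all add: divide_inverse)
        with p(4)[OF j] show False by simp
      qed
    qed
    then obtain j where j: "j \<ge> i" "S \<subseteq> localize_at (Rs j) (p j)" by blast
    have "inverse x \<in> localize_at (Rs j) (p j)"
      by (intro localize_atI[OF subring_1[OF Rs] xj[OF j(1)] p(2)[OF j(1)]]) (simp add: divide_inverse)
    then have "S \<subset> localize_at (Rs j) (p j)" using j(2) N_inverse[OF xN x0] by blast
    then have "T \<subseteq> localize_at (Rs j) (p j)"
      using p(3)[OF j(1)] unfolding noetherian_hull_def by blast
    moreover have "inverse u \<in> T"
      unfolding U(4) using u subring_1[OF Rs[of 0]] by (force simp: divide_inverse)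
    ultimately show False using p(4)[OF j(1)] by blast
  qed
  fix f assume "f \<in> T"
  then obtain r u where ru: "r \<in> Rs 0" "u \<in> U" "f = r / u" unfolding U(4) by blast
  obtain s k where sk: "s \<in> S" "inverse u = s / x ^ k" using inv[OF ru(2)] by (auto simp: Sx_def)
  have "f = (r * s) / x ^ k" using ru(3) sk(2) by (simp add: divide_inverse)
  then show "f \<in> Sx" using Sx_I[OF subring_mult[OF S.A S_I[OF ru(1)] sk(1)]] by simp
qed

text \<open>Discrete valuation localizations missing \<open>f = s / x ^ k\<close> have
  \<open>x ^ k\<close>, again a fixed element, in their primes, and the nonnegative orders of
  \<open>f\<close> keep these primes from containing \<open>m i\<close>. The one that contains
  \<open>S\<close> omits \<open>1 / x\<close>, so it dominates \<open>S\<close> and equals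
  it.\<close>

lemma V_Int_Sx:
  assumes f: "f \<in> V" "f \<in> Sx" shows "f \<in> S"
proof (rule ccontr)
  assume fS: "f \<notin> S"
  obtain s k where sk: "s \<in> S" "f = s / x ^ k" using f(2) by (auto simp: Sx_def)
  obtain i0 where i0: "\<forall>j\<ge>i0. v j f \<ge> 0" using f(1) by (rule V_E)
  obtain i1 where i1: "s \<in> Rs i1" "x ^ k \<in> Rs i1" using S_common[OF sk(1) x_pow_S] by blast
  define i where "i = max i0 i1"
  have b: "x ^ k \<in> Rs i" and vf: "\<And>j. j \<ge> i \<Longrightarrow> v j f \<ge> 0"
    using i1 Rs_mono[of i1 i] i0 by (auto simp: i_def)
  have "\<forall>j. \<exists>p. j \<ge> i \<longrightarrow> prime_ideal (Rs j) p \<and> DVR (localize_at (Rs j) p) \<and> f \<notin> localize_at (Rs j) p"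
  proof
    fix j
    have "f \<notin> Rs j" using fS S_I by blast
    then show "\<exists>p. j \<ge> i \<longrightarrow> prime_ideal (Rs j) p \<and> DVR (localize_at (Rs j) p) \<and> f \<notin> localize_at (Rs j) p"
      using exists_prime_DVR[OF subring_1[OF Rs], where f = f and j = j] by auto
  qed
  from choice[OF this] obtain p where p: "\<And>j. j \<ge> i \<Longrightarrow> prime_ideal (Rs j) (p j)"
    "\<And>j. j \<ge> i \<Longrightarrow> DVR (localize_at (Rs j) (p j))"
    "\<And>j. j \<ge> i \<Longrightarrow> f \<notin> localize_at (Rs j) (p j)" by blast
  have xk0: "x ^ k \<noteq> 0" using x0 by simp
  have "\<exists>j\<ge>i. S \<subseteq> localize_at (Rs j) (p j)"
  proof (rule persistent_localization[OF b xk0 p(1) _ p(2)])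
    show "\<not> m i \<subseteq> p j" if j: "j \<ge> i" for j
      by (rule contract_not_maximal[OF j p(1)[OF j] p(2)[OF j] p(3)[OF j] vf])
    show "x ^ k \<in> p j" if j: "j \<ge> i" for j
    proof (rule ccontr)
      assume n: "x ^ k \<notin> p j"
      have "x ^ k \<in> Rs j" "s \<in> Rs j" using b i1 Rs_mono[OF j] Rs_mono[of i1 j] j by (auto simp: i_def)
      then have "f \<in> localize_at (Rs j) (p j)" using n sk(2) by (intro localize_atI)
      with p(3)[OF j] show False by simp
    qed
  qed
  then obtain j where j: "j \<ge> i" "S \<subseteq> localize_at (Rs j) (p j)" by blast
  define W where "W = localize_at (Rs j) (p j)"
  have W: "DVR W" "f \<notin> W" "S \<subseteq> W" using p(2,3)[OF j(1)] j(2) by (auto simp: W_def)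
  have vW: "valuation_ring W" using W(1) by (simp add: DVR_def)
  have "inverse x \<notin> W"
  proof
    assume "inverse x \<in> W"
    then have "s * inverse x ^ k \<in> W"
      using sk(1) W(3) by (intro subring_mult subring_power DVR_subring[OF W(1)]) auto
    then show False using W(2) sk(2) by (simp add: divide_inverse power_inverse)
  qed
  then have "x \<in> nonunits W" using xS W(3) by (auto simp: nonunits_def)
  then have "W \<subseteq> S" using dominating_DVR_subset[OF W(1,3)] N_nonunits[OF vW W(3)] by blast
  then have WS: "W = S" using W(3) by blast
  \<comment> \<open>Now \<open>S\<close> is itself a discrete valuation ring with the overring
    \<open>V\<close>. This is not \<open>S\<close>, as it contains \<open>f\<close>, and not the
    field, as it omits \<open>1 / x\<close>.\<close>
  have "V \<noteq> S" using f(1) fS by blast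
  then have "V = UNIV" using DVR_overring[OF W(1) subring_V] S_V unfolding WS by blast
  then show False using N_inverse_V[OF xN x0] by blast
qed

section \<open>The equivalent conditions\<close>

definition nonarch where "nonarch \<longleftrightarrow> (\<exists>y. y \<noteq> 0 \<and> (\<forall>n. y / x ^ n \<in> S))"

lemma Inter_principal_iff: "y \<in> (\<Inter>n\<in>{0<..}. principal S (x ^ n)) \<longleftrightarrow> (\<forall>n. y / x ^ n \<in> S)"
proof -
  have pr: "y \<in> principal S (x ^ n) \<longleftrightarrow> y / x ^ n \<in> S" for n
  proof
    assume "y \<in> principal S (x ^ n)"
    then show "y / x ^ n \<in> S" using x0 by (auto simp: principal_def)
  next
    assume "y / x ^ n \<in> S"
    moreover have "y = x ^ n * (y / x ^ n)" using x0 by simp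
    ultimately show "y \<in> principal S (x ^ n)" unfolding principal_def by blast
  qed
  \<comment> \<open>The intersection runs over positive exponents; exponent zero is recovered from
    exponent one.\<close>
  have "y / x ^ n \<in> S" if h: "\<And>n. n > 0 \<Longrightarrow> y / x ^ n \<in> S" for n
  proof (cases "n = 0")
    case True
    have "x * (y / x ^ Suc 0) \<in> S" by (rule subring_mult[OF S.A xS h]) simp
    then show ?thesis using True x0 by simp
  qed (use h in simp)
  then show ?thesis unfolding INT_iff pr by auto
qed

text \<open>Every nonunit \<open>a\<close> of \<open>S\<close> has a power in \<open>xS\<close>, so
  divisibility by all powers of \<open>a\<close> implies divisibility by all powers of
  \<open>x\<close>.\<close>

lemma not_archimedean_iff: "\<not> archimedean S \<longleftrightarrow> nonarch"
proof
  define I where "I a = (\<Inter>n\<in>{0<..}. principal S (a ^ n))" for a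
  assume "\<not> archimedean S"
  then have "\<not> (\<forall>a\<in>S. \<not> unit_of S a \<longrightarrow> I a = {0})" unfolding archimedean_def I_def .
  then obtain a where a: "a \<in> S" "\<not> unit_of S a" "I a \<noteq> {0}" by auto
  have "0 \<in> principal S b" for b
    unfolding principal_def using subring_0[OF S.A] by (intro CollectI exI[of _ 0]) simp
  then have "0 \<in> I a" by (simp add: I_def)
  then obtain c where c: "c \<noteq> 0" "c \<in> I a" using a(3) by blast
  have "a \<in> N"
  proof (rule ccontr)
    assume n: "a \<notin> N"
    then have "a \<noteq> 0" using ideal_0[OF S.ideal_M] by auto
    then have "a * inverse a = 1" by simp
    then have "unit_of S a" using S.inverse_in[OF a(1) n] a(1) unfolding unit_of_def by blast
    with a(2) show False by simp
  qed
  then obtain k where k: "k > 0" "a ^ k / x \<in> S" using N_power by blast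
  have "c / x ^ n \<in> S" for n
  proof -
    \<comment> \<open>\<open>Suc n\<close> instead of \<open>n\<close> keeps the exponent positive,
      as the intersection requires; the surplus factor \<open>x\<close> does no harm.\<close>
    have "k * Suc n \<in> {0<..}" using k(1) by simp
    then have "c \<in> principal S (a ^ (k * Suc n))" using c(2) unfolding I_def by (rule INT_D[rotated])
    then obtain s where s: "s \<in> S" "c = a ^ (k * Suc n) * s" by (auto simp: principal_def)
    define w where "w = a ^ k / x"
    have "a ^ k = x * w" using x0 by (simp add: w_def)
    then have "a ^ (k * Suc n) = (x * w) ^ Suc n" by (simp only: power_mult)
    also have "\<dots> = x ^ n * (x * w ^ Suc n)" by (simp add: power_mult_distrib)
    finally have "c / x ^ n = (x * w ^ Suc n) * s" unfolding s(2) using x0 by simp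
    also have "\<dots> \<in> S"
      using k(2) unfolding w_def[symmetric] by (intro subring_mult[OF S.A] subring_power[OF S.A] xS s(1))
    finally show ?thesis .
  qed
  then show nonarch using c(1) by (auto simp: nonarch_def)
next
  assume nonarch
  then obtain y where y: "y \<noteq> 0" "\<forall>n. y / x ^ n \<in> S" by (auto simp: nonarch_def)
  have "\<not> unit_of S x"
  proof
    assume "unit_of S x"
    then obtain b where "b \<in> S" "x * b = 1" by (auto simp: unit_of_def)
    then show False using ideal_mult'[OF S.ideal_M xN, of b] S.one_notin by simp
  qed
  moreover have "y \<in> (\<Inter>n\<in>{0<..}. principal S (x ^ n))" unfolding Inter_principal_iff by (rule y(2))
  then have "(\<Inter>n\<in>{0<..}. principal S (x ^ n)) \<noteq> {0}" using y(1) by (metis singletonD)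
  ultimately show "\<not> archimedean S" using xS unfolding archimedean_def by meson
qed

text \<open>Multiplication by a denominator from \<open>Rs 0\<close> preserves divisibility by the
  powers of \<open>x\<close>, so the numerator serves as well.\<close>

lemma nonarch_Rs0:
  assumes nonarch shows "\<exists>y\<in>Rs 0. y \<noteq> 0 \<and> (\<forall>n. y / x ^ n \<in> S)"
proof -
  obtain y where y: "y \<noteq> 0" "\<forall>n. y / x ^ n \<in> S" using assms by (auto simp: nonarch_def)
  obtain a b where ab: "a \<in> Rs 0" "b \<in> Rs 0" "b \<noteq> 0" "y = a / b" using S_frac by blast
  have "a / x ^ n \<in> S" for n
  proof -
    have "y / x ^ n * b \<in> S" by (rule subring_mult[OF S.A]) (use y S_I[OF ab(2)] in auto)
    then show ?thesis using ab by simp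
  qed
  moreover have "a \<noteq> 0" using ab y by auto
  ultimately show ?thesis using ab(1) by blast
qed

text \<open>As \<open>T = S[1/x]\<close>, a common denominator of \<open>T\<close> is the same as an
  element of \<open>S\<close> divisible by all powers of \<open>x\<close>.\<close>

lemma fractional_ideal_T_iff:
  assumes loc: "is_localization_of T (Rs 0)"
  shows "fractional_ideal S T \<longleftrightarrow> nonarch"
proof
  assume "fractional_ideal S T"
  then obtain d where d: "d \<in> S" "d \<noteq> 0" "\<forall>t\<in>T. d * t \<in> S"
    unfolding fractional_ideal_def by (elim conjE bexE)
  have "d / x ^ n \<in> S" for n
  proof -
    have "1 / x ^ n \<in> T" using Sx_I[OF subring_1[OF S.A]] Sx_T by blast
    then have "d * (1 / x ^ n) \<in> S" using d(3) by blast
    then show ?thesis by simp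
  qed
  then show nonarch using d(2) by (auto simp: nonarch_def)
next
  assume nonarch
  then obtain y where y: "y \<noteq> 0" "\<forall>n. y / x ^ n \<in> S" by (auto simp: nonarch_def)
  have "y \<in> S" using y(2)[rule_format, of 0] by simp
  moreover have "y * t \<in> S" if t: "t \<in> T" for t
  proof -
    have "t \<in> Sx" using T_Sx[OF loc] t by (rule subsetD)
    then obtain s k where "s \<in> S" "t = s / x ^ k" by (auto simp: Sx_def)
    then show ?thesis using subring_mult[OF S.A y(2)[rule_format, of k]] by simp
  qed
  moreover have "T \<noteq> {0}" using subring_1[OF subring_T] by auto
  ultimately show "fractional_ideal S T"
    unfolding fractional_ideal_def
    using y(1) subring_0[OF subring_T] subring_add[OF subring_T] subring_mult[OF subring_T] S_T
    by (intro conjI ballI bexI[of _ y]) auto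
qed

text \<open>Discrete valuation rings are completely integrally closed, so the closure always lies in
  \<open>T\<close>. Equality makes \<open>1 / x\<close> almost integral, which yields a denominator
  for all its powers; conversely a common denominator of \<open>T\<close> serves for every
  \<open>S[\<theta>]\<close>.\<close>

lemma complete_integral_closure_T_iff:
  assumes loc: "is_localization_of T (Rs 0)"
  shows "complete_integral_closure S = T \<longleftrightarrow> nonarch"
proof
  assume eq: "complete_integral_closure S = T"
  have "1 / x ^ 1 \<in> T" using Sx_I[OF subring_1[OF S.A], of 1] Sx_T by blast
  then have "fractional_ideal S (ring_adjoin1 S (1 / x))"
    using eq unfolding complete_integral_closure_def by auto
  then obtain d where d: "d \<in> S" "d \<noteq> 0" "\<forall>t\<in>ring_adjoin1 S (1 / x). d * t \<in> S"
    unfolding fractional_ideal_def by (elim conjE bexE)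
  have "d / x ^ n \<in> S" for n
    using d(3) power_in_ring_adjoin1[OF S.A, of "1 / x" n] by (auto simp: power_divide)
  then show nonarch using d(2) by (auto simp: nonarch_def)
next
  assume na: nonarch
  show "complete_integral_closure S = T"
  proof
    show "complete_integral_closure S \<subseteq> T"
    proof
      fix \<theta> assume "\<theta> \<in> complete_integral_closure S"
      then obtain d where d: "d \<in> S" "d \<noteq> 0" "\<forall>t\<in>ring_adjoin1 S \<theta>. d * t \<in> S"
        unfolding complete_integral_closure_def fractional_ideal_def mem_Collect_eq by (elim conjE bexE)
      have "\<theta> \<in> W" if W: "DVR W" "S \<subset> W" for W
      proof (rule DVR_completely_integrally_closed[OF W(1) _ d(2)])
        show "d \<in> W" using d(1) W(2) by blast
        show "d * \<theta> ^ n \<in> W" for n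
          using d(3) power_in_ring_adjoin1[OF S.A, of \<theta> n] W(2) by blast
      qed
      then show "\<theta> \<in> T" unfolding noetherian_hull_def by blast
    qed
    obtain d where d: "d \<in> S" "d \<noteq> 0" "\<forall>t\<in>T. d * t \<in> S"
      using fractional_ideal_T_iff[OF loc, THEN iffD2, OF na] unfolding fractional_ideal_def
      by (elim conjE bexE)
    show "T \<subseteq> complete_integral_closure S"
    proof
      fix \<theta> assume \<theta>: "\<theta> \<in> T"
      let ?B = "ring_adjoin1 S \<theta>"
      have sub: "?B \<subseteq> T"
        unfolding ring_adjoin1_def
        using S_T by (auto intro!: subring_sum[OF subring_T] subring_mult[OF subring_T] subring_power[OF subring_T] \<theta>)
      have one: "1 \<in> ?B" using power_in_ring_adjoin1[OF S.A, of \<theta> 0] by simp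
      have add: "a + b \<in> ?B" if ab: "a \<in> ?B" "b \<in> ?B" for a b
      proof -
        obtain n c where c: "a = (\<Sum>k<n. c k * \<theta> ^ k)" "\<forall>k<n. c k \<in> S" using ab(1) by (auto simp: ring_adjoin1_def)
        obtain l e where e: "b = (\<Sum>k<l. e k * \<theta> ^ k)" "\<forall>k<l. e k \<in> S" using ab(2) by (auto simp: ring_adjoin1_def)
        let ?g = "\<lambda>k. (if k < n then c k else 0) + (if k < l then e k else 0)"
        have "a = (\<Sum>k<max n l. (if k < n then c k else 0) * \<theta> ^ k)"
          unfolding c(1) by (rule sum.mono_neutral_cong_left) auto
        moreover have "b = (\<Sum>k<max n l. (if k < l then e k else 0) * \<theta> ^ k)"
          unfolding e(1) by (rule sum.mono_neutral_cong_left) auto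
        ultimately have eq: "a + b = (\<Sum>k<max n l. ?g k * \<theta> ^ k)"
          by (simp add: sum.distrib distrib_right)
        have "\<forall>k<max n l. ?g k \<in> S" using c(2) e(2) subring_0[OF S.A] subring_add[OF S.A] by auto
        then show ?thesis using eq by (rule ring_adjoin1I)
      qed
      have scale: "r * a \<in> ?B" if ra: "a \<in> ?B" "r \<in> S" for a r
      proof -
        obtain n c where c: "a = (\<Sum>k<n. c k * \<theta> ^ k)" "\<forall>k<n. c k \<in> S" using ra(1) by (auto simp: ring_adjoin1_def)
        have "\<forall>k<n. r * c k \<in> S" using c(2) subring_mult[OF S.A ra(2)] by auto
        then show ?thesis
          by (rule ring_adjoin1I) (simp add: c(1) sum_distrib_left mult.assoc)
      qed
      have zero: "0 \<in> ?B" using scale[OF one subring_0[OF S.A]] by simp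
      have "?B \<noteq> {0}" using one by auto
      then have "fractional_ideal S ?B"
        unfolding fractional_ideal_def using zero add scale d sub by (intro conjI ballI bexI[of _ d]) auto
      then show "\<theta> \<in> complete_integral_closure S" by (simp add: complete_integral_closure_def)
    qed
  qed
qed

text \<open>The largest prime of the valuation ring \<open>V\<close> that does not contain
  \<open>x\<close>.\<close>

definition PV where "PV = {f. \<forall>n. f / x ^ n \<in> V}"

lemma inverse_x_V: "1 / x \<notin> V"
  using N_inverse_V[OF xN x0] by (simp add: divide_inverse)

lemma prime_PV: "prime_ideal V PV"
  unfolding prime_ideal_def ideal_def
proof (intro conjI ballI impI)
  show "PV \<subseteq> V"
  proof
    fix f assume "f \<in> PV"
    then have "f / x ^ 0 \<in> V" unfolding PV_def by blast
    then show "f \<in> V" by simp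
  qed
  show "0 \<in> PV" using subring_0[OF subring_V] by (simp add: PV_def)
  show "a + b \<in> PV" if "a \<in> PV" "b \<in> PV" for a b
    using that subring_add[OF subring_V] by (simp add: PV_def add_divide_distrib)
  show "r * a \<in> PV" if "a \<in> PV" "r \<in> V" for a r
    using that subring_mult[OF subring_V, of r] by (simp add: PV_def flip: times_divide_eq_right)
  have "1 \<notin> PV" using inverse_x_V unfolding PV_def by (metis (mono_tags, lifting) mem_Collect_eq power_one_right)
  then show "PV \<noteq> V" using subring_1[OF subring_V] by blast
  fix a b assume ab: "a \<in> V" "b \<in> V" "a * b \<in> PV"
  show "a \<in> PV \<or> b \<in> PV"
  proof (rule ccontr)
    assume "\<not> ?thesis"
    then obtain n k where nk: "a / x ^ n \<notin> V" "b / x ^ k \<notin> V" unfolding PV_def by blast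
    then have nz: "a \<noteq> 0" "b \<noteq> 0" using subring_0[OF subring_V] by auto
    have "inverse (a / x ^ n) \<in> V" "inverse (b / x ^ k) \<in> V"
      using V_dichotomy[of "a / x ^ n"] V_dichotomy[of "b / x ^ k"] nk nz x0 by auto
    \<comment> \<open>The extra factor in \<open>Suc (n + k)\<close> leaves exactly
      \<open>1 / x\<close> after multiplication by the two inverses.\<close>
    then have "inverse (a / x ^ n) * inverse (b / x ^ k) * (a * b / x ^ Suc (n + k)) \<in> V"
      using ab(3) unfolding PV_def by (intro subring_mult[OF subring_V]) blast+
    moreover have "inverse (a / x ^ n) * inverse (b / x ^ k) * (a * b / x ^ Suc (n + k)) = 1 / x"
      using nz x0 by (simp add: field_simps power_add)
    ultimately show False using inverse_x_V by simp
  qed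
qed

lemma PV_S_iff: "y \<in> S \<Longrightarrow> y \<in> PV \<longleftrightarrow> (\<forall>n. y / x ^ n \<in> S)"
  unfolding PV_def using V_Int_Sx[OF _ Sx_I] S_V by blast

lemma Inter_principal_eq: "(\<Inter>n\<in>{0<..}. principal S (x ^ n)) = PV \<inter> S"
proof -
  have "y \<in> S" if "\<forall>n. y / x ^ n \<in> S" for y using that[rule_format, of 0] by simp
  then show ?thesis unfolding set_eq_iff Inter_principal_iff using PV_S_iff by blast
qed

lemma prime_Inter_principal: "prime_ideal S (\<Inter>n\<in>{0<..}. principal S (x ^ n))"
  unfolding Inter_principal_eq by (rule prime_contract[OF S.A subring_V S_V prime_PV])

lemma Inter_principal_nonzero_iff: "(\<Inter>n\<in>{0<..}. principal S (x ^ n)) \<noteq> {0} \<longleftrightarrow> nonarch"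
proof -
  have "0 \<in> (\<Inter>n\<in>{0<..}. principal S (x ^ n))" using subring_0[OF S.A] by (simp only: Inter_principal_iff) simp
  then have "(\<Inter>n\<in>{0<..}. principal S (x ^ n)) \<noteq> {0} \<longleftrightarrow> (\<exists>y. y \<noteq> 0 \<and> y \<in> (\<Inter>n\<in>{0<..}. principal S (x ^ n)))"
    by blast
  then show ?thesis unfolding Inter_principal_iff nonarch_def .
qed

text \<open>A prime of \<open>V\<close> not lying over \<open>N\<close> omits \<open>x\<close>,
  because a prime of \<open>S\<close> containing \<open>x\<close> is \<open>N\<close>. By
  comparability in \<open>V\<close> its elements are divisible by all powers of \<open>x\<close>;
  clearing a denominator and intersecting with \<open>S[1/x]\<close> moves this to \<open>S\<close>.
  Conversely \<open>PV\<close> is such a prime.\<close>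

lemma boundary_prime_iff:
  "(\<exists>P. prime_ideal V P \<and> P \<noteq> {0} \<and> P \<noteq> max_ideal V \<and> P \<inter> S \<noteq> N) \<longleftrightarrow> nonarch"
proof
  interpret V: quasi_local V "nonunits V" by (rule valuation_ring_quasi_local[OF valuation_ring_V])
  {
    assume nonarch
    then obtain y where y: "y \<noteq> 0" "\<forall>n. y / x ^ n \<in> S" by (auto simp: nonarch_def)
    have "y \<in> PV" using y(2) S_V by (auto simp: PV_def)
    then have "PV \<noteq> {0}" using y(1) by blast
    have "x / x ^ 2 \<notin> V" using inverse_x_V x0 by (simp add: power2_eq_square)
    then have xP: "x \<notin> PV" unfolding PV_def by blast
    then have "PV \<inter> S \<noteq> N" using xN by blast
    moreover have "x \<in> nonunits V"
      using inverse_x_V xS S_V by (auto simp: nonunits_def divide_inverse)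
    then have "PV \<noteq> max_ideal V" using xP V.max_ideal_eq by blast
    ultimately show "\<exists>P. prime_ideal V P \<and> P \<noteq> {0} \<and> P \<noteq> max_ideal V \<and> P \<inter> S \<noteq> N"
      using prime_PV \<open>PV \<noteq> {0}\<close> by blast
  }
  assume "\<exists>P. prime_ideal V P \<and> P \<noteq> {0} \<and> P \<noteq> max_ideal V \<and> P \<inter> S \<noteq> N"
  then obtain P where P: "prime_ideal V P" "P \<noteq> {0}" "P \<inter> S \<noteq> N" by blast
  note iP = prime_ideal_ideal[OF P(1)]
  have PS: "prime_ideal S (P \<inter> S)" by (rule prime_contract[OF S.A subring_V S_V P(1)])
  have xP: "x \<notin> P"
  proof
    assume xP: "x \<in> P"
    have "N \<subseteq> P \<inter> S"
    proof
      fix a assume a: "a \<in> N"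
      then obtain k where k: "a ^ k / x \<in> S" using N_power by blast
      have "a ^ k / x * x \<in> P \<inter> S" using k xP xS by (intro ideal_mult[OF prime_ideal_ideal[OF PS]]) auto
      then have "a ^ k \<in> P \<inter> S" using x0 by simp
      then show "a \<in> P \<inter> S" by (rule prime_ideal_power[OF S.A PS S.M_sub[OF a]])
    qed
    then show False using P(3) S.prime_subset_M[OF PS] by blast
  qed
  obtain p where p: "p \<in> P" "p \<noteq> 0" using P(2) ideal_0[OF iP] by blast
  \<comment> \<open>Otherwise \<open>x ^ n\<close> would be a multiple of \<open>p\<close> in
    \<open>V\<close> and lie in \<open>P\<close>.\<close>
  have pV: "p / x ^ n \<in> V" for n
  proof (rule ccontr)
    assume "p / x ^ n \<notin> V"
    then have "inverse (p / x ^ n) \<in> V" using V_dichotomy[of "p / x ^ n"] p(2) x0 by auto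
    then have "inverse (p / x ^ n) * p \<in> P" by (rule ideal_mult[OF iP p(1)])
    then have "x ^ n \<in> P" using p(2) by simp
    moreover have "x \<in> V" using xS S_V by blast
    ultimately show False using prime_ideal_power[OF subring_V P(1)] xP by blast
  qed
  obtain a b where ab: "a \<in> Rs 0" "b \<in> Rs 0" "b \<noteq> 0" "p = a / b" using S_frac by blast
  have "a / x ^ n \<in> V" for n
  proof -
    have "p / x ^ n * b \<in> V" using S_V S_I[OF ab(2)] by (intro subring_mult[OF subring_V pV]) blast
    then show ?thesis using ab by simp
  qed
  then have "a / x ^ n \<in> S" for n using V_Int_Sx[OF _ Sx_I[OF S_I[OF ab(1)]]] by blast
  moreover have "a \<noteq> 0" using ab p by auto
  ultimately show nonarch by (auto simp: nonarch_def)
qed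

text \<open>For fixed \<open>n\<close> the growth condition puts \<open>y / x ^ n\<close> into
  \<open>V\<close>, and \<open>V_Int_Sx\<close> turns this into membership in \<open>S\<close>.
  Conversely an element of \<open>S\<close> has nonnegative orders from some stage on, where
  \<open>x\<close> is available too.\<close>

lemma order_growth_iff:
  "(\<exists>y\<in>Rs 0. y \<noteq> 0 \<and> (\<forall>n::nat>0. \<forall>\<^sub>F i in sequentially. x \<in> Rs i \<and> v i y \<ge> int n * v i x)) \<longleftrightarrow> nonarch"
proof
  have vd: "v i (y / x ^ n) = v i y - int n * v i x" if "y \<noteq> 0" for i y n
    using v_divide[OF that, of "x ^ n" i] v_power[OF x0] x0 by simp
  {
    assume "\<exists>y\<in>Rs 0. y \<noteq> 0 \<and> (\<forall>n::nat>0. \<forall>\<^sub>F i in sequentially. x \<in> Rs i \<and> v i y \<ge> int n * v i x)"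
    then obtain y where y: "y \<in> Rs 0" "y \<noteq> 0"
      "\<And>n::nat. n > 0 \<Longrightarrow> \<forall>\<^sub>F i in sequentially. x \<in> Rs i \<and> v i y \<ge> int n * v i x" by blast
    have "y / x ^ n \<in> S" for n
    proof (cases "n = 0")
      case True
      then show ?thesis using S_I[OF y(1)] by simp
    next
      case False
      then have "\<forall>\<^sub>F i in sequentially. v i (y / x ^ n) \<ge> 0"
        using y(3)[of n] by (auto simp: vd[OF y(2)] elim: eventually_mono)
      then have "y / x ^ n \<in> V" by (simp add: boundary_valuation_ring_def)
      then show ?thesis by (rule V_Int_Sx[OF _ Sx_I[OF S_I[OF y(1)]]])
    qed
    then show nonarch using y(2) by (auto simp: nonarch_def)
  }
  assume nonarch
  then obtain y where y: "y \<in> Rs 0" "y \<noteq> 0" "\<forall>n. y / x ^ n \<in> S" using nonarch_Rs0 by blast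
  have "\<forall>\<^sub>F i in sequentially. x \<in> Rs i \<and> v i y \<ge> int n * v i x" for n :: nat
  proof -
    obtain k where k: "y / x ^ n \<in> Rs k" "x \<in> Rs k" using S_common[OF _ xS] y(3) by blast
    have "x \<in> Rs i \<and> v i y \<ge> int n * v i x" if "i \<ge> k" for i
      using k Rs_mono[OF that] v_nonneg[of "y / x ^ n" i] vd[OF y(2), of i n] by auto
    then show ?thesis unfolding eventually_sequentially by blast
  qed
  then show "\<exists>y\<in>Rs 0. y \<noteq> 0 \<and> (\<forall>n::nat>0. \<forall>\<^sub>F i in sequentially. x \<in> Rs i \<and> v i y \<ge> int n * v i x)"
    using y(1,2) by blast
qed

end

theorem theorem6p9:
  fixes Rs :: "nat \<Rightarrow> 'a::field set" and R S N T Sstar :: "'a set" and x :: 'a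
  assumes R0: "Rs 0 = R"
    and RF: "has_quotient_field_F R"
    and reg: "\<And>i. regular_local (Rs i)"
    and dim: "\<And>i. krull_dim (Rs i) \<ge> 2"
    and lqt: "\<And>i. local_quadratic_transform (Rs i) (Rs (Suc i))"
    and strict: "\<And>i. Rs i \<subset> Rs (Suc i)"
    and S_def: "S = (\<Union>i. Rs i)"
    and N_def: "N = (\<Union>i. max_ideal (Rs i))"
    and xS: "x \<in> S"
    and primary: "radical S (principal S x) = N"
    and T_def: "T = noetherian_hull S"
    and T_loc: "is_localization_of T R"
    and Sstar_def: "Sstar = complete_integral_closure S"
  shows "(\<not> archimedean S \<longleftrightarrow> fractional_ideal S T)
    \<and> (\<not> archimedean S \<longleftrightarrow> Sstar = T)
    \<and> (\<not> archimedean S \<longleftrightarrow> (\<exists>P. prime_ideal (boundary_valuation_ring Rs) P \<and> P \<noteq> {0}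
            \<and> P \<noteq> max_ideal (boundary_valuation_ring Rs) \<and> P \<inter> S \<noteq> N))
    \<and> (\<not> archimedean S \<longleftrightarrow> (let I = (\<Inter>n\<in>{0<..}. principal S (x ^ n)) in I \<noteq> {0} \<and> prime_ideal S I))
    \<and> (\<not> archimedean S \<longleftrightarrow> (\<exists>y\<in>R. y \<noteq> 0 \<and> (\<forall>n::nat>0.
            \<forall>\<^sub>F i in sequentially. x \<in> Rs i \<and> ordF (Rs i) y \<ge> int n * ordF (Rs i) x)))"
proof -
  interpret seq: shannon_sequence Rs
    by unfold_locales (use R0 RF reg dim lqt strict in auto)
  have SN: "S = seq.S" "N = seq.N" by (simp_all add: S_def N_def seq.S_def seq.N_def)
  interpret shannon_primary Rs x
    by unfold_locales (use xS primary SN in auto)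
  have loc: "is_localization_of (noetherian_hull seq.S) (Rs 0)"
    using T_loc unfolding T_def R0 SN .
  \<comment> \<open>The intersection of the ideals \<open>x ^ n S\<close> is prime in every case, so
    the condition on it amounts to being nonzero.\<close>
  show ?thesis
    unfolding T_def Sstar_def SN R0[symmetric] Let_def not_archimedean_iff
      fractional_ideal_T_iff[OF loc] complete_integral_closure_T_iff[OF loc] boundary_prime_iff
      order_growth_iff Inter_principal_nonzero_iff
    using prime_Inter_principal by simp
qed

end
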